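(* Let $\lambda>0$, and let $\psi\in C^\infty([0,\infty))$ be a fixed real-valued cutoff function with $\psi(r)=0$ for $r$ near $0$ and $\psi(r)=1$ for $r\ge 1$. For $(\hat u,\hat w)\in W^{1,2}_{\rm loc}((0,\infty),\mathbb{R}^2)$ put $$\rho_\lambda(r)=(\hat w^2-1+\hat u')^2+\Big(\frac{\hat u}{r}\Big)^2+\lambda^2\Big(\hat w'^2+\frac{\hat w^2}{r^2}\Big),$$ let $$\mathcal W=\Big\{(\hat u,\hat w)\in W^{1,2}_{\rm loc}((0,\infty),\mathbb{R}^2):\ \int_0^1 \rho_\lambda(r)\,r\,dr<\infty\Big\},$$ and for $(\hat u,\hat w)\in\mathcal W$ let $$\hat E_\lambda(\hat u,\hat w)=\lim_{R\to\infty}\int_0^R\Big(\rho_\lambda(r)-\lambda^2\frac{\psi(r/\lambda)^2}{r^2}\Big)\,r\,dr .$$ Then the functional $\hat E_\lambda:\mathcal W\to\mathbb{R}\cup\{+\infty\}$ is well defined (i.e. the limit exists in $\mathbb{R}\cup\{+\infty\}$ for every $(\hat u,\hat w)\in\mathcal W$) and bounded from below. It possesses minimizers $(\hat u,\hat w)$ in $\mathcal W$ with $\hat w\ge 0$ and $\hat E_\lambda(\hat u,\hat w)<\infty$. Furthermore, each minimizer $(\hat u,\hat w)$ of $\hat E_\lambda$ in $\mathcal W$ with $\hat w\ge 0$ satisfies, for any $\sigma<2$, $$\hat u(r)=\frac{\lambda^2}{2r}+o\big(\exp(-\sigma\sqrt{r/\lambda})\big),\qquad \hat w(r)=1+o\big(\exp(-\sigma\sqrt{r/\lambda})\big)\qquad\text{as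 } r\to\infty .$$
   Context: $W^{1,2}_{\rm loc}((0,\infty),\mathbb{R}^2)$ is the space of pairs of real functions belonging to $W^{1,2}$ on every compact subinterval of $(0,\infty)$; functions in this space are always identified with their continuous representatives, and primes denote (weak) derivatives in $r$. *)

theory Defs
  imports "HOL-Analysis.Analysis" "HOL-Library.Landau_Symbols"
begin

text \<open>Derivatives at endpoints are one-sided. Only meant for sets without isolated points.\<close>

definition smooth_on :: "real set \<Rightarrow> (real \<Rightarrow> real) \<Rightarrow> bool" where
  "smooth_on S f \<longleftrightarrow>
     (\<exists>d :: nat \<Rightarrow> real \<Rightarrow> real. (\<forall>x\<in>S. d 0 x = f x) \<and>
        (\<forall>n. \<forall>x\<in>S. (d n has_real_derivative d (Suc n) x) (at x within S)))"

definition cutoff :: "(real \<Rightarrow> real) \<Rightarrow> bool" where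
  "cutoff \<psi> \<longleftrightarrow> smooth_on {0..} \<psi> \<and> (\<exists>\<epsilon>>0. \<forall>r. 0 \<le> r \<and> r < \<epsilon> \<longrightarrow> \<psi> r = 0) \<and> (\<forall>r\<ge>1. \<psi> r = 1)"

definition test_function :: "real set \<Rightarrow> (real \<Rightarrow> real) \<Rightarrow> bool" where
  "test_function S \<phi> \<longleftrightarrow>
     smooth_on UNIV \<phi> \<and> (\<exists>K. compact K \<and> K \<subseteq> S \<and> (\<forall>x. x \<notin> K \<longrightarrow> \<phi> x = 0))"

definition L2_on :: "real set \<Rightarrow> (real \<Rightarrow> real) \<Rightarrow> bool" where
  "L2_on S f \<longleftrightarrow> set_borel_measurable lborel S f \<and> set_integrable lborel S (\<lambda>x. (f x)\<^sup>2)"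

definition has_weak_deriv_on :: "real set \<Rightarrow> (real \<Rightarrow> real) \<Rightarrow> (real \<Rightarrow> real) \<Rightarrow> bool" where
  "has_weak_deriv_on S f g \<longleftrightarrow>
     (\<forall>\<phi>. test_function S \<phi> \<longrightarrow>
        (LINT x:S|lborel. f x * deriv \<phi> x) = - (LINT x:S|lborel. g x * \<phi> x))"

text \<open>One \<open>g\<close> serves as the square-integrable weak derivative on all compact subintervals of the open half-line.
  Since weak derivatives are unique up to null sets, this is the same as one per subinterval.\<close>

definition has_W12_loc_deriv :: "(real \<Rightarrow> real) \<Rightarrow> (real \<Rightarrow> real) \<Rightarrow> bool" where
  "has_W12_loc_deriv f g \<longleftrightarrow>
     (\<forall>a b. 0 < a \<and> a < b \<longrightarrow>
        L2_on {a<..<b} f \<and> L2_on {a<..<b} g \<and> has_weak_deriv_on {a<..<b} f g)"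

text \<open>Continuity selects the continuous representative. Values at \<open>r \<le> 0\<close> are irrelevant.\<close>

definition W12_loc :: "(real \<Rightarrow> real) set" where
  "W12_loc = {f. continuous_on {0<..} f \<and> (\<exists>g. has_W12_loc_deriv f g)}"

text \<open>The weak derivative is unique up to null sets on the open half-line, and it is only
  used under integrals over subsets of the open half-line, so the choice does not matter.\<close>

definition weak_deriv :: "(real \<Rightarrow> real) \<Rightarrow> real \<Rightarrow> real" where
  "weak_deriv f = (SOME g. has_W12_loc_deriv f g)"

definition rho :: "real \<Rightarrow> (real \<Rightarrow> real) \<Rightarrow> (real \<Rightarrow> real) \<Rightarrow> real \<Rightarrow> real" where
  "rho lam u w r =
     ((w r)\<^sup>2 - 1 + weak_deriv u r)\<^sup>2 + (u r / r)\<^sup>2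
       + lam\<^sup>2 * ((weak_deriv w r)\<^sup>2 + (w r)\<^sup>2 / r\<^sup>2)"

definition admissible :: "real \<Rightarrow> ((real \<Rightarrow> real) \<times> (real \<Rightarrow> real)) set" where
  "admissible lam =
     {(u, w). u \<in> W12_loc \<and> w \<in> W12_loc \<and>
        (\<integral>\<^sup>+ r\<in>{0<..<1}. ennreal (rho lam u w r * r) \<partial>lborel) < \<infinity>}"

definition renormalized_density ::
    "real \<Rightarrow> (real \<Rightarrow> real) \<Rightarrow> (real \<Rightarrow> real) \<Rightarrow> (real \<Rightarrow> real) \<Rightarrow> real \<Rightarrow> real" where
  "renormalized_density lam \<psi> u w r = (rho lam u w r - lam\<^sup>2 * ((\<psi> (r / lam))\<^sup>2 / r\<^sup>2)) * r"

definition truncated_energy ::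
    "real \<Rightarrow> (real \<Rightarrow> real) \<Rightarrow> (real \<Rightarrow> real) \<Rightarrow> (real \<Rightarrow> real) \<Rightarrow> real \<Rightarrow> real" where
  "truncated_energy lam \<psi> u w R = (LINT r:{0<..<R}|lborel. renormalized_density lam \<psi> u w r)"

definition energy ::
    "real \<Rightarrow> (real \<Rightarrow> real) \<Rightarrow> (real \<Rightarrow> real) \<Rightarrow> (real \<Rightarrow> real) \<Rightarrow> ereal" where
  "energy lam \<psi> u w = Lim at_top (\<lambda>R. ereal (truncated_energy lam \<psi> u w R))"

definition is_minimizer ::
    "real \<Rightarrow> (real \<Rightarrow> real) \<Rightarrow> (real \<Rightarrow> real) \<Rightarrow> (real \<Rightarrow> real) \<Rightarrow> bool" where
  "is_minimizer lam \<psi> u w \<longleftrightarrow>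
     (u, w) \<in> admissible lam \<and>
     (\<forall>(u', w') \<in> admissible lam. energy lam \<psi> u w \<le> energy lam \<psi> u' w')"

end

theory Submission
  imports Defs "HOL-Complex_Analysis.Great_Picard" "HOL-Real_Asymp.Real_Asymp"
begin

text \<open>For \<open>r \<ge> \<lambda>\<close> one completes squares around the exact solution \<open>w = 1\<close>, \<open>u = \<lambda>\<^sup>2/(2r)\<close>. The
  renormalized energy then becomes the integral of a nonnegative density plus the boundary value
  \<open>\<lambda> u(\<lambda>)\<close> and a constant, provided \<open>u(R)/R\<close> vanishes at infinity. This last point holds because
  \<open>U = u - \<lambda>\<^sup>2/(2r)\<close> satisfies the one-sided bound \<open>U' \<le> 1 + Y\<close> with \<open>Y\<close> and \<open>U/r\<close> square integrable for
  \<open>r dr\<close>. The same bound controls \<open>\<lambda> u(\<lambda>)\<close> from below.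

  Minimizers come from the direct method: pointwise convergence of a subsequence by equicontinuity, weak
  lower semicontinuity by Mazur's lemma, and \<open>w\<close> may be replaced by \<open>|w|\<close>.

  For a minimizer put \<open>q = r(w\<^sup>2 - 1 + U')\<close>. The Euler-Lagrange equations are \<open>r q' = U\<close> and
  \<open>\<lambda>\<^sup>2(r w')' = 2qw\<close>. Since \<open>w \<rightarrow> 1\<close>, in the variable \<open>s = 2\<surd>(r/\<lambda>)\<close> they say that
  \<open>Z = \<lambda>(w - 1) + iq\<close> solves \<open>Z'' = -2iZ\<close> up to small errors. The growing mode is excluded by the
  polynomial growth of \<open>Z\<close>, and the other one decays like \<open>exp(-s)\<close>.\<close>

subsection \<open>Absolutely continuous functions\<close>

text \<open>The weak derivative is an a.e. class picked by \<open>SOME\<close>, so all analysis is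
  done with pairs \<open>f\<close>, \<open>g\<close> where \<open>f\<close> is an indefinite
  integral of \<open>g\<close>; \<open>W12_loc_primitive\<close> and
  \<open>primitive_W12_loc\<close> translate once and for all. The split at \<lambda> is dictated by
  the cutoff: beyond \<lambda> it equals 1 and the counterterm can be completed to squares, below
  \<lambda> it contributes a constant. The price is the boundary value \<lambda> u(\<lambda>), which
  has no sign; the problem stays coercive because this value is bounded below by minus half of the
  square energy, up to a constant. The bound on U' is one-sided because U' = Y + 1 - w^2 and no
  pointwise upper bound on w^2 is at hand. The strain Y is nonlinear in w, so the direct method is
  not applied to u but to w and to a primitive of Y; u is recovered from their pointwise limits.
  Decay is obtained for each \<sigma> < 2 only, because the errors in the linearised system are
  known to tend to 0 without a rate, which costs an arbitrarily small part of the exponent.\<close>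

definition ac_on :: "real \<Rightarrow> real \<Rightarrow> (real \<Rightarrow> real) \<Rightarrow> (real \<Rightarrow> real) \<Rightarrow> bool" where
  "ac_on a b f g \<longleftrightarrow> set_integrable lborel {a..b} g \<and>
     (\<forall>x y. a \<le> x \<longrightarrow> x \<le> y \<longrightarrow> y \<le> b \<longrightarrow> f y - f x = (LINT t:{x..y}|lborel. g t))"

lemma set_integrable_subinterval:
  fixes g :: "real \<Rightarrow> real"
  assumes "set_integrable lborel {a..b} g" "a \<le> x" "y \<le> b"
  shows "set_integrable lborel {x..y} g"
  by (rule set_integrable_subset[OF assms(1)]) (use assms in auto)

lemma set_integral_singleton:
  fixes g :: "real \<Rightarrow> real"
  shows "(LINT t:{x..x}|lborel. g t) = 0"
  unfolding set_lebesgue_integral_def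
  by (rule integral_eq_zero_AE, rule eventually_mono[OF AE_lborel_singleton[of x]]) (auto simp: indicator_def)

lemma set_integral_combine:
  fixes g :: "real \<Rightarrow> real"
  assumes "set_integrable lborel {a..c} g" "a \<le> b" "b \<le> c"
  shows "(LINT t:{a..c}|lborel. g t) = (LINT t:{a..b}|lborel. g t) + (LINT t:{b..c}|lborel. g t)"
proof -
  note 1 = set_borel_integral_eq_integral[OF assms(1)]
  note 2 = set_borel_integral_eq_integral[OF set_integrable_subinterval[OF assms(1) order_refl assms(3)]]
  note 3 = set_borel_integral_eq_integral[OF set_integrable_subinterval[OF assms(1) assms(2) order_refl]]
  show ?thesis
    using Henstock_Kurzweil_Integration.integral_combine[OF assms(2,3) 1(1)] 1 2 3 by simp
qed

lemma set_integrable_cont_mult: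
  fixes g h :: "real \<Rightarrow> real"
  assumes "continuous_on {a..b} h" "set_integrable lborel {a..b} g"
  shows "set_integrable lborel {a..b} (\<lambda>x. h x * g x)"
proof -
  have "bounded (h ` {a..b})"
    by (intro compact_imp_bounded compact_continuous_image assms) simp
  then obtain B where B: "\<And>x. x \<in> {a..b} \<Longrightarrow> \<bar>h x\<bar> \<le> B"
    unfolding bounded_iff by (metis image_eqI real_norm_def)
  have m1: "(\<lambda>x. indicator {a..b} x * h x) \<in> borel_measurable lborel"
    using borel_measurable_continuous_on_indicator[OF _ assms(1)] by (simp add: mult.commute)
  have m2: "(\<lambda>x. indicator {a..b} x * g x) \<in> borel_measurable lborel"
    using assms(2) unfolding set_integrable_def by simp
  have m: "(\<lambda>x. (indicator {a..b} x * h x) * (indicator {a..b} x * g x)) \<in> borel_measurable lborel"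
    using m1 m2 by simp
  have e: "(\<lambda>x. (indicator {a..b} x * h x) * (indicator {a..b} x * g x)) = (\<lambda>x. indicator {a..b} x * (h x * g x))"
    by (auto simp: indicator_def fun_eq_iff)
  have i: "integrable lborel (\<lambda>x. B * (indicator {a..b} x * g x))"
    using assms(2) unfolding set_integrable_def by simp
  show ?thesis
    unfolding set_integrable_def real_scaleR_def
    by (rule Bochner_Integration.integrable_bound[OF i m[unfolded e]])
       (auto simp: indicator_def abs_mult intro!: mult_right_mono order_trans[OF B])
qed

lemma set_integrable_continuous:
  fixes h :: "real \<Rightarrow> real"
  assumes "continuous_on {a..b} h"
  shows "set_integrable lborel {a..b} h"
  unfolding set_integrable_def by (rule borel_integrable_compact) (use assms in auto)

lemma set_integral_abs_le:
  fixes f g :: "real \<Rightarrow> real"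
  assumes "set_integrable M A f" "set_integrable M A g" "\<And>x. x \<in> A \<Longrightarrow> \<bar>f x\<bar> \<le> g x"
  shows "\<bar>LINT x:A|M. f x\<bar> \<le> (LINT x:A|M. g x)"
proof -
  have "\<bar>LINT x:A|M. f x\<bar> \<le> (LINT x:A|M. \<bar>f x\<bar>)"
    unfolding set_lebesgue_integral_def
    using integral_abs_bound[of M "\<lambda>x. indicator A x *\<^sub>R f x"] by (simp add: abs_mult)
  also have "\<dots> \<le> (LINT x:A|M. g x)"
    by (rule set_integral_mono[OF set_integrable_abs[OF assms(1)] assms(2,3)])
  finally show ?thesis .
qed

lemma ac_onD:
  assumes "ac_on a b f g" "a \<le> x" "x \<le> y" "y \<le> b"
  shows "f y - f x = (LINT t:{x..y}|lborel. g t)" "set_integrable lborel {x..y} g" "ac_on x y f g"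
  using assms set_integrable_subinterval[of a b g] unfolding ac_on_def
  by auto

lemma ac_on_continuous:
  assumes "ac_on a b f g"
  shows "continuous_on {a..b} f"
proof (cases "a \<le> b")
  case True
  have i: "set_integrable lborel {a..b} g" using assms unfolding ac_on_def by blast
  note j = set_borel_integral_eq_integral[OF i]
  have "continuous_on {a..b} (\<lambda>x. f a + integral {a..x} g)"
    by (intro continuous_intros indefinite_integral_continuous_1 j)
  moreover have "f a + integral {a..x} g = f x" if "x \<in> {a..b}" for x
    using ac_onD(1)[OF assms, of a x] that
      set_borel_integral_eq_integral(2)[OF set_integrable_subinterval[OF i, of a x]] by auto
  ultimately show ?thesis using continuous_on_cong[of "{a..b}" "{a..b}" "\<lambda>x. f a + integral {a..x} g" f] by simp
qed simp

text \<open>On a partition into equal steps shorter than \<open>d\<close> the increments of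
  \<open>M\<close> telescope, so \<open>\<bar>H b - H a\<bar> \<le> e * (M b - M a)\<close> for
  every \<open>e > 0\<close>. Nothing has to be differentiable, which is why it serves for the chain
  rule below.\<close>

lemma eq_of_local_increment_bound:
  fixes H M :: "real \<Rightarrow> real"
  assumes ab: "a \<le> b"
    and loc: "\<And>e. e > 0 \<Longrightarrow> \<exists>d>0. \<forall>x y. a \<le> x \<longrightarrow> x \<le> y \<longrightarrow> y \<le> b \<longrightarrow> y - x < d \<longrightarrow>
                 \<bar>H y - H x\<bar> \<le> e * (M y - M x)"
  shows "H b = H a"
proof -
  have "\<bar>H b - H a\<bar> \<le> e * (M b - M a)" if e: "e > 0" for e
  proof -
    obtain d where d: "d > 0"
      "\<And>x y. a \<le> x \<Longrightarrow> x \<le> y \<Longrightarrow> y \<le> b \<Longrightarrow> y - x < d \<Longrightarrow> \<bar>H y - H x\<bar> \<le> e * (M y - M x)"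
      using loc[OF e] by blast
    obtain n :: nat where n: "(b - a) / d < real n" using reals_Archimedean2 by blast
    have n0: "n > 0" using n ab d by (cases n) (auto simp: divide_less_0_iff)
    define p where "p i = a + real i * ((b - a) / real n)" for i :: nat
    have p0: "p 0 = a" and pn: "p n = b" using n0 by (auto simp: p_def)
    have st: "p (Suc i) - p i = (b - a) / real n" for i 
    proof -
      have "a + (1 + real i) * c - (a + real i * c) = c" for c by (simp add: algebra_simps)
      thus ?thesis unfolding p_def of_nat_Suc .
    qed
    have small: "(b - a) / real n < d" using n n0 d(1) by (simp add: field_simps)
    have mono: "p i \<le> p (Suc i)" for i using st[of i] ab n0 by (smt (verit) divide_nonneg_nonneg of_nat_0_le_iff)
    have lo: "a \<le> p i" for i using ab by (auto simp: p_def)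
    have hi: "p (Suc i) \<le> b" if "i < n" for i
    proof -
      have "real (Suc i) * ((b - a) / real n) \<le> real n * ((b - a) / real n)"
        by (rule mult_right_mono) (use that ab in auto)
      thus ?thesis using n0 by (simp add: p_def)
    qed
    have "\<bar>H (p n) - H (p 0)\<bar> = \<bar>\<Sum>i<n. H (p (Suc i)) - H (p i)\<bar>"
      by (subst sum_lessThan_telescope) simp
    also have "\<dots> \<le> (\<Sum>i<n. e * (M (p (Suc i)) - M (p i)))"
      by (rule order_trans[OF sum_abs sum_mono]) (use d(2) lo hi mono st small in auto)
    also have "\<dots> = e * (M (p n) - M (p 0))"
      by (subst sum_distrib_left[symmetric], subst sum_lessThan_telescope) simp
    finally show ?thesis by (simp add: p0 pn)
  qed
  hence *: "\<bar>H b - H a\<bar> \<le> e * \<bar>M b - M a\<bar>" if "e > 0" for e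
    using that by (smt (verit) mult_left_mono)
  show ?thesis
  proof (rule ccontr)
    assume "H b \<noteq> H a"
    hence pos: "\<bar>H b - H a\<bar> > 0" by simp
    \<comment> \<open>With this \<open>e\<close> the bound is at most half of
      \<open>\<bar>H b - H a\<bar>\<close>, a contradiction; the \<open>+ 1\<close> guards against
      \<open>M b = M a\<close>.\<close>
    have "\<bar>H b - H a\<bar> / (2 * (\<bar>M b - M a\<bar> + 1)) > 0" using pos by (intro divide_pos_pos mult_pos_pos add_nonneg_pos) auto
    from *[OF this] have "\<bar>H b - H a\<bar> \<le> \<bar>H b - H a\<bar> / 2 * (\<bar>M b - M a\<bar> / (\<bar>M b - M a\<bar> + 1))"
      by (simp add: field_simps)
    also have "\<dots> \<le> \<bar>H b - H a\<bar> / 2 * 1" by (rule mult_left_mono) (auto simp: field_simps)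
    finally show False using pos by simp
  qed
qed

text \<open>No pointwise derivative of \<open>f\<close> is used. The difference of the two sides,
  \<open>H\<close>, changes over a short interval by at most \<open>e\<close> times the integral of
  \<open>\<bar>g\<bar>\<close>, since \<phi>' composed with \<open>f\<close> is uniformly
  continuous; hence \<open>H\<close> is constant.\<close>

lemma ac_on_chain:
  assumes ac: "ac_on a b f g"
    and der: "\<And>x. (\<phi> has_real_derivative \<phi>' x) (at x)" and c: "continuous_on UNIV \<phi>'"
  shows "ac_on a b (\<lambda>x. \<phi> (f x)) (\<lambda>x. \<phi>' (f x) * g x)"
proof -
  define h where "h x = \<phi>' (f x)" for x
  have fc: "continuous_on {a..b} f" by (rule ac_on_continuous[OF ac])
  have hc: "continuous_on {a..b} h"
    unfolding h_def by (rule continuous_on_compose2[OF c fc]) simp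
  have gi: "set_integrable lborel {a..b} g" using ac unfolding ac_on_def by blast
  have hi: "set_integrable lborel {a..b} (\<lambda>x. h x * g x)" by (rule set_integrable_cont_mult[OF hc gi])
  have ga: "set_integrable lborel {a..b} (\<lambda>x. \<bar>g x\<bar>)" by (rule set_integrable_abs[OF gi])
  have key: "\<phi> (f y0) - \<phi> (f x0) = (LINT t:{x0..y0}|lborel. h t * g t)"
    if xy0: "a \<le> x0" "x0 \<le> y0" "y0 \<le> b" for x0 y0
  proof -
    define H where "H x = \<phi> (f x) - (LINT t:{x0..x}|lborel. h t * g t)" for x
    define M where "M x = (LINT t:{x0..x}|lborel. \<bar>g t\<bar>)" for x
    have "H y0 = H x0"
    proof (rule eq_of_local_increment_bound[where M = M, OF xy0(2)])
      fix e :: real assume e: "e > 0"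
      have "uniformly_continuous_on {a..b} h" by (rule compact_uniformly_continuous[OF hc]) simp
      then obtain d where d: "d > 0" "\<And>s t. s \<in> {a..b} \<Longrightarrow> t \<in> {a..b} \<Longrightarrow> dist t s < d \<Longrightarrow> dist (h t) (h s) < e"
        using e unfolding uniformly_continuous_on_def by metis
      have "\<bar>H y - H x\<bar> \<le> e * (M y - M x)" if xy: "x0 \<le> x" "x \<le> y" "y \<le> y0" "y - x < d" for x y
      proof -
        have sub: "a \<le> x" "y \<le> b" using xy xy0 by auto
        have "(LINT t:{x0..y}|lborel. h t * g t) = (LINT t:{x0..x}|lborel. h t * g t) + (LINT t:{x..y}|lborel. h t * g t)"
          by (rule set_integral_combine[OF set_integrable_subinterval[OF hi]]) (use xy xy0 in auto)
        moreover have "(LINT t:{x0..y}|lborel. \<bar>g t\<bar>) = (LINT t:{x0..x}|lborel. \<bar>g t\<bar>) + (LINT t:{x..y}|lborel. \<bar>g t\<bar>)"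
          by (rule set_integral_combine[OF set_integrable_subinterval[OF ga]]) (use xy xy0 in auto)
        ultimately have HM: "H y - H x = \<phi> (f y) - \<phi> (f x) - (LINT t:{x..y}|lborel. h t * g t)"
          "M y - M x = (LINT t:{x..y}|lborel. \<bar>g t\<bar>)"
          by (auto simp: H_def M_def)
        have i1: "set_integrable lborel {x..y} g" and i2: "set_integrable lborel {x..y} (\<lambda>x. h x * g x)"
          and i3: "set_integrable lborel {x..y} (\<lambda>x. \<bar>g x\<bar>)"
          using set_integrable_subinterval[OF gi sub] set_integrable_subinterval[OF hi sub]
            set_integrable_subinterval[OF ga sub] by auto
        \<comment> \<open>The mean value theorem yields an intermediate value \<open>z\<close>
          between \<open>f x\<close> and \<open>f y\<close>, and the intermediate value theorem
          realises \<open>z\<close> as \<open>f t0\<close>, so that \<open>h t0\<close> is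
          comparable with \<open>h\<close> on the same short interval.\<close>
        obtain t0 where t0: "t0 \<in> {x..y}" "\<phi> (f y) - \<phi> (f x) = h t0 * (f y - f x)"
        proof -
          have fc': "continuous_on {x..y} f" by (rule continuous_on_subset[OF fc]) (use sub in auto)
          consider "f x = f y" | "f x < f y" | "f y < f x" by linarith
          thus thesis
          proof cases
            case 1 thus thesis using that[of x] xy by auto
          next
            case 2
            obtain z where z: "f x < z" "z < f y" "\<phi> (f y) - \<phi> (f x) = (f y - f x) * \<phi>' z"
              using MVT2[OF 2, of \<phi> \<phi>'] der by blast
            obtain t where "t \<in> {x..y}" "f t = z"
              using IVT'[of f x z y] z xy fc' by auto
            thus thesis using that[of t] z by (auto simp: h_def)
          next
            case 3
            obtain z where z: "f y < z" "z < f x" "\<phi> (f x) - \<phi> (f y) = (f x - f y) * \<phi>' z"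
              using MVT2[OF 3, of \<phi> \<phi>'] der by blast
            obtain t where "t \<in> {x..y}" "f t = z"
              using IVT2'[of f y z x] z xy fc' by auto
            thus thesis using that[of t] z by (auto simp: h_def algebra_simps)
          qed
        qed
        have "H y - H x = (LINT t:{x..y}|lborel. h t0 * g t) - (LINT t:{x..y}|lborel. h t * g t)"
          using HM t0 ac_onD(1)[OF ac sub(1) xy(2) sub(2)] by simp
        also have "\<dots> = (LINT t:{x..y}|lborel. h t0 * g t - h t * g t)"
          by (rule set_integral_diff(2)[symmetric]) (use i1 i2 in auto)
        finally have "\<bar>H y - H x\<bar> = \<bar>LINT t:{x..y}|lborel. h t0 * g t - h t * g t\<bar>" by simp
        also have "\<dots> \<le> (LINT t:{x..y}|lborel. e * \<bar>g t\<bar>)"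
        proof (rule set_integral_abs_le)
          show "\<bar>h t0 * g t - h t * g t\<bar> \<le> e * \<bar>g t\<bar>" if "t \<in> {x..y}" for t
          proof -
            have "\<bar>h t0 - h t\<bar> \<le> e"
              using d(2)[of t t0] that t0(1) xy sub unfolding dist_real_def atLeastAtMost_iff by linarith
            hence "\<bar>h t0 - h t\<bar> * \<bar>g t\<bar> \<le> e * \<bar>g t\<bar>" by (rule mult_right_mono) simp
            thus ?thesis by (simp add: abs_mult[symmetric] algebra_simps)
          qed
        qed (use i1 i2 i3 in auto)
        finally show ?thesis using HM by simp
      qed
      thus "\<exists>d>0. \<forall>x y. x0 \<le> x \<longrightarrow> x \<le> y \<longrightarrow> y \<le> y0 \<longrightarrow> y - x < d \<longrightarrow> \<bar>H y - H x\<bar> \<le> e * (M y - M x)"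
        using d(1) by blast
    qed
    moreover have "(LINT t:{x0..x0}|lborel. h t * g t) = 0"
      by (rule set_integral_singleton)
    ultimately show ?thesis by (simp add: H_def)
  qed
  show ?thesis
    unfolding ac_on_def using hi key by (auto simp: h_def)
qed

lemma ac_on_add:
  assumes "ac_on a b f g" "ac_on a b f2 g2"
  shows "ac_on a b (\<lambda>x. f x + f2 x) (\<lambda>x. g x + g2 x)"
  unfolding ac_on_def
proof (intro conjI allI impI)
  show "set_integrable lborel {a..b} (\<lambda>x. g x + g2 x)"
    using assms unfolding ac_on_def by (intro set_integral_add) auto
  fix x y assume *: "a \<le> x" "x \<le> y" "y \<le> b"
  show "f y + f2 y - (f x + f2 x) = (LINT t:{x..y}|lborel. g t + g2 t)"
    using ac_onD(1,2)[OF assms(1) *] ac_onD(1,2)[OF assms(2) *] by (subst set_integral_add(2)) auto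
qed

lemma ac_on_cmult:
  assumes "ac_on a b f g"
  shows "ac_on a b (\<lambda>x. c * f x) (\<lambda>x. c * g x)"
  using assms unfolding ac_on_def by (auto simp: right_diff_distrib[symmetric])

lemma ac_on_diff:
  assumes "ac_on a b f g" "ac_on a b f2 g2"
  shows "ac_on a b (\<lambda>x. f x - f2 x) (\<lambda>x. g x - g2 x)"
  using ac_on_add[OF assms(1) ac_on_cmult[OF assms(2), of "-1"]] by simp

lemma ac_on_cong:
  assumes "ac_on a b f g" "\<And>x. x \<in> {a..b} \<Longrightarrow> f x = f2 x" "AE x in lborel. x \<in> {a..b} \<longrightarrow> g x = g2 x"
    "set_borel_measurable lborel {a..b} g2"
  shows "ac_on a b f2 g2"
  unfolding ac_on_def
proof (intro conjI allI impI)
  have g: "set_integrable lborel {a..b} g" using assms(1) unfolding ac_on_def by blast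
  show i: "set_integrable lborel {a..b} g2"
    using g assms(4) unfolding set_integrable_def set_borel_measurable_def
    by (rule integrable_cong_AE_imp) (use assms(3) in \<open>auto elim!: eventually_mono simp: indicator_def\<close>)
  fix x y assume *: "a \<le> x" "x \<le> y" "y \<le> b"
  have "(LINT t:{x..y}|lborel. g t) = (LINT t:{x..y}|lborel. g2 t)"
    unfolding set_lebesgue_integral_def
  proof (rule integral_cong_AE)
    show "AE t in lborel. indicator {x..y} t *\<^sub>R g t = indicator {x..y} t *\<^sub>R g2 t"
      using assms(3) * by (auto elim!: eventually_mono simp: indicator_def)
  qed (use set_integrable_subinterval[OF g *(1,3)] set_integrable_subinterval[OF i *(1,3)]
       in \<open>auto simp: set_integrable_def\<close>)
  thus "f2 y - f2 x = (LINT t:{x..y}|lborel. g2 t)"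
    using ac_onD(1)[OF assms(1) *] assms(2) * by auto
qed

text \<open>Polarisation: the product is half of the square of the sum minus the squares, and
  squares are covered by \<open>ac_on_chain\<close>.\<close>

lemma ac_on_mult:
  assumes "ac_on a b f g" "ac_on a b f2 g2"
  shows "ac_on a b (\<lambda>x. f x * f2 x) (\<lambda>x. g x * f2 x + f x * g2 x)"
proof -
  have sq: "ac_on a b (\<lambda>x. (h x)\<^sup>2) (\<lambda>x. 2 * h x * k x)" if "ac_on a b h k" for h k
    by (rule ac_on_chain[OF that, of "\<lambda>x. x\<^sup>2" "\<lambda>x. 2 * x"])
       (auto intro!: derivative_eq_intros continuous_intros)
  have "ac_on a b (\<lambda>x. (1/2) * ((f x + f2 x)\<^sup>2 - (f x)\<^sup>2 - (f2 x)\<^sup>2))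
     (\<lambda>x. (1/2) * (2 * (f x + f2 x) * (g x + g2 x) - 2 * f x * g x - 2 * f2 x * g2 x))"
    by (intro ac_on_cmult ac_on_diff sq ac_on_add assms)
  also have "(\<lambda>x. (1/2) * ((f x + f2 x)\<^sup>2 - (f x)\<^sup>2 - (f2 x)\<^sup>2)) = (\<lambda>x. f x * f2 x)"
    by (auto simp: power2_eq_square algebra_simps)
  also have "(\<lambda>x. (1/2) * (2 * (f x + f2 x) * (g x + g2 x) - 2 * f x * g x - 2 * f2 x * g2 x)) = (\<lambda>x. g x * f2 x + f x * g2 x)"
    by (auto simp: power2_eq_square algebra_simps)
  finally show ?thesis .
qed

lemma ac_on_C1:
  assumes "\<And>x. x \<in> {a..b} \<Longrightarrow> (f has_real_derivative g x) (at x within {a..b})" "continuous_on {a..b} g"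
  shows "ac_on a b f g"
  unfolding ac_on_def
proof (intro conjI allI impI)
  show i: "set_integrable lborel {a..b} g" by (rule set_integrable_continuous[OF assms(2)])
  fix x y assume *: "a \<le> x" "x \<le> y" "y \<le> b"
  have "(g has_integral (f y - f x)) {x..y}"
  proof (rule fundamental_theorem_of_calculus[OF *(2)])
    fix t assume "t \<in> {x..y}"
    thus "(f has_vector_derivative g t) (at t within {x..y})"
      using assms(1)[of t] * has_field_derivative_subset[of f "g t" t "{a..b}" "{x..y}"]
      by (auto simp: has_real_derivative_iff_has_vector_derivative)
  qed
  thus "f y - f x = (LINT t:{x..y}|lborel. g t)"
    using set_borel_integral_eq_integral(2)[OF set_integrable_subinterval[OF i *(1,3)]]
    by (simp add: integral_unique)
qed

lemma ac_on_indefinite: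
  assumes "set_integrable lborel {a..b} g" "\<And>x. x \<in> {a..b} \<Longrightarrow> f x = c + (LINT t:{a..x}|lborel. g t)"
  shows "ac_on a b f g"
  unfolding ac_on_def
proof (intro conjI allI impI assms(1))
  fix x y assume *: "a \<le> x" "x \<le> y" "y \<le> b"
  thus "f y - f x = (LINT t:{x..y}|lborel. g t)"
    using assms(2)[of x] assms(2)[of y]
      set_integral_combine[OF set_integrable_subinterval[OF assms(1) order_refl *(3)] *(1,2)] by auto
qed

lemma ac_on_combine:
  assumes "ac_on a b f g" "ac_on b c f g" "a \<le> b" "b \<le> c"
  shows "ac_on a c f g"
proof (rule ac_on_indefinite[where c = "f a"])
  have "set_integrable lborel ({a..b} \<union> {b..c}) g"
    using assms(1,2) unfolding ac_on_def by (intro set_integrable_Un) auto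
  thus i: "set_integrable lborel {a..c} g" using assms(3,4) by (simp add: ivl_disj_un_two_touch)
  fix x assume x: "x \<in> {a..c}"
  show "f x = f a + (LINT t:{a..x}|lborel. g t)"
  proof (cases "x \<le> b")
    case True thus ?thesis using ac_onD(1)[OF assms(1), of a x] x by auto
  next
    case False
    thus ?thesis using ac_onD(1)[OF assms(1), of a b] ac_onD(1)[OF assms(2), of b x] x assms(3,4)
      set_integral_combine[OF set_integrable_subinterval[OF i], of a x b] by auto
  qed
qed

subsection \<open>Smooth bump functions\<close>

lemma poly_exp_tendsto_0: "((\<lambda>y::real. poly p y * exp (- y)) \<longlongrightarrow> 0) at_top"
proof -
  have "((\<lambda>y::real. \<Sum>i\<le>degree p. coeff p i * (y ^ i / exp y)) \<longlongrightarrow> (\<Sum>i\<le>degree p. coeff p i * 0)) at_top"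
    by (intro tendsto_sum tendsto_mult tendsto_const tendsto_power_div_exp_0)
  also have "(\<lambda>y::real. \<Sum>i\<le>degree p. coeff p i * (y ^ i / exp y)) = (\<lambda>y. poly p y * exp (- y))"
    by (auto simp: poly_altdef exp_minus sum_distrib_right divide_inverse mult.assoc fun_eq_iff intro!: sum.cong)
  finally show ?thesis by simp
qed

text \<open>A family of flat functions that is closed under differentiation, so that smoothness of
  the bump needs no induction over explicit higher derivatives.\<close>

definition flatexp :: "real poly \<Rightarrow> real \<Rightarrow> real" where
  "flatexp p x = (if x > 0 then poly p (1 / x) * exp (- (1 / x)) else 0)"

lemma flatexp_uminus: "flatexp (- p) x = - flatexp p x"
  by (simp add: flatexp_def)

text \<open>In terms of y = 1/x the new polynomial is y^2 (p(y) - p'(y)). At 0 the right difference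
  quotient is y p(y) exp(-y), which tends to 0 as y tends to infinity.\<close>

lemma has_real_derivative_flatexp:
  "(flatexp p has_real_derivative flatexp ([:0, 0, 1:] * (p - pderiv p)) x) (at x)"
proof -
  consider "x > 0" | "x < 0" | "x = 0" by linarith
  thus ?thesis
  proof cases
    case 1
    have "((\<lambda>x. poly p (1 / x) * exp (- (1 / x))) has_real_derivative
            (poly (pderiv p) (1 / x) * (- (1 / x\<^sup>2)) * exp (- (1 / x)) + poly p (1 / x) * (exp (- (1 / x)) * (1 / x\<^sup>2)))) (at x)"
      by (rule derivative_eq_intros refl DERIV_chain2[OF poly_DERIV] | use 1 in \<open>simp add: power2_eq_square\<close>)+
    hence "(flatexp p has_real_derivative
            (poly (pderiv p) (1 / x) * (- (1 / x\<^sup>2)) * exp (- (1 / x)) + poly p (1 / x) * (exp (- (1 / x)) * (1 / x\<^sup>2)))) (at x)"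
      by (rule has_field_derivative_transform_within_open[where S = "{0<..}"]) (use 1 in \<open>auto simp: flatexp_def\<close>)
    thus ?thesis using 1 by (simp add: flatexp_def power2_eq_square algebra_simps)
  next
    case 2
    have "((\<lambda>x. 0) has_real_derivative 0) (at x)" by simp
    hence "(flatexp p has_real_derivative 0) (at x)"
      by (rule has_field_derivative_transform_within_open[where S = "{..<0}"]) (use 2 in \<open>auto simp: flatexp_def\<close>)
    thus ?thesis using 2 by (simp add: flatexp_def)
  next
    case 3
    have "filterlim (\<lambda>h::real. 1 / h) at_top (at_right 0)"
      using filterlim_inverse_at_top_right by (simp add: inverse_eq_divide)
    from filterlim_compose[OF poly_exp_tendsto_0[of "pCons 0 p"] this]
    have "((\<lambda>h. poly (pCons 0 p) (1 / h) * exp (- (1 / h))) \<longlongrightarrow> 0) (at_right 0)" .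
    hence r: "((\<lambda>h. flatexp p h / h) \<longlongrightarrow> 0) (at_right 0)"
      by (rule Lim_transform_eventually)
         (auto simp: eventually_at_filter flatexp_def intro!: always_eventually)
    have l: "((\<lambda>h. flatexp p h / h) \<longlongrightarrow> 0) (at_left 0)"
      by (rule Lim_transform_eventually[OF tendsto_const])
         (auto simp: eventually_at_filter flatexp_def intro!: always_eventually)
    have "((\<lambda>h. flatexp p h / h) \<longlongrightarrow> 0) (at 0)"
      by (rule filterlim_split_at[OF l r])
    thus ?thesis using 3 by (simp add: DERIV_def flatexp_def)
  qed
qed

text \<open>\<open>smooth_on\<close> asks for one whole sequence of derivatives; iterating a choice
  of derivative inside the class \<open>P\<close> produces it.\<close>

lemma smooth_onI_closed_under_deriv:
  assumes P: "P f" and step: "\<And>f. P f \<Longrightarrow> \<exists>g. P g \<and> (\<forall>x. (f has_real_derivative g x) (at x))"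
  shows "smooth_on UNIV f"
proof -
  define D where "D f = (SOME g. P g \<and> (\<forall>x. (f has_real_derivative g x) (at x)))" for f
  have D: "P (D f) \<and> (\<forall>x. (f has_real_derivative D f x) (at x))" if "P f" for f
    unfolding D_def by (rule someI_ex[OF step[OF that]])
  have "P ((D ^^ n) f)" for n by (induction n) (use P D in auto)
  thus ?thesis unfolding smooth_on_def using D by (intro exI[of _ "\<lambda>n. (D ^^ n) f"]) auto
qed

text \<open>Sums are included because the product rule turns one product into two.\<close>

inductive flat_sum :: "(real \<Rightarrow> real) \<Rightarrow> bool" where
  prod: "flat_sum (\<lambda>x. flatexp p (1 + x) * flatexp q (1 - x))"
| add: "flat_sum f \<Longrightarrow> flat_sum g \<Longrightarrow> flat_sum (\<lambda>x. f x + g x)"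

lemma flat_sum_deriv:
  assumes "flat_sum f"
  shows "\<exists>g. flat_sum g \<and> (\<forall>x. (f has_real_derivative g x) (at x))"
  using assms
proof induction
  case (prod p q)
  define D :: "real poly \<Rightarrow> real poly" where "D p = [:0, 0, 1:] * (p - pderiv p)" for p
  have D: "(flatexp p has_real_derivative flatexp (D p) x) (at x)" for p x
    unfolding D_def by (rule has_real_derivative_flatexp)
  have "((\<lambda>x. flatexp p (1 + x) * flatexp q (1 - x)) has_real_derivative
     (flatexp (D p) (1 + x) * flatexp q (1 - x) + flatexp p (1 + x) * flatexp (- D q) (1 - x))) (at x)" for x
    by (rule derivative_eq_intros DERIV_chain2[OF D] refl | simp add: flatexp_uminus)+
  moreover have "flat_sum (\<lambda>x. flatexp (D p) (1 + x) * flatexp q (1 - x) + flatexp p (1 + x) * flatexp (- D q) (1 - x))"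
    by (intro flat_sum.intros)
  ultimately show ?case by blast
next
  case (add f g)
  then obtain f' g' where "flat_sum f'" "flat_sum g'"
     "\<And>x. (f has_real_derivative f' x) (at x)" "\<And>x. (g has_real_derivative g' x) (at x)" by blast
  thus ?case by (intro exI[of _ "\<lambda>x. f' x + g' x"]) (auto intro: flat_sum.add DERIV_add)
qed

definition bump :: "real \<Rightarrow> real" where
  "bump x = flatexp 1 (1 + x) * flatexp 1 (1 - x)"

lemma smooth_bump: "smooth_on UNIV bump"
  by (rule smooth_onI_closed_under_deriv[where P = flat_sum, OF _ flat_sum_deriv])
     (auto simp: bump_def[abs_def] intro: flat_sum.prod)

lemma bump_nonneg: "bump x \<ge> 0" by (simp add: bump_def flatexp_def)
lemma bump_pos: "bump 0 > 0" by (simp add: bump_def flatexp_def)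
lemma bump_eq_0: "\<bar>x\<bar> \<ge> 1 \<Longrightarrow> bump x = 0" by (auto simp: bump_def flatexp_def)

lemma smooth_on_UNIV_has_deriv:
  assumes "smooth_on UNIV f"
  shows "(f has_real_derivative deriv f x) (at x)" "continuous_on UNIV (deriv f)"
proof -
  obtain d where d: "\<And>x. d 0 x = f x" "\<And>n x. (d n has_real_derivative d (Suc n) x) (at x)"
    using assms unfolding smooth_on_def by auto
  have f: "d 0 = f" using d(1) by auto
  have e: "deriv f = d 1" using d(2)[of 0] f by (auto intro!: ext DERIV_imp_deriv)
  show "(f has_real_derivative deriv f x) (at x)" using d(2)[of 0 x] f e by simp
  show "continuous_on UNIV (deriv f)"
    unfolding e using d(2)[of 1] by (auto intro!: continuous_at_imp_continuous_on DERIV_isCont)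
qed

lemma continuous_on_bump: "continuous_on A bump"
  using smooth_on_UNIV_has_deriv(1)[OF smooth_bump]
  by (auto intro!: continuous_at_imp_continuous_on DERIV_isCont)

lemma smooth_on_affine:
  assumes "smooth_on UNIV f"
  shows "smooth_on UNIV (\<lambda>x. f ((x - c) / \<delta>))"
proof -
  obtain d where d: "\<And>x. d 0 x = f x" "\<And>n x. (d n has_real_derivative d (Suc n) x) (at x)"
    using assms unfolding smooth_on_def by auto
  have "((\<lambda>x. d n ((x - c) / \<delta>) / \<delta> ^ n) has_real_derivative d (Suc n) ((x - c) / \<delta>) / \<delta> ^ Suc n) (at x)" for n x
  proof -
    have "((\<lambda>x. (x - c) / \<delta>) has_real_derivative 1 / \<delta>) (at x)"
      by (auto intro!: derivative_eq_intros simp: divide_inverse)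
    from DERIV_cdivide[OF DERIV_chain2[OF d(2) this], of n "\<delta> ^ n"] show ?thesis by (simp add: mult.commute)
  qed
  thus ?thesis unfolding smooth_on_def using d(1)
    by (intro exI[of _ "\<lambda>n x. d n ((x - c) / \<delta>) / \<delta> ^ n"]) auto
qed

lemma smooth_on_diff:
  assumes "smooth_on UNIV f" "smooth_on UNIV g"
  shows "smooth_on UNIV (\<lambda>x. f x - g x)"
proof -
  obtain d e where d: "\<And>x. d 0 x = f x" "\<And>n x. (d n has_real_derivative d (Suc n) x) (at x)"
    and e: "\<And>x. e 0 x = g x" "\<And>n x. (e n has_real_derivative e (Suc n) x) (at x)"
    using assms unfolding smooth_on_def by auto
  show ?thesis unfolding smooth_on_def
    by (rule exI[of _ "\<lambda>n x. d n x - e n x"]) (use d e in \<open>auto intro: DERIV_diff\<close>)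
qed

lemma smooth_antiderivative:
  assumes "smooth_on UNIV g" "\<And>x. (f has_real_derivative g x) (at x)"
  shows "smooth_on UNIV f"
proof -
  obtain d where d: "\<And>x. d 0 x = g x" "\<And>n x. (d n has_real_derivative d (Suc n) x) (at x)"
    using assms unfolding smooth_on_def by auto
  have "((case n of 0 \<Rightarrow> f | Suc n \<Rightarrow> d n) has_real_derivative (case Suc n of 0 \<Rightarrow> f | Suc n \<Rightarrow> d n) x) (at x)" for n x
    using d assms(2) by (cases n) auto
  thus ?thesis unfolding smooth_on_def by (intro exI[of _ "\<lambda>n. case n of 0 \<Rightarrow> f | Suc n \<Rightarrow> d n"]) auto
qed

text \<open>\<open>H\<close> is the integral of the bump, hence constant on both sides of [-1, 1].
  Its final value is positive: otherwise monotonicity would make \<open>H\<close> vanish on (-1, 1)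
  and so \<open>bump 0 = 0\<close>.\<close>

lemma smooth_step_exists:
  obtains H I where "smooth_on UNIV H" "\<And>x. (H has_real_derivative bump x) (at x)"
    "\<And>x. x \<le> -1 \<Longrightarrow> H x = 0" "\<And>x. x \<ge> 1 \<Longrightarrow> H x = I" "(I::real) > 0"
proof -
  define H where "H x = (if x < -1 then 0 else integral {-2..x} bump)" for x :: real
  have H': "(H has_real_derivative bump x) (at x)" for x
  proof (cases "x < -1")
    case True
    have "((\<lambda>x. 0) has_real_derivative bump x) (at x)" using bump_eq_0[of x] True by simp
    thus ?thesis
      by (rule has_field_derivative_transform_within_open[where S = "{..<-1}"]) (use True in \<open>auto simp: H_def\<close>)
  next
    case False
    have "((\<lambda>x. integral {-2..x} bump) has_real_derivative bump x) (at x within {-2..x+1})"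
      by (rule integral_has_real_derivative) (use False in \<open>auto intro: continuous_on_bump\<close>)
    hence "((\<lambda>x. integral {-2..x} bump) has_real_derivative bump x) (at x)"
      using at_within_interior[of x "{-2..x+1}"] False by simp
    moreover have "integral {-2..y} bump = H y" if "y > -2" for y
    proof (cases "y < -1")
      case True
      have "integral {-2..y} bump = integral {-2..y} (\<lambda>x. 0)"
        by (rule integral_cong) (use True in \<open>auto intro!: bump_eq_0\<close>)
      thus ?thesis using True by (simp add: H_def)
    qed (simp add: H_def)
    ultimately show ?thesis
      using has_field_derivative_transform_within_open[of "\<lambda>x. integral {-2..x} bump" "bump x" x "{-2<..}" H] False by auto
  qed
  have 0: "H x = 0" if "x \<le> -1" for x
  proof (cases "x < -1")
    case False
    hence [simp]: "x = -1" using that by simp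
    have "integral {-2..-1::real} bump = integral {-2..-1} (\<lambda>x::real. 0)"
      by (rule integral_cong) (auto intro!: bump_eq_0)
    thus ?thesis by (simp add: H_def)
  qed (simp add: H_def)
  have 1: "H x = H 1" if "x \<ge> 1" for x
  proof (rule ccontr)
    assume "H x \<noteq> H 1"
    hence "x > 1" using that by (cases "x = 1") auto
    from MVT2[OF this, of H bump] H' obtain z where "z > 1" "H x - H 1 = (x - 1) * bump z" by auto
    thus False using \<open>H x \<noteq> H 1\<close> bump_eq_0[of z] by simp
  qed
  have mono: "x < y \<Longrightarrow> H x \<le> H y" for x y
    using MVT2[of x y H bump] H' bump_nonneg by (smt (verit) mult_nonneg_nonneg)
  have "H 1 > 0"
  proof (rule ccontr)
    assume "\<not> H 1 > 0"
    hence z: "H x = 0" if "x \<in> {-1<..<1}" for x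
      using mono[of x 1] mono[of "-1" x] 0[of "-1"] that by auto
    have "((\<lambda>x. 0) has_real_derivative bump 0) (at 0)"
      by (rule has_field_derivative_transform_within_open[OF H', where S = "{-1<..<1}"]) (use z in auto)
    hence "bump 0 = 0" using DERIV_unique DERIV_const by blast
    thus False using bump_pos by simp
  qed
  thus thesis using that[of H "H 1"] H' 0 1 smooth_antiderivative[OF smooth_bump H'] by blast
qed

lemma set_integral_countable_change:
  fixes f :: "real \<Rightarrow> real"
  assumes "countable X" "\<And>x. x \<notin> X \<Longrightarrow> x \<in> A \<longleftrightarrow> x \<in> B"
  shows "(LINT x:A|lborel. f x) = (LINT x:B|lborel. f x)"
        "set_integrable lborel A f = set_integrable lborel B f"
  unfolding set_lebesgue_integral_def set_integrable_def
  by (rule integral_discrete_difference[where X = X] integrable_discrete_difference[where X = X];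
      use assms in \<open>auto simp: indicator_def\<close>)+

lemma set_integral_openclosed:
  fixes f :: "real \<Rightarrow> real"
  shows "(LINT x:{a<..<b}|lborel. f x) = (LINT x:{a..b}|lborel. f x)"
        "set_integrable lborel {a<..<b} f = set_integrable lborel {a..b} f"
  by (rule set_integral_countable_change[where X = "{a, b}"]; auto)+

subsection \<open>Functions with square integrable derivative\<close>

text \<open>If \<open>h x < h y\<close>, test with a smoothed step at \<open>x\<close> minus one at
  \<open>y\<close>: its derivative is a bump near \<open>x\<close> minus a bump of equal mass near
  \<open>y\<close>, so the integral is close to a positive multiple of \<open>h x - h y\<close> and
  cannot vanish.\<close>

lemma du_bois_reymond:
  assumes h: "continuous_on {a<..<b} h"
    and zero: "\<And>\<phi>. test_function {a<..<b} \<phi> \<Longrightarrow> (LINT x:{a<..<b}|lborel. h x * deriv \<phi> x) = 0"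
    and x: "x \<in> {a<..<b}" and y: "y \<in> {a<..<b}"
  shows "h x = h y"
proof -
  have less: "\<not> h x < h y" if x: "x \<in> {a<..<b}" and y: "y \<in> {a<..<b}" for x y
  proof
    assume lt: "h x < h y"
    \<comment> \<open>A third of the gap: after an error \<tau> at each of the two points the values
      still differ by \<tau>.\<close>
    define \<tau> where "\<tau> = (h y - h x) / 3"
    have \<tau>: "\<tau> > 0" using lt by (simp add: \<tau>_def)
    have nbhd: "\<exists>d>0. {z-d..z+d} \<subseteq> {a<..<b} \<and> (\<forall>t\<in>{z-d..z+d}. \<bar>h t - h z\<bar> < \<tau>)" if z: "z \<in> {a<..<b}" for z
    proof -
      have "isCont h z" using h z by (simp add: continuous_on_eq_continuous_at)
      then obtain d where d: "d > 0" "\<And>t. dist t z < d \<Longrightarrow> dist (h t) (h z) < \<tau>"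
        using \<tau> unfolding continuous_at_eps_delta dist_real_def by blast
      define e where "e = min (d / 2) (min ((z - a) / 2) ((b - z) / 2))"
      have e: "e > 0" "e < d" "e \<le> (z - a) / 2" "e \<le> (b - z) / 2"
        unfolding e_def using d z by (simp, linarith+)
      have "{z-e..z+e} \<subseteq> {a<..<b}" using e z by auto
      moreover have "\<forall>t\<in>{z-e..z+e}. \<bar>h t - h z\<bar> < \<tau>"
        using d(2) e by (auto simp: dist_real_def)
      ultimately show ?thesis using e(1) by blast
    qed
    obtain d1 where d1: "d1 > 0" "{x-d1..x+d1} \<subseteq> {a<..<b}" "\<And>t. t \<in> {x-d1..x+d1} \<Longrightarrow> \<bar>h t - h x\<bar> < \<tau>"
      using nbhd[OF x] by blast
    obtain d2 where d2: "d2 > 0" "{y-d2..y+d2} \<subseteq> {a<..<b}" "\<And>t. t \<in> {y-d2..y+d2} \<Longrightarrow> \<bar>h t - h y\<bar> < \<tau>"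
      using nbhd[OF y] by blast
    define d where "d = min d1 d2"
    have d: "d > 0" "{x-d..x+d} \<subseteq> {a<..<b}" "{y-d..y+d} \<subseteq> {a<..<b}"
      "\<And>t. t \<in> {x-d..x+d} \<Longrightarrow> \<bar>h t - h x\<bar> < \<tau>" "\<And>t. t \<in> {y-d..y+d} \<Longrightarrow> \<bar>h t - h y\<bar> < \<tau>"
    proof -
      have "{x-d..x+d} \<subseteq> {x-d1..x+d1}" "{y-d..y+d} \<subseteq> {y-d2..y+d2}" by (auto simp: d_def)
      thus "{x-d..x+d} \<subseteq> {a<..<b}" "{y-d..y+d} \<subseteq> {a<..<b}"
        "\<And>t. t \<in> {x-d..x+d} \<Longrightarrow> \<bar>h t - h x\<bar> < \<tau>" "\<And>t. t \<in> {y-d..y+d} \<Longrightarrow> \<bar>h t - h y\<bar> < \<tau>"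
        using d1 d2 by blast+
      show "d > 0" using d1 d2 by (simp add: d_def)
    qed
    obtain H I where H: "smooth_on UNIV H" "\<And>x. (H has_real_derivative bump x) (at x)"
      "\<And>x. x \<le> -1 \<Longrightarrow> H x = 0" "\<And>x. x \<ge> 1 \<Longrightarrow> H x = I" "I > 0" using smooth_step_exists by metis
    \<comment> \<open>To the left of both points both steps are 0, to the right both equal
      \<open>I\<close>; hence the difference has compact support.\<close>
    define \<phi> where "\<phi> t = H ((t - x) / d) - H ((t - y) / d)" for t
    have sm: "smooth_on UNIV \<phi>"
      unfolding \<phi>_def by (intro smooth_on_diff smooth_on_affine H)
    have Hd: "((\<lambda>t. H ((t - c) / d)) has_real_derivative bump ((t - c) / d) / d) (at t)" for c t
    proof -
      have "((\<lambda>x. (x - c) / d) has_real_derivative 1 / d) (at t)"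
        by (auto intro!: derivative_eq_intros simp: divide_inverse)
      from DERIV_chain2[OF H(2) this] show ?thesis by (simp add: mult.commute)
    qed
    have der: "deriv \<phi> t = bump ((t - x) / d) / d - bump ((t - y) / d) / d" for t
      unfolding \<phi>_def by (rule DERIV_imp_deriv) (rule DERIV_diff[OF Hd Hd])
    have test: "test_function {a<..<b} \<phi>"
      unfolding test_function_def
    proof (intro conjI sm exI[of _ "{min x y - d..max x y + d}"] allI impI)
      show "{min x y - d..max x y + d} \<subseteq> {a<..<b}" 
      proof -
        have "x - d \<in> {a<..<b}" "x + d \<in> {a<..<b}" "y - d \<in> {a<..<b}" "y + d \<in> {a<..<b}"
          using d(1) subsetD[OF d(2), of "x - d"] subsetD[OF d(2), of "x + d"]
            subsetD[OF d(3), of "y - d"] subsetD[OF d(3), of "y + d"] by simp_all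
        thus ?thesis by (auto simp: min_def max_def split: if_splits)
      qed
      fix t assume "t \<notin> {min x y - d..max x y + d}"
      then consider "t - x < -d" "t - y < -d" | "t - x > d" "t - y > d" by fastforce
      thus "\<phi> t = 0"
      proof cases
        case 1
        hence "(t - x) / d \<le> -1" "(t - y) / d \<le> -1" using d(1) by (auto simp: field_simps)
        thus ?thesis by (simp add: \<phi>_def H)
      next
        case 2
        hence "(t - x) / d \<ge> 1" "(t - y) / d \<ge> 1" using d(1) by (auto simp: field_simps)
        thus ?thesis by (simp add: \<phi>_def H)
      qed
    qed simp
    have cont: "continuous_on {c-d..c+d} (\<lambda>t. bump ((t - c) / d) / d)" for c
      by (intro continuous_intros continuous_on_compose2[OF continuous_on_bump[of UNIV]]) (use d in auto)
    have mass: "(LINT t:{c-d..c+d}|lborel. bump ((t - c) / d) / d) = I" for c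
    proof -
      have "ac_on (c-d) (c+d) (\<lambda>t. H ((t - c) / d)) (\<lambda>t. bump ((t - c) / d) / d)"
        by (rule ac_on_C1) (use Hd cont in \<open>auto intro: has_field_derivative_at_within\<close>)
      from ac_onD(1)[OF this, of "c-d" "c+d"] show ?thesis using d(1) H(3)[of "-1"] H(4)[of 1] by simp
    qed
    have red: "set_integrable lborel {a<..<b} (\<lambda>t. h t * (bump ((t - c) / d) / d)) \<and>
        (LINT t:{a<..<b}|lborel. h t * (bump ((t - c) / d) / d)) = (LINT t:{c-d..c+d}|lborel. h t * (bump ((t - c) / d) / d))
        \<and> set_integrable lborel {c-d..c+d} (\<lambda>t. h t * (bump ((t - c) / d) / d))"
      if c: "{c-d..c+d} \<subseteq> {a<..<b}" for c
    proof -
      have e: "(\<lambda>t. indicator {a<..<b} t *\<^sub>R (h t * (bump ((t - c) / d) / d))) = (\<lambda>t. indicator {c-d..c+d} t *\<^sub>R (h t * (bump ((t - c) / d) / d)))"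
      proof
        fix t
        show "indicator {a<..<b} t *\<^sub>R (h t * (bump ((t - c) / d) / d)) = indicator {c-d..c+d} t *\<^sub>R (h t * (bump ((t - c) / d) / d))"
        proof (cases "t \<in> {c-d..c+d}")
          case False
          hence "\<bar>(t - c) / d\<bar> \<ge> 1" using d(1) by (auto simp: field_simps abs_if)
          from bump_eq_0[OF this] show ?thesis by simp
        qed (use c in \<open>auto simp: indicator_def subset_iff\<close>)
      qed
      have "set_integrable lborel {c-d..c+d} (\<lambda>t. h t * (bump ((t - c) / d) / d))"
        by (intro set_integrable_continuous continuous_on_mult cont continuous_on_subset[OF h c])
      thus ?thesis unfolding set_integrable_def set_lebesgue_integral_def e by simp
    qed
    have bi: "set_integrable lborel {c-d..c+d} (\<lambda>t. k * (bump ((t - c) / d) / d))" for c k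
      by (intro set_integrable_continuous continuous_intros cont)
    have "0 = (LINT t:{a<..<b}|lborel. h t * (bump ((t - x) / d) / d)) - (LINT t:{a<..<b}|lborel. h t * (bump ((t - y) / d) / d))"
      using zero[OF test] red[OF d(2)] red[OF d(3)]
      by (subst set_integral_diff(2)[symmetric]) (auto simp: der algebra_simps diff_divide_distrib)
    also have "\<dots> \<le> (LINT t:{x-d..x+d}|lborel. (h x + \<tau>) * (bump ((t - x) / d) / d)) - (LINT t:{y-d..y+d}|lborel. (h y - \<tau>) * (bump ((t - y) / d) / d))"
    proof -
      have "(LINT t:{x-d..x+d}|lborel. h t * (bump ((t - x) / d) / d)) \<le> (LINT t:{x-d..x+d}|lborel. (h x + \<tau>) * (bump ((t - x) / d) / d))"
      proof (rule set_integral_mono)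
        fix t assume t: "t \<in> {x-d..x+d}"
        have "h t \<le> h x + \<tau>" using d(4)[OF t] by linarith
        thus "h t * (bump ((t - x) / d) / d) \<le> (h x + \<tau>) * (bump ((t - x) / d) / d)"
          by (rule mult_right_mono) (use d(1) bump_nonneg in auto)
      qed (use red[OF d(2)] bi in auto)
      moreover have "(LINT t:{y-d..y+d}|lborel. (h y - \<tau>) * (bump ((t - y) / d) / d)) \<le> (LINT t:{y-d..y+d}|lborel. h t * (bump ((t - y) / d) / d))"
      proof (rule set_integral_mono)
        fix t assume t: "t \<in> {y-d..y+d}"
        have "h y - \<tau> \<le> h t" using d(5)[OF t] by linarith
        thus "(h y - \<tau>) * (bump ((t - y) / d) / d) \<le> h t * (bump ((t - y) / d) / d)"
          by (rule mult_right_mono) (use d(1) bump_nonneg in auto)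
      qed (use red[OF d(3)] bi in auto)
      ultimately show ?thesis
        unfolding red[OF d(2), THEN conjunct2, THEN conjunct1] red[OF d(3), THEN conjunct2, THEN conjunct1] by linarith
    qed
    also have "\<dots> = (h x + \<tau>) * I - (h y - \<tau>) * I"
      using mass by (simp only: set_integral_mult_right mass)
    also have "\<dots> = - \<tau> * I" by (simp add: \<tau>_def field_simps)
    also have "\<dots> < 0" using \<tau> H(5) by simp
    finally show False by simp
  qed
  show ?thesis using less[OF x y] less[OF y x] by simp
qed

section \<open>Local Sobolev functions as indefinite integrals\<close>

definition primitive :: "(real \<Rightarrow> real) \<Rightarrow> (real \<Rightarrow> real) \<Rightarrow> bool" where
  "primitive f g \<longleftrightarrow> (\<forall>a b. 0 < a \<longrightarrow> a \<le> b \<longrightarrow> ac_on a b f g \<and> set_integrable lborel {a..b} (\<lambda>x. (g x)\<^sup>2))"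

lemma primitiveD:
  assumes "primitive f g" "0 < a"
  shows "ac_on a b f g" "set_integrable lborel {a..b} g" "set_integrable lborel {a..b} (\<lambda>x. (g x)\<^sup>2)"
    "continuous_on {a..b} f" "a \<le> b \<Longrightarrow> f b - f a = (LINT t:{a..b}|lborel. g t)"
proof -
  have *: "ac_on a b f g \<and> set_integrable lborel {a..b} (\<lambda>x. (g x)\<^sup>2)"
  proof (cases "a \<le> b")
    case True thus ?thesis using assms by (auto simp: primitive_def)
  next
    case False thus ?thesis by (auto simp: ac_on_def set_integrable_def)
  qed
  thus "ac_on a b f g" "set_integrable lborel {a..b} (\<lambda>x. (g x)\<^sup>2)" by auto
  thus "set_integrable lborel {a..b} g" "continuous_on {a..b} f"
    by (auto simp: ac_on_def intro: ac_on_continuous[OF \<open>ac_on a b f g\<close>])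
  show "a \<le> b \<Longrightarrow> f b - f a = (LINT t:{a..b}|lborel. g t)" using ac_onD(1)[of a b f g a b] * by auto
qed

lemma primitive_continuous_on:
  assumes "primitive f g"
  shows "continuous_on {0<..} f"
proof (rule continuous_on_subset[of "{0<..}"])
  show "continuous_on {0<..} f"
  proof (rule continuous_at_imp_continuous_on, rule ballI)
    fix x :: real assume "x \<in> {0<..}"
    hence x: "x > 0" by simp
    have "continuous_on {x/2<..<2*x} f"
      by (rule continuous_on_subset[OF primitiveD(4)[OF assms, of "x/2" "2*x"]]) (use x in auto)
    thus "isCont f x" using x by (subst (asm) continuous_on_eq_continuous_at) auto
  qed
qed simp

lemma set_integrable_square_imp:
  fixes g :: "real \<Rightarrow> real"
  assumes "set_borel_measurable lborel {a..b} g" "set_integrable lborel {a..b} (\<lambda>x. (g x)\<^sup>2)"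
  shows "set_integrable lborel {a..b} g"
proof -
  have i: "set_integrable lborel {a..b} (\<lambda>x. 1 + (g x)\<^sup>2)"
    by (intro set_integral_add assms set_integrable_continuous) simp
  have "\<bar>g x\<bar> \<le> 1 + (g x)\<^sup>2" for x
    using sum_squares_bound[of 1 "\<bar>g x\<bar>"] by (simp add: power2_eq_square)
  thus ?thesis
    using i assms(1) unfolding set_integrable_def set_borel_measurable_def
    by (elim Bochner_Integration.integrable_bound) (auto simp: indicator_def intro: order_trans)
qed

lemma set_borel_measurable_subinterval:
  fixes g :: "real \<Rightarrow> real"
  assumes "set_borel_measurable lborel A g" "B \<subseteq> A" "B \<in> sets borel"
  shows "set_borel_measurable lborel B g"
proof -
  have "(\<lambda>x. indicator B x * (indicator A x *\<^sub>R g x)) \<in> borel_measurable lborel"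
    using assms unfolding set_borel_measurable_def by measurable
  also have "(\<lambda>x. indicator B x * (indicator A x *\<^sub>R g x)) = (\<lambda>x. indicator B x *\<^sub>R g x)"
    using assms(2) by (auto simp: indicator_def fun_eq_iff)
  finally show ?thesis unfolding set_borel_measurable_def .
qed

lemma L2_onD:
  assumes "L2_on {c<..<d} g" "c < a" "b < d"
  shows "set_borel_measurable lborel {a..b} g" "set_integrable lborel {a..b} (\<lambda>x. (g x)\<^sup>2)"
    "set_integrable lborel {a..b} g"
proof -
  show 1: "set_borel_measurable lborel {a..b} g"
    by (rule set_borel_measurable_subinterval) (use assms in \<open>auto simp: L2_on_def\<close>)
  show 2: "set_integrable lborel {a..b} (\<lambda>x. (g x)\<^sup>2)"
    by (rule set_integrable_subset[of lborel "{c<..<d}"]) (use assms in \<open>auto simp: L2_on_def\<close>)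
  show "set_integrable lborel {a..b} g" by (rule set_integrable_square_imp[OF 1 2])
qed

text \<open>Integration by parts; the boundary terms vanish because a compact support inside the
  open interval misses both endpoints.\<close>

lemma ac_on_test_function:
  assumes ac: "ac_on c d f g" and t: "test_function {c<..<d} \<phi>"
  shows "(LINT x:{c<..<d}|lborel. f x * deriv \<phi> x) = - (LINT x:{c<..<d}|lborel. g x * \<phi> x)"
proof (cases "c < d")
  case True
  have sm: "smooth_on UNIV \<phi>" using t by (simp add: test_function_def)
  note p = smooth_on_UNIV_has_deriv[OF sm]
  have z: "\<phi> c = 0" "\<phi> d = 0" using t unfolding test_function_def by auto
  have pac: "ac_on c d \<phi> (deriv \<phi>)"
    by (rule ac_on_C1) (auto intro: has_field_derivative_at_within[OF p(1)] continuous_on_subset[OF p(2)])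
  note m = ac_on_mult[OF ac pac]
  have fc: "continuous_on {c..d} f" by (rule ac_on_continuous[OF ac])
  have i1: "set_integrable lborel {c..d} (\<lambda>x. f x * deriv \<phi> x)"
    by (intro set_integrable_continuous continuous_on_mult fc continuous_on_subset[OF p(2)]) auto
  have i2: "set_integrable lborel {c..d} (\<lambda>x. \<phi> x * g x)"
    by (rule set_integrable_cont_mult) (use ac ac_on_continuous[OF pac] in \<open>auto simp: ac_on_def\<close>)
  have "0 = (LINT x:{c..d}|lborel. g x * \<phi> x + f x * deriv \<phi> x)"
    using ac_onD(1)[OF m, of c d] True z by simp
  also have "\<dots> = (LINT x:{c..d}|lborel. g x * \<phi> x) + (LINT x:{c..d}|lborel. f x * deriv \<phi> x)"
    using i1 i2 by (intro set_integral_add) (auto simp: mult.commute)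
  finally show ?thesis unfolding set_integral_openclosed by simp
next
  case False thus ?thesis by (simp add: set_lebesgue_integral_def)
qed

text \<open>Subtracting an indefinite integral \<open>G\<close> of \<open>g\<close> leaves a
  continuous function with weak derivative 0, which is constant by
  \<open>du_bois_reymond\<close>.\<close>

lemma has_W12_loc_deriv_imp_primitive:
  assumes c: "continuous_on {0<..} f" and w: "has_W12_loc_deriv f g"
  shows "primitive f g"
  unfolding primitive_def
proof (intro allI impI)
  fix a b :: real assume ab: "0 < a" "a \<le> b"
  define c where "c = a / 2"
  define d where "d = b + 1"
  have cd: "0 < c" "c < a" "b < d" "c < d" using ab by (auto simp: c_def d_def)
  \<comment> \<open>Square integrability is given on open intervals only; the larger one contains
    the closed interval from \<open>c\<close> to \<open>d\<close>, where \<open>G\<close> is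
    needed.\<close>
  have L: "L2_on {c/2<..<d+1} g" and wd: "has_weak_deriv_on {c<..<d} f g"
    using w cd unfolding has_W12_loc_deriv_def by auto
  note g = L2_onD[OF L, of c d]
  define G where "G x = (LINT t:{c..x}|lborel. g t)" for x
  have Gac: "ac_on c d G g"
    by (rule ac_on_indefinite[where c = 0]) (use g cd in \<open>auto simp: G_def\<close>)
  have Gc: "continuous_on {c..d} G" by (rule ac_on_continuous[OF Gac])
  have fc: "continuous_on {c..d} f" by (rule continuous_on_subset[OF assms(1)]) (use cd in auto)
  have eq: "f x - G x = f y - G y" if "x \<in> {c<..<d}" "y \<in> {c<..<d}" for x y
  proof (rule du_bois_reymond[OF _ _ that])
    show "continuous_on {c<..<d} (\<lambda>x. f x - G x)"
      by (rule continuous_on_subset[of "{c..d}"]) (auto intro!: continuous_intros fc Gc)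
    fix \<phi> assume t: "test_function {c<..<d} \<phi>"
    note p = smooth_on_UNIV_has_deriv[of \<phi>]
    have sm: "smooth_on UNIV \<phi>" using t by (simp add: test_function_def)
    have i: "set_integrable lborel {c<..<d} (\<lambda>x. f x * deriv \<phi> x)" "set_integrable lborel {c<..<d} (\<lambda>x. G x * deriv \<phi> x)"
      unfolding set_integral_openclosed
      by (intro set_integrable_continuous continuous_on_mult fc Gc continuous_on_subset[OF p(2)[OF sm]]; simp)+
    have "(LINT x:{c<..<d}|lborel. (f x - G x) * deriv \<phi> x)
       = (LINT x:{c<..<d}|lborel. f x * deriv \<phi> x) - (LINT x:{c<..<d}|lborel. G x * deriv \<phi> x)"
      using i by (subst set_integral_diff(2)[symmetric]) (auto simp: algebra_simps)
    also have "\<dots> = 0"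
      using wd t ac_on_test_function[OF Gac t] unfolding has_weak_deriv_on_def by auto
    finally show "(LINT x:{c<..<d}|lborel. (f x - G x) * deriv \<phi> x) = 0" .
  qed
  have "ac_on a b f g"
    unfolding ac_on_def
  proof (intro conjI allI impI)
    show "set_integrable lborel {a..b} g" using set_integrable_subinterval[OF g(3)] cd by auto
    fix x y assume xy: "a \<le> x" "x \<le> y" "y \<le> b"
    have "G y - G x = (LINT t:{x..y}|lborel. g t)" using ac_onD(1)[OF Gac, of x y] xy cd by auto
    thus "f y - f x = (LINT t:{x..y}|lborel. g t)" using eq[of x y] xy cd by auto
  qed
  moreover have "set_integrable lborel {a..b} (\<lambda>x. (g x)\<^sup>2)"
    by (rule set_integrable_subinterval[OF g(2)]) (use cd in auto)
  ultimately show "ac_on a b f g \<and> set_integrable lborel {a..b} (\<lambda>x. (g x)\<^sup>2)" ..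
qed

lemma primitive_imp_has_W12_loc_deriv:
  assumes "primitive f g"
  shows "has_W12_loc_deriv f g"
  unfolding has_W12_loc_deriv_def
proof (intro allI impI)
  fix a b :: real assume ab: "0 < a \<and> a < b"
  note p = primitiveD[OF assms, of a b]
  have "L2_on {a<..<b} f"
    unfolding L2_on_def set_integral_openclosed
  proof
    have "set_borel_measurable lborel {a..b} f"
      using set_integrable_continuous[OF p(4)] ab by (auto simp: set_integrable_def set_borel_measurable_def)
    thus "set_borel_measurable lborel {a<..<b} f" by (rule set_borel_measurable_subinterval) auto
    show "set_integrable lborel {a..b} (\<lambda>x. (f x)\<^sup>2)"
      by (intro set_integrable_continuous continuous_intros p) (use ab in auto)
  qed
  moreover have "L2_on {a<..<b} g"
    unfolding L2_on_def set_integral_openclosed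
  proof
    have "set_borel_measurable lborel {a..b} g"
      using p(2) ab by (auto simp: set_integrable_def set_borel_measurable_def)
    thus "set_borel_measurable lborel {a<..<b} g" by (rule set_borel_measurable_subinterval) auto
    show "set_integrable lborel {a..b} (\<lambda>x. (g x)\<^sup>2)" using p ab by auto
  qed
  moreover have "has_weak_deriv_on {a<..<b} f g"
    unfolding has_weak_deriv_on_def using ac_on_test_function[OF p(1)] ab by auto
  ultimately show "L2_on {a<..<b} f \<and> L2_on {a<..<b} g \<and> has_weak_deriv_on {a<..<b} f g" by blast
qed

lemma W12_loc_primitive: "f \<in> W12_loc \<Longrightarrow> primitive f (weak_deriv f)"
  unfolding W12_loc_def weak_deriv_def
  using has_W12_loc_deriv_imp_primitive someI_ex[of "has_W12_loc_deriv f"] by blast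

lemma primitive_W12_loc: "primitive f g \<Longrightarrow> f \<in> W12_loc"
  unfolding W12_loc_def using primitive_continuous_on primitive_imp_has_W12_loc_deriv by blast

text \<open>The positive and the negative part of \<open>h\<close> are densities of two finite
  measures that agree on every half-line \<open>{x<..}\<close>. The measures are therefore equal,
  and so are their densities almost everywhere.\<close>

lemma AE_zero_of_interval_integrals:
  fixes h :: "real \<Rightarrow> real"
  assumes i: "set_integrable lborel {a..b} h"
    and z: "\<And>x y. a \<le> x \<Longrightarrow> x \<le> y \<Longrightarrow> y \<le> b \<Longrightarrow> (LINT t:{x..y}|lborel. h t) = 0"
  shows "AE x in lborel. x \<in> {a..b} \<longrightarrow> h x = 0"
proof -
  define k where "k x = indicator {a..b} x * h x" for x
  have ki: "integrable lborel k" using i by (simp add: k_def[abs_def] set_integrable_def)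
  have km [measurable]: "k \<in> borel_measurable borel" using borel_measurable_integrable[OF ki] by simp
  \<comment> \<open>For \<open>s = 1\<close> the density is the positive part of \<open>k\<close>,
    for \<open>s = -1\<close> the negative part.\<close>
  define M where "M s = density lborel (\<lambda>x. ennreal (max 0 (s * k x)))" for s
  have ei: "integrable lborel (\<lambda>t. indicator {x<..} t * max 0 (s * k t))" for s x
    by (rule Bochner_Integration.integrable_bound[OF integrable_mult_right[OF ki, of s]])
       (auto simp: indicator_def max_def abs_mult[symmetric])
  have em: "emeasure (M s) {x<..} = ennreal (LINT t|lborel. indicator {x<..} t * max 0 (s * k t))" for s x
  proof -
    have "emeasure (M s) {x<..} = (\<integral>\<^sup>+t. ennreal (max 0 (s * k t)) * indicator {x<..} t \<partial>lborel)"
      unfolding M_def by (rule emeasure_density) auto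
    also have "\<dots> = (\<integral>\<^sup>+t. ennreal (indicator {x<..} t * max 0 (s * k t)) \<partial>lborel)"
      by (intro nn_integral_cong) (auto simp: indicator_def)
    also have "\<dots> = ennreal (LINT t|lborel. indicator {x<..} t * max 0 (s * k t))"
      by (rule nn_integral_eq_integral[OF ei]) auto
    finally show ?thesis .
  qed
  have kz: "(LINT t|lborel. indicator {x<..} t * k t) = 0" for x
  proof (cases "max a x \<le> b")
    case True
    have "(LINT t|lborel. indicator {x<..} t * k t) = (LINT t|lborel. indicator {max a x..b} t * h t)"
    proof (rule integral_cong_AE)
      show "AE t in lborel. indicator {x<..} t * k t = indicator {max a x..b} t * h t"
        using AE_lborel_singleton[of x] by eventually_elim (auto simp: indicator_def k_def)
      show "(\<lambda>t. indicator {max a x..b} t * h t) \<in> borel_measurable lborel"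
        using set_integrable_subinterval[OF i, of "max a x" b] unfolding set_integrable_def by auto
    qed auto
    also have "\<dots> = (LINT t:{max a x..b}|lborel. h t)" by (simp add: set_lebesgue_integral_def)
    also have "\<dots> = 0" by (rule z) (use True in auto)
    finally show ?thesis .
  next
    case False
    hence "(\<lambda>t. indicator {x<..} t * k t) = (\<lambda>t. 0)" by (auto simp: k_def indicator_def fun_eq_iff)
    thus ?thesis by simp
  qed
  have "M 1 = M (-1)"
  proof (rule measure_eqI_lessThan)
    show "sets (M 1) = sets borel" "sets (M (-1)) = sets borel" by (auto simp: M_def)
    fix x
    show "emeasure (M 1) {x<..} < \<infinity>" unfolding em by simp
    have "(LINT t|lborel. indicator {x<..} t * max 0 (1 * k t)) - (LINT t|lborel. indicator {x<..} t * max 0 (-1 * k t))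
       = (LINT t|lborel. indicator {x<..} t * max 0 (1 * k t) - indicator {x<..} t * max 0 (-1 * k t))"
      by (rule Bochner_Integration.integral_diff[symmetric]) (rule ei)+
    also have "\<dots> = (LINT t|lborel. indicator {x<..} t * k t)"
      by (intro Bochner_Integration.integral_cong) (auto simp: max_def)
    finally show "emeasure (M 1) {x<..} = emeasure (M (-1)) {x<..}"
      unfolding em kz by simp
  qed
  hence "AE x in lborel. ennreal (max 0 (1 * k x)) = ennreal (max 0 (-1 * k x))"
    unfolding M_def by (intro sigma_finite_measure.density_unique[OF sigma_finite_lborel]) auto
  thus ?thesis
    by eventually_elim (auto simp: k_def max_def ennreal_eq_0_iff split: if_splits)
qed

lemma AE_pos_realI:
  assumes "\<And>a b. 0 < a \<Longrightarrow> AE x in lborel. x \<in> {a..b} \<longrightarrow> P (x::real)"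
  shows "AE x in lborel. x > 0 \<longrightarrow> P x"
proof -
  have "AE x in lborel. \<forall>n::nat. x \<in> {1 / real (Suc n)..real (Suc n)} \<longrightarrow> P x"
    unfolding AE_all_countable by (intro allI assms) simp
  thus ?thesis
  proof eventually_elim
    case (elim x)
    show ?case
    proof
      assume x: "x > 0"
      obtain n :: nat where n: "real n > max x (1/x)" using reals_Archimedean2 by blast
      have "1 / real (Suc n) \<le> x" using n x by (simp add: field_simps)
      thus "P x" using elim[rule_format, of n] n by auto
    qed
  qed
qed

lemma primitive_unique:
  assumes "primitive f g" "primitive f g'"
  shows "AE x in lborel. x > 0 \<longrightarrow> g x = g' x"
proof (rule AE_pos_realI)
  fix a b :: real assume a: "0 < a"
  have "AE x in lborel. x \<in> {a..b} \<longrightarrow> g x - g' x = 0"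
  proof (rule AE_zero_of_interval_integrals)
    show "set_integrable lborel {a..b} (\<lambda>x. g x - g' x)"
      by (intro set_integral_diff primitiveD[OF assms(1) a] primitiveD[OF assms(2) a])
    fix x y assume xy: "a \<le> x" "x \<le> y" "y \<le> b"
    hence x: "0 < x" using a by simp
    show "(LINT t:{x..y}|lborel. g t - g' t) = 0"
      using primitiveD(5)[OF assms(1) x xy(2)] primitiveD(5)[OF assms(2) x xy(2)]
        primitiveD(2)[OF assms(1) x] primitiveD(2)[OF assms(2) x] by (subst set_integral_diff(2)) auto
  qed
  thus "AE x in lborel. x \<in> {a..b} \<longrightarrow> g x = g' x" by simp
qed

text \<open>This makes the choice in \<open>weak_deriv\<close> harmless: under integrals over the
  half-line any explicit derivative may replace it.\<close>

lemma weak_deriv_AE: "primitive f g \<Longrightarrow> AE x in lborel. x > 0 \<longrightarrow> weak_deriv f x = g x"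
  using primitive_unique[OF W12_loc_primitive[OF primitive_W12_loc]] by blast

lemma borel_measurable_pos_realI:
  fixes g :: "real \<Rightarrow> real"
  assumes "\<And>a b. 0 < a \<Longrightarrow> set_borel_measurable lborel {a..b} g"
  shows "(\<lambda>x. indicator {0<..} x * g x) \<in> borel_measurable borel"
proof (rule borel_measurable_LIMSEQ_real)
  fix n :: nat
  show "(\<lambda>x. indicator {1 / real (Suc n)..real (Suc n)} x * g x) \<in> borel_measurable borel"
    using assms[of "1 / real (Suc n)" "real (Suc n)"] by (simp add: set_borel_measurable_def)
next
  fix x :: real
  show "(\<lambda>n. indicator {1 / real (Suc n)..real (Suc n)} x * g x) \<longlonglongrightarrow> indicator {0<..} x * g x"
  proof (rule tendsto_eventually, cases "x > 0")
    case True
    have "eventually (\<lambda>n. real n > max x (1/x)) sequentially"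
      using filterlim_at_top_dense[THEN iffD1, OF filterlim_real_sequentially] by blast
    thus "\<forall>\<^sub>F n in sequentially. indicator {1 / real (Suc n)..real (Suc n)} x * g x = indicator {0<..} x * g x"
    proof eventually_elim
      case (elim n)
      have "1 / real (Suc n) \<le> x" using elim True by (simp add: field_simps)
      thus ?case using elim True by (simp add: indicator_def)
    qed
  next
    case False
    have "\<not> 1 / real (Suc n) \<le> x" for n using False by (smt (verit) divide_pos_pos of_nat_0_less_iff zero_less_Suc)
    thus "\<forall>\<^sub>F n in sequentially. indicator {1 / real (Suc n)..real (Suc n)} x * g x = indicator {0<..} x * g x"
      using False by (intro always_eventually) (auto simp: indicator_def)
  qed
qed

lemma primitive_measurable:
  assumes "primitive f g"
  shows "(\<lambda>x. indicator {0<..} x * g x) \<in> borel_measurable borel"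
    "(\<lambda>x. indicator {0<..} x * f x) \<in> borel_measurable borel"
proof (rule_tac[!] borel_measurable_pos_realI)
  fix a b :: real assume a: "0 < a"
  show "set_borel_measurable lborel {a..b} g" using primitiveD(2)[OF assms a, of b]
    by (auto simp: set_integrable_def set_borel_measurable_def)
  show "set_borel_measurable lborel {a..b} f"
    using set_integrable_continuous[OF primitiveD(4)[OF assms a, of b]]
    by (auto simp: set_integrable_def set_borel_measurable_def)
qed

subsection \<open>Weighted square norms of derivatives\<close>

text \<open>Turns a family of Young inequalities into Cauchy-Schwarz. For \<open>e > 0\<close> the
  choice \<open>k = x / e\<close> suffices; for \<open>e = 0\<close> a large \<open>k\<close> such
  as \<open>(d + 1) / x\<close> already contradicts \<open>x > 0\<close>.\<close>

lemma square_le_of_AM_GM: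
  fixes x e d :: real
  assumes "\<And>k. k > 0 \<Longrightarrow> x \<le> k * e / 2 + d / (2 * k)" "x \<ge> 0" "e \<ge> 0" "d \<ge> 0"
  shows "x\<^sup>2 \<le> e * d"
proof (cases "x = 0")
  case False
  hence x: "x > 0" using assms by simp
  show ?thesis
  proof (cases "e = 0")
    case True
    have "x \<le> d / (2 * ((d + 1) / x))" using assms(1)[of "(d + 1) / x"] x assms True by simp
    also have "\<dots> = x * (d / (2 * (d + 1)))" using x assms by (simp add: field_simps)
    also have "\<dots> < x * 1" by (rule mult_strict_left_mono) (use x assms in auto)
    finally show ?thesis by simp
  next
    case False
    hence e: "e > 0" using assms by simp
    have "x \<le> x / e * e / 2 + d / (2 * (x / e))" using assms(1)[of "x / e"] x e by simp
    hence "x \<le> x / 2 + d * e / (2 * x)" using e by simp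
    hence "x * x \<le> x * (x / 2 + d * e / (2 * x))" using x by (intro mult_left_mono) auto
    thus ?thesis using x by (simp add: power2_eq_square field_simps)
  qed
qed (use assms in auto)

lemma abs_AM_GM:
  fixes g t k :: real
  assumes "k > 0" "t > 0"
  shows "\<bar>g\<bar> \<le> k / 2 * (t * g\<^sup>2) + 1 / (2 * k * t)"
proof -
  have "2 * (k * t) * \<bar>g\<bar> \<le> (k * t)\<^sup>2 * g\<^sup>2 + 1"
    using sum_squares_bound[of "k * t * \<bar>g\<bar>" 1] by (simp add: power_mult_distrib algebra_simps)
  hence "\<bar>g\<bar> \<le> ((k * t)\<^sup>2 * g\<^sup>2 + 1) / (2 * (k * t))" using assms by (simp add: field_simps)
  also have "\<dots> = k / 2 * (t * g\<^sup>2) + 1 / (2 * k * t)" using assms by (simp add: field_simps power2_eq_square)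
  finally show ?thesis .
qed

text \<open>Young's inequality for the weights t and 1/t, with 1/t estimated by 1/a. The parameter
  is kept free because the growth estimate below only needs a bound linear in the weighted square
  integral.\<close>

lemma integral_abs_AM_GM:
  fixes g :: "real \<Rightarrow> real"
  assumes a: "0 < a" "a \<le> b" and k: "k > 0" and g: "set_integrable lborel {a..b} g" "set_integrable lborel {a..b} (\<lambda>x. (g x)\<^sup>2)"
  shows "(LINT t:{a..b}|lborel. \<bar>g t\<bar>) \<le> k * (LINT t:{a..b}|lborel. t * (g t)\<^sup>2) / 2 + (b - a) / a / (2 * k)"
proof -
  have i: "set_integrable lborel {a..b} (\<lambda>x. x * (g x)\<^sup>2)"
    by (rule set_integrable_cont_mult[OF _ g(2)]) (intro continuous_intros)
  have ic: "set_integrable lborel {a..b} (\<lambda>x. 1 / (2 * k * a))" by (intro set_integrable_continuous continuous_intros)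
  have "(LINT t:{a..b}|lborel. \<bar>g t\<bar>) \<le> (LINT t:{a..b}|lborel. k / 2 * (t * (g t)\<^sup>2) + 1 / (2 * k * a))"
  proof (rule set_integral_mono)
    fix t assume t: "t \<in> {a..b}"
    have "\<bar>g t\<bar> \<le> k / 2 * (t * (g t)\<^sup>2) + 1 / (2 * k * t)" by (rule abs_AM_GM) (use t a k in auto)
    also have "1 / (2 * k * t) \<le> 1 / (2 * k * a)" by (rule divide_left_mono) (use t a k in auto)
    finally show "\<bar>g t\<bar> \<le> k / 2 * (t * (g t)\<^sup>2) + 1 / (2 * k * a)" by simp
  qed (use set_integrable_abs[OF g(1)] i ic in auto)
  also have "\<dots> = (LINT t:{a..b}|lborel. k / 2 * (t * (g t)\<^sup>2)) + (LINT t:{a..b}|lborel. 1 / (2 * k * a))"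
    by (rule set_integral_add(2)) (use i ic in auto)
  also have "(LINT t:{a..b}|lborel. 1 / (2 * k * a)) = (b - a) / (2 * k * a)"
    using a by (simp add: set_lebesgue_integral_def)
  finally show ?thesis by (simp add: mult.commute)
qed

lemma integral_abs_square_le:
  fixes g :: "real \<Rightarrow> real"
  assumes a: "0 < a" "a \<le> b" and g: "set_integrable lborel {a..b} g" "set_integrable lborel {a..b} (\<lambda>x. (g x)\<^sup>2)"
  shows "(LINT t:{a..b}|lborel. \<bar>g t\<bar>)\<^sup>2 \<le> (LINT t:{a..b}|lborel. t * (g t)\<^sup>2) * ((b - a) / a)"
proof (rule square_le_of_AM_GM)
  show "(LINT t:{a..b}|lborel. \<bar>g t\<bar>) \<ge> 0" "(LINT t:{a..b}|lborel. t * (g t)\<^sup>2) \<ge> 0"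
    unfolding set_lebesgue_integral_def using a by (auto intro!: integral_nonneg_AE simp: indicator_def)
qed (use integral_abs_AM_GM[OF a _ g] a in auto)

text \<open>Square integrability for the measure r dr on the half-line becomes plain square
  integrability on the line, so that completeness can be used for Lebesgue measure.\<close>

definition scaled :: "(real \<Rightarrow> real) \<Rightarrow> real \<Rightarrow> real" where
  "scaled g r = indicator {0<..} r * (sqrt r * g r)"

lemma scaled_sq: "(scaled g r)\<^sup>2 = indicator {0<..} r * (r * (g r)\<^sup>2)"
  by (auto simp: scaled_def power_mult_distrib indicator_def)

lemma scaled_measurable:
  assumes "(\<lambda>x. indicator {0<..} x * g x) \<in> borel_measurable borel"
  shows "scaled g \<in> borel_measurable borel"
proof -
  have "(\<lambda>x. sqrt x * (indicator {0<..} x * g x)) \<in> borel_measurable borel" using assms by measurable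
  also have "(\<lambda>x. sqrt x * (indicator {0<..} x * g x)) = scaled g" by (auto simp: scaled_def fun_eq_iff)
  finally show ?thesis .
qed

lemma set_integral_le_scaled:
  assumes i: "integrable lborel (\<lambda>r. (scaled g r)\<^sup>2)" and a: "0 < a"
  shows "(LINT t:{a..b}|lborel. t * (g t)\<^sup>2) \<le> (LINT r|lborel. (scaled g r)\<^sup>2)"
  unfolding set_lebesgue_integral_def
proof (rule integral_mono')
  show "indicator {a..b} t *\<^sub>R (t * (g t)\<^sup>2) \<le> (scaled g t)\<^sup>2" for t
    using a by (auto simp: scaled_sq indicator_def)
qed (use i in auto)

text \<open>A modulus of continuity, uniform on compact subsets of the open half-line, that depends
  on \<open>f\<close> only through the weighted norm of its derivative: the source of
  equicontinuity.\<close>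

lemma primitive_hoelder:
  assumes p: "primitive f g" and i: "integrable lborel (\<lambda>r. (scaled g r)\<^sup>2)" and x: "0 < x" "x \<le> y"
  shows "(f y - f x)\<^sup>2 \<le> (LINT r|lborel. (scaled g r)\<^sup>2) * ((y - x) / x)"
proof -
  note d = primitiveD[OF p x(1), of y]
  have "(f y - f x)\<^sup>2 = \<bar>LINT t:{x..y}|lborel. g t\<bar>\<^sup>2" using d(5) x by simp
  also have "\<dots> \<le> (LINT t:{x..y}|lborel. \<bar>g t\<bar>)\<^sup>2"
    by (intro power_mono set_integral_abs_le set_integrable_abs d) auto
  also have "\<dots> \<le> (LINT t:{x..y}|lborel. t * (g t)\<^sup>2) * ((y - x) / x)"
    by (rule integral_abs_square_le) (use d x in auto)
  also have "\<dots> \<le> (LINT r|lborel. (scaled g r)\<^sup>2) * ((y - x) / x)"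
    by (intro mult_right_mono set_integral_le_scaled i) (use x in auto)
  finally show ?thesis .
qed

text \<open>Fatou's lemma for integrals that are bounded by \<open>c\<close> only asymptotically;
  letting \<open>e\<close> tend to 0 removes the slack.\<close>

lemma nn_integral_fatou_bound:
  fixes f :: "nat \<Rightarrow> 'a \<Rightarrow> real"
  assumes m: "\<And>n. f n \<in> borel_measurable M"
    and lim: "AE x in M. (\<lambda>n. f n x) \<longlonglongrightarrow> g x"
    and bd: "\<And>e. e > 0 \<Longrightarrow> eventually (\<lambda>n. (\<integral>\<^sup>+x. ennreal (f n x) \<partial>M) \<le> ennreal (c + e)) sequentially"
  shows "(\<integral>\<^sup>+x. ennreal (g x) \<partial>M) \<le> ennreal c"
proof -
  have "(\<integral>\<^sup>+x. ennreal (g x) \<partial>M) = (\<integral>\<^sup>+x. liminf (\<lambda>n. ennreal (f n x)) \<partial>M)"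
  proof (rule nn_integral_cong_AE)
    show "AE x in M. ennreal (g x) = liminf (\<lambda>n. ennreal (f n x))"
      using lim by eventually_elim (auto intro!: lim_imp_Liminf[symmetric] tendsto_ennrealI)
  qed
  also have "\<dots> \<le> liminf (\<lambda>n. \<integral>\<^sup>+x. ennreal (f n x) \<partial>M)"
    by (rule nn_integral_liminf) (use m in measurable)
  finally have *: "(\<integral>\<^sup>+x. ennreal (g x) \<partial>M) \<le> liminf (\<lambda>n. \<integral>\<^sup>+x. ennreal (f n x) \<partial>M)" .
  have le: "(\<integral>\<^sup>+x. ennreal (g x) \<partial>M) \<le> ennreal (c + e)" if "e > 0" for e
  proof -
    have "liminf (\<lambda>n. \<integral>\<^sup>+x. ennreal (f n x) \<partial>M) \<le> limsup (\<lambda>n. \<integral>\<^sup>+x. ennreal (f n x) \<partial>M)"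
      by (rule Liminf_le_Limsup) simp
    also have "\<dots> \<le> ennreal (c + e)" by (rule Limsup_bounded) (use bd[OF that] in simp)
    finally show ?thesis using * by simp
  qed
  have "((\<lambda>e. ennreal (c + e)) \<longlongrightarrow> ennreal (c + 0)) (at_right 0)"
    by (intro tendsto_ennrealI tendsto_intros)
  from tendsto_lowerbound[OF this] show ?thesis
    using le by (auto simp: eventually_at_filter)
qed

lemma integrable_of_nn_bound:
  fixes f :: "'a \<Rightarrow> real"
  assumes "f \<in> borel_measurable M" "\<And>x. f x \<ge> 0" "(\<integral>\<^sup>+x. ennreal (f x) \<partial>M) \<le> ennreal c" "c \<ge> 0"
  shows "integrable M f" "(LINT x|M. f x) \<le> c"
proof -
  show i: "integrable M f"
    by (rule integrableI_nonneg) (use assms le_less_trans[OF assms(3) ennreal_less_top] in auto)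
  have "ennreal (LINT x|M. f x) \<le> ennreal c"
    using nn_integral_eq_integral[OF i] assms by simp
  thus "(LINT x|M. f x) \<le> c" using assms(4) by (simp add: ennreal_le_iff)
qed

lemma sq_add_le: "(x + y)\<^sup>2 \<le> 2 * x\<^sup>2 + 2 * (y::real)\<^sup>2"
  using sum_squares_bound[of x y] by (simp add: power2_sum)

lemma integrable_sq_add:
  fixes f g :: "'a \<Rightarrow> real"
  assumes [measurable]: "f \<in> borel_measurable M" "g \<in> borel_measurable M"
    and "integrable M (\<lambda>x. (f x)\<^sup>2)" "integrable M (\<lambda>x. (g x)\<^sup>2)"
  shows "integrable M (\<lambda>x. (f x + g x)\<^sup>2)"
  by (rule Bochner_Integration.integrable_bound[of M "\<lambda>x. 2 * (f x)\<^sup>2 + 2 * (g x)\<^sup>2"])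
     (use assms sq_add_le in \<open>auto intro!: integrable_add\<close>)

lemma integrable_sq_diff:
  fixes f g :: "'a \<Rightarrow> real"
  assumes "f \<in> borel_measurable M" "g \<in> borel_measurable M"
    and "integrable M (\<lambda>x. (f x)\<^sup>2)" "integrable M (\<lambda>x. (g x)\<^sup>2)"
  shows "integrable M (\<lambda>x. (f x - g x)\<^sup>2)"
  using integrable_sq_add[of f M "\<lambda>x. - g x"] assms by simp

text \<open>Riesz-Fischer. Almost everywhere convergence is obtained along a subsequence only, norm
  convergence for the whole sequence; both are used for weak limits.\<close>

lemma L2_complete:
  fixes h :: "nat \<Rightarrow> 'a \<Rightarrow> real"
  assumes m [measurable]: "\<And>n. h n \<in> borel_measurable M" and i: "\<And>n. integrable M (\<lambda>x. (h n x)\<^sup>2)"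
    and cau: "\<And>e. e > 0 \<Longrightarrow> \<exists>N. \<forall>m\<ge>N. \<forall>n\<ge>N. (LINT x|M. (h m x - h n x)\<^sup>2) \<le> e"
  obtains g r where "strict_mono (r :: nat \<Rightarrow> nat)" "g \<in> borel_measurable M" "AE x in M. (\<lambda>n. h (r n) x) \<longlonglongrightarrow> g x"
    "integrable M (\<lambda>x. (g x)\<^sup>2)" "(\<lambda>n. LINT x|M. (h n x - g x)\<^sup>2) \<longlonglongrightarrow> 0"
proof -
  define N where "N k = (SOME N. \<forall>m\<ge>N. \<forall>n\<ge>N. (LINT x|M. (h m x - h n x)\<^sup>2) \<le> (1/4) ^ k)" for k :: nat
  have N: "(LINT x|M. (h m x - h n x)\<^sup>2) \<le> (1/4) ^ k" if "m \<ge> N k" "n \<ge> N k" for m n k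
    using someI_ex[OF cau[of "(1/4) ^ k"]] that unfolding N_def by auto
  \<comment> \<open>The sum dominates \<open>N k\<close>, and the summand \<open>k\<close> makes the
    sequence strictly increasing.\<close>
  define r where "r k = k + (\<Sum>j\<le>k. N j)" for k
  have r: "strict_mono r" unfolding strict_mono_Suc_iff by (auto simp: r_def)
  have rN: "r k \<ge> N k" for k unfolding r_def by (rule trans_le_add2) (rule member_le_sum, auto)
  have rN': "r (Suc k) \<ge> N k" for k unfolding r_def by (rule trans_le_add2) (rule member_le_sum, auto)
  note di = integrable_sq_diff[OF m m i i]
  define D where "D k x = h (r (Suc k)) x - h (r k) x" for k x
  have Dm [measurable]: "D k \<in> borel_measurable M" for k unfolding D_def by measurable
  have Dn: "(\<integral>\<^sup>+x. ennreal ((D k x)\<^sup>2) \<partial>M) \<le> ennreal ((1/4) ^ k)" for k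
    using nn_integral_eq_integral[OF di[of "r (Suc k)" "r k"]] N[of k "r (Suc k)" "r k"] rN rN'
    by (simp add: D_def ennreal_leI)
  \<comment> \<open>The squared distances are at most 4^(-k). The weight 2^k leaves a convergent
    series of integrals, and wherever the weighted series is finite the increments are bounded by a
    multiple of 2^(-k/2), hence summable.\<close>
  have "(\<integral>\<^sup>+x. (\<Sum>k. ennreal (2 ^ k * (D k x)\<^sup>2)) \<partial>M) = (\<Sum>k. \<integral>\<^sup>+x. ennreal (2 ^ k * (D k x)\<^sup>2) \<partial>M)"
    by (rule nn_integral_suminf) measurable
  also have "\<dots> \<le> (\<Sum>k. ennreal ((1/2) ^ k))"
  proof (rule suminf_le)
    fix k
    have "(\<integral>\<^sup>+x. ennreal (2 ^ k * (D k x)\<^sup>2) \<partial>M) = ennreal (2 ^ k) * (\<integral>\<^sup>+x. ennreal ((D k x)\<^sup>2) \<partial>M)"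
      by (simp add: ennreal_mult nn_integral_cmult)
    also have "\<dots> \<le> ennreal (2 ^ k) * ennreal ((1/4) ^ k)" by (intro mult_left_mono Dn) auto
    also have "\<dots> = ennreal ((1/2) ^ k)"
      by (simp add: ennreal_mult[symmetric] power_mult_distrib[symmetric])
    finally show "(\<integral>\<^sup>+x. ennreal (2 ^ k * (D k x)\<^sup>2) \<partial>M) \<le> ennreal ((1/2) ^ k)" .
  qed auto
  also have "\<dots> = ennreal (\<Sum>k. (1/2) ^ k)" by (rule suminf_ennreal2) (auto intro: summable_geometric)
  finally have "(\<integral>\<^sup>+x. (\<Sum>k. ennreal (2 ^ k * (D k x)\<^sup>2)) \<partial>M) \<noteq> \<infinity>"
    using ennreal_less_top le_less_trans by (metis infinity_ennreal_def less_irrefl)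
  hence "AE x in M. (\<Sum>k. ennreal (2 ^ k * (D k x)\<^sup>2)) \<noteq> \<infinity>"
    by (intro nn_integral_PInf_AE) auto
  hence conv: "AE x in M. convergent (\<lambda>n. h (r n) x)"
  proof eventually_elim
    case (elim x)
    define C where "C = enn2real (\<Sum>k. ennreal (2 ^ k * (D k x)\<^sup>2))"
    have bd: "(D k x)\<^sup>2 \<le> C * (1/2) ^ k" for k
    proof -
      have le: "ennreal (2 ^ k * (D k x)\<^sup>2) \<le> (\<Sum>k. ennreal (2 ^ k * (D k x)\<^sup>2))"
      proof -
        have "(\<Sum>j\<in>{k}. ennreal (2 ^ j * (D j x)\<^sup>2)) \<le> (\<Sum>k. ennreal (2 ^ k * (D k x)\<^sup>2))"
          by (rule sum_le_suminf) auto
        thus ?thesis by simp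
      qed
      hence "2 ^ k * (D k x)\<^sup>2 \<le> C"
        using enn2real_mono[OF le] elim by (simp add: C_def less_top)
      thus ?thesis by (simp add: field_simps)
    qed
    have "norm (D k x) \<le> sqrt C * sqrt (1/2) ^ k" for k
    proof -
      have "\<bar>D k x\<bar> = sqrt ((D k x)\<^sup>2)" by simp
      also have "\<dots> \<le> sqrt (C * (1/2) ^ k)" by (rule real_sqrt_le_mono[OF bd])
      finally show ?thesis by (simp add: real_sqrt_mult real_sqrt_power)
    qed
    moreover have "summable (\<lambda>k. sqrt C * sqrt (1/2) ^ k)"
      by (intro summable_mult summable_geometric) (simp add: real_sqrt_lt_1_iff)
    ultimately have "summable (\<lambda>k. D k x)" by (rule summable_comparison_test'[rotated, where N = 0])
    hence "convergent (\<lambda>n. \<Sum>k<n. D k x)" by (simp add: summable_iff_convergent)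
    moreover have "(\<lambda>n. h (r 0) x + (\<Sum>k<n. D k x)) = (\<lambda>n. h (r n) x)"
      unfolding D_def by (subst sum_lessThan_telescope) simp
    ultimately show ?case using convergent_add[OF convergent_const, of "\<lambda>n. \<Sum>k<n. D k x" "h (r 0) x"] by simp
  qed
  define g where "g x = lim (\<lambda>n. h (r n) x)" for x
  have gm [measurable]: "g \<in> borel_measurable M"
    unfolding g_def[abs_def] by (rule borel_measurable_lim_metric) measurable
  have lim: "AE x in M. (\<lambda>n. h (r n) x) \<longlonglongrightarrow> g x"
    using conv by eventually_elim (simp add: g_def convergent_LIMSEQ_iff)
  \<comment> \<open>The Cauchy condition passes to the limit in its second index by Fatou.\<close>
  have le: "(\<integral>\<^sup>+x. ennreal ((h n x - g x)\<^sup>2) \<partial>M) \<le> ennreal e"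
    if n: "\<forall>m\<ge>K. \<forall>n\<ge>K. (LINT x|M. (h m x - h n x)\<^sup>2) \<le> e" "n \<ge> K" "e > 0" for n K e
  proof (rule nn_integral_fatou_bound[where f = "\<lambda>k x. (h n x - h (r k) x)\<^sup>2"])
    show "AE x in M. (\<lambda>k. (h n x - h (r k) x)\<^sup>2) \<longlonglongrightarrow> (h n x - g x)\<^sup>2"
      using lim by eventually_elim (intro tendsto_intros)
    fix e' :: real assume "e' > 0"
    show "\<forall>\<^sub>F k in sequentially. (\<integral>\<^sup>+ x. ennreal ((h n x - h (r k) x)\<^sup>2) \<partial>M) \<le> ennreal (e + e')"
    proof (rule eventually_sequentiallyI[of K])
      fix k assume "K \<le> k"
      hence "r k \<ge> K" using seq_suble[OF r, of k] by simp
      thus "(\<integral>\<^sup>+ x. ennreal ((h n x - h (r k) x)\<^sup>2) \<partial>M) \<le> ennreal (e + e')"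
        using nn_integral_eq_integral[OF di[of n "r k"]] n \<open>e' > 0\<close>
        by (auto intro!: ennreal_leI simp: add_increasing2)
    qed
  qed measurable
  have fin: "\<exists>K. \<forall>n\<ge>K. integrable M (\<lambda>x. (h n x - g x)\<^sup>2) \<and> (LINT x|M. (h n x - g x)\<^sup>2) \<le> e" if pos: "e > 0" for e
  proof -
    obtain K where K: "\<forall>m\<ge>K. \<forall>n\<ge>K. (LINT x|M. (h m x - h n x)\<^sup>2) \<le> e" using cau[OF pos] by blast
    show ?thesis
      by (rule exI[of _ K]) (intro allI impI conjI integrable_of_nn_bound[OF _ _ le[OF K]], use pos in auto)
  qed
  obtain K where K: "integrable M (\<lambda>x. (h K x - g x)\<^sup>2)" using fin[of 1] by auto
  have gi: "integrable M (\<lambda>x. (g x)\<^sup>2)"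
    using integrable_sq_diff[OF m[of K] _ i K] by simp
  have "(\<lambda>n. LINT x|M. (h n x - g x)\<^sup>2) \<longlonglongrightarrow> 0"
    unfolding LIMSEQ_iff
  proof (intro allI impI)
    fix e :: real assume "e > 0"
    then obtain K where K: "\<And>n. n \<ge> K \<Longrightarrow> (LINT x|M. (h n x - g x)\<^sup>2) \<le> e / 2" using fin[of "e/2"] by auto
    have "0 \<le> (LINT x|M. (h n x - g x)\<^sup>2)" for n by (rule integral_nonneg_AE) auto
    thus "\<exists>no. \<forall>n\<ge>no. norm ((LINT x|M. (h n x - g x)\<^sup>2) - 0) < e"
      using K \<open>e > 0\<close> by (intro exI[of _ K]) (force)
  qed
  with r gm lim gi show thesis by (rule that)
qed

lemma set_integrable_sq_add:
  fixes f g :: "'a \<Rightarrow> real"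
  assumes "set_integrable M A f" "set_integrable M A g"
    and "set_integrable M A (\<lambda>x. (f x)\<^sup>2)" "set_integrable M A (\<lambda>x. (g x)\<^sup>2)"
  shows "set_integrable M A (\<lambda>x. (f x + g x)\<^sup>2)"
proof -
  have e: "(indicator A x *\<^sub>R h x)\<^sup>2 = indicator A x *\<^sub>R (h x)\<^sup>2" for h :: "'a \<Rightarrow> real" and x
    by (auto simp: indicator_def)
  have "integrable M (\<lambda>x. (indicator A x *\<^sub>R f x + indicator A x *\<^sub>R g x)\<^sup>2)"
    by (rule integrable_sq_add; (unfold e)?; use assms[unfolded set_integrable_def] borel_measurable_integrable in blast)
  also have "(\<lambda>x. (indicator A x *\<^sub>R f x + indicator A x *\<^sub>R g x)\<^sup>2) = (\<lambda>x. indicator A x *\<^sub>R (f x + g x)\<^sup>2)"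
    by (auto simp: indicator_def fun_eq_iff)
  finally show ?thesis unfolding set_integrable_def .
qed

lemma set_integrable_sq_diff:
  fixes f g :: "'a \<Rightarrow> real"
  assumes "set_integrable M A f" "set_integrable M A g"
    and "set_integrable M A (\<lambda>x. (f x)\<^sup>2)" "set_integrable M A (\<lambda>x. (g x)\<^sup>2)"
  shows "set_integrable M A (\<lambda>x. (f x - g x)\<^sup>2)"
proof -
  have "set_integrable M A (\<lambda>x. - g x)" using assms(2) by (simp add: set_integrable_def)
  from set_integrable_sq_add[OF assms(1) this assms(3)] show ?thesis using assms(4) by simp
qed

section \<open>Primitives under algebraic operations\<close>

lemma primitive_add:
  assumes "primitive f g" "primitive f' g'"
  shows "primitive (\<lambda>x. f x + f' x) (\<lambda>x. g x + g' x)"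
  unfolding primitive_def
proof (intro allI impI conjI)
  fix a b :: real assume a: "0 < a" "a \<le> b"
  note p = primitiveD[OF assms(1) a(1), of b] and q = primitiveD[OF assms(2) a(1), of b]
  show "ac_on a b (\<lambda>x. f x + f' x) (\<lambda>x. g x + g' x)" by (intro ac_on_add p q)
  show "set_integrable lborel {a..b} (\<lambda>x. (g x + g' x)\<^sup>2)" by (intro set_integrable_sq_add p q)
qed

lemma primitive_cmult:
  assumes "primitive f g"
  shows "primitive (\<lambda>x. c * f x) (\<lambda>x. c * g x)"
  using assms unfolding primitive_def by (auto intro: ac_on_cmult simp: power_mult_distrib)

lemma primitive_diff:
  assumes "primitive f g" "primitive f' g'"
  shows "primitive (\<lambda>x. f x - f' x) (\<lambda>x. g x - g' x)"
  using primitive_add[OF assms(1) primitive_cmult[OF assms(2), of "-1"]] by simp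

lemma primitive_cong:
  assumes "primitive f g" "\<And>x. x > 0 \<Longrightarrow> f x = f' x" "\<And>x. x > 0 \<Longrightarrow> g x = g' x"
  shows "primitive f' g'"
  unfolding primitive_def
proof (intro allI impI)
  fix a b :: real assume a: "0 < a" "a \<le> b"
  note p = primitiveD[OF assms(1) a(1), of b]
  have e: "indicator {a..b} x *\<^sub>R h (g x) = indicator {a..b} x *\<^sub>R h (g' x)" for h :: "real \<Rightarrow> real" and x
    using assms(3) a by (auto simp: indicator_def)
  have m: "set_borel_measurable lborel {a..b} g'"
    using borel_measurable_integrable[OF p(2)[unfolded set_integrable_def]] e[where h = "\<lambda>x. x"]
    by (simp only: set_borel_measurable_def)
  have "ac_on a b f' g'"
    by (rule ac_on_cong[OF p(1) _ _ m]) (use assms a in auto)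
  moreover have "set_integrable lborel {a..b} (\<lambda>x. (g' x)\<^sup>2)"
    using p(3) e[where h = "\<lambda>x. x\<^sup>2"] by (simp only: set_integrable_def)
  ultimately show "ac_on a b f' g' \<and> set_integrable lborel {a..b} (\<lambda>x. (g' x)\<^sup>2)" ..
qed

lemma primitive_continuous:
  assumes "\<And>x. x > 0 \<Longrightarrow> (f has_real_derivative g x) (at x)" "continuous_on {0<..} g"
  shows "primitive f g"
  unfolding primitive_def
proof (intro allI impI conjI)
  fix a b :: real assume a: "0 < a" "a \<le> b"
  have c: "continuous_on {a..b} g" by (rule continuous_on_subset[OF assms(2)]) (use a in auto)
  show "ac_on a b f g"
    by (rule ac_on_C1) (use assms(1) a c in \<open>auto intro: has_field_derivative_at_within\<close>)
  show "set_integrable lborel {a..b} (\<lambda>x. (g x)\<^sup>2)"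
    by (intro set_integrable_continuous continuous_intros c)
qed

text \<open>For the parallelogram argument behind Mazur's lemma, closure under midpoints suffices instead of
  convex hulls.\<close>

inductive_set midpoints :: "(nat \<Rightarrow> real \<Rightarrow> real) \<Rightarrow> (nat \<Rightarrow> real \<Rightarrow> real) \<Rightarrow> nat \<Rightarrow> ((real \<Rightarrow> real) \<times> (real \<Rightarrow> real)) set"
  for F G k where
  base: "n \<ge> k \<Longrightarrow> (F n, G n) \<in> midpoints F G k"
| mid: "p \<in> midpoints F G k \<Longrightarrow> q \<in> midpoints F G k \<Longrightarrow>
    (\<lambda>x. (fst p x + fst q x) / 2, \<lambda>x. (snd p x + snd q x) / 2) \<in> midpoints F G k"

lemma midpoints_mono: "k \<le> l \<Longrightarrow> midpoints F G l \<subseteq> midpoints F G k"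
proof
  fix p assume kl: "k \<le> l" and "p \<in> midpoints F G l"
  from this(2) show "p \<in> midpoints F G k"
    by induction (use kl in \<open>auto intro: midpoints.intros\<close>)
qed

lemma midpoints_primitive:
  assumes "p \<in> midpoints F G k" "\<And>n. primitive (F n) (G n)"
  shows "primitive (fst p) (snd p)"
  using assms(1)
proof induction
  case (mid p q)
  show ?case using primitive_cmult[OF primitive_add[OF mid(3,4)], of "1/2"] by simp
qed (use assms(2) in auto)

lemma midpoints_integrable:
  assumes "p \<in> midpoints F G k" "\<And>n. primitive (F n) (G n)" "\<And>n. integrable lborel (\<lambda>r. (scaled (G n) r)\<^sup>2)"
  shows "integrable lborel (\<lambda>r. (scaled (snd p) r)\<^sup>2)"
  using assms(1)
proof induction
  case (mid p q)
  have m: "scaled (snd p) \<in> borel_measurable lborel" "scaled (snd q) \<in> borel_measurable lborel"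
    using scaled_measurable[OF primitive_measurable(1)[OF midpoints_primitive[OF mid(1) assms(2)]]]
      scaled_measurable[OF primitive_measurable(1)[OF midpoints_primitive[OF mid(2) assms(2)]]] by simp_all
  have "(\<lambda>r. (scaled (\<lambda>x. (snd p x + snd q x) / 2) r)\<^sup>2) = (\<lambda>r. (1/4) * (scaled (snd p) r + scaled (snd q) r)\<^sup>2)"
    by (auto simp: scaled_def fun_eq_iff power2_eq_square algebra_simps)
  thus ?case using integrable_sq_add[OF m mid(3,4)] by simp
qed (use assms(3) in auto)

lemma midpoints_close:
  assumes "p \<in> midpoints F G k" "\<And>n. n \<ge> k \<Longrightarrow> \<bar>F n x - L\<bar> \<le> e"
  shows "\<bar>fst p x - L\<bar> \<le> e"
  using assms(1)
  by induction (use assms(2) in \<open>auto simp: abs_le_iff field_simps\<close>)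

text \<open>Weak lower semicontinuity without weak topology. Almost minimal elements of the midpoint
  closures of the tails are a Cauchy sequence for the weighted norm, by the parallelogram law. Their
  values still converge to \<open>f\<close>, since midpoints of values near \<open>f x\<close> are
  near \<open>f x\<close>; so the norm limit is a derivative of \<open>f\<close>.\<close>

lemma weak_limit_primitive:
  assumes P: "\<And>n. primitive (F n) (G n)" and I: "\<And>n. integrable lborel (\<lambda>r. (scaled (G n) r)\<^sup>2)"
    and e: "(\<lambda>n. LINT r|lborel. (scaled (G n) r)\<^sup>2) \<longlonglongrightarrow> e"
    and F: "\<And>x. x > 0 \<Longrightarrow> (\<lambda>n. F n x) \<longlonglongrightarrow> f x"
  obtains g where "primitive f g" "integrable lborel (\<lambda>r. (scaled g r)\<^sup>2)" "(LINT r|lborel. (scaled g r)\<^sup>2) \<le> e"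
proof -
  define N where "N g = (LINT r|lborel. (scaled g r)\<^sup>2)" for g
  define S where "S k = midpoints F G k" for k
  define V where "V k = (\<lambda>p. N (snd p)) ` S k" for k
  define m where "m k = Inf (V k)" for k
  have N0: "N g \<ge> 0" for g unfolding N_def by (rule integral_nonneg_AE) auto
  have S: "(F n, G n) \<in> S k" if "n \<ge> k" for n k using that by (auto simp: S_def intro: midpoints.base)
  have bdd: "bdd_below (V k)" for k by (rule bdd_belowI[of _ 0]) (auto simp: V_def N0)
  have mle: "m k \<le> N (snd p)" if "p \<in> S k" for p k
    unfolding m_def by (rule cInf_lower[OF _ bdd]) (use that in \<open>auto simp: V_def\<close>)
  have ne: "V k \<noteq> {}" for k using S[of k k] by (auto simp: V_def)
  \<comment> \<open>The closures shrink along the tails, so the infima increase; they are bounded by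
    \<open>e\<close> because each closure contains the tail of the sequence itself.\<close>
  have minc: "incseq m"
    unfolding incseq_def m_def
    by (intro allI impI cInf_superset_mono ne bdd) (auto simp: V_def S_def dest: midpoints_mono[THEN subsetD])
  have me: "m k \<le> e" for k
  proof (rule LIMSEQ_le_const[OF e])
    show "\<exists>N. \<forall>n\<ge>N. m k \<le> (LINT r|lborel. (scaled (G n) r)\<^sup>2)"
      using mle[OF S] by (auto simp: N_def)
  qed
  obtain L where L: "m \<longlonglongrightarrow> L" "\<And>k. m k \<le> L"
    using incseq_convergent[OF minc, of e] me by metis
  have "\<exists>p\<in>S k. N (snd p) < m k + 1 / real (Suc k)" for k
  proof -
    have "Inf (V k) < m k + 1 / real (Suc k)" by (simp add: m_def)
    from cInf_lessD[OF ne this] show ?thesis by (auto simp: V_def)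
  qed
  then obtain p where p: "\<And>k. p k \<in> S k" "\<And>k. N (snd (p k)) < m k + 1 / real (Suc k)" by metis
  define f' where "f' k = fst (p k)" for k
  define g' where "g' k = snd (p k)" for k
  have P': "primitive (f' k) (g' k)" for k
    unfolding f'_def g'_def by (rule midpoints_primitive[OF p(1)[unfolded S_def] P])
  have I': "integrable lborel (\<lambda>r. (scaled (g' k) r)\<^sup>2)" for k
    unfolding g'_def by (rule midpoints_integrable[OF p(1)[unfolded S_def] P I])
  have M': "scaled (g' k) \<in> borel_measurable lborel" for k
    using scaled_measurable[OF primitive_measurable(1)[OF P']] by simp
  \<comment> \<open>For \<open>k \<le> l\<close> the midpoint of \<open>p k\<close> and
    \<open>p l\<close> lies in the closure of tail \<open>k\<close>, so its norm is at least
    \<open>m k\<close>; the parallelogram law then forces the two to be close.\<close>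
  have par: "(LINT r|lborel. (scaled (g' k) r - scaled (g' l) r)\<^sup>2) \<le> 2 * (L - m K) + 4 / real (Suc K)"
    if "K \<le> k" "k \<le> l" for k l K
  proof -
    define h where "h = (\<lambda>x. (snd (p k) x + snd (p l) x) / 2)"
    have "p l \<in> S k" using p(1)[of l] midpoints_mono[OF \<open>k \<le> l\<close>] by (auto simp: S_def)
    hence hS: "(\<lambda>x. (fst (p k) x + fst (p l) x) / 2, h) \<in> S k"
      using p(1)[of k] unfolding S_def h_def by (intro midpoints.mid)
    have ih: "integrable lborel (\<lambda>r. (scaled h r)\<^sup>2)"
      using midpoints_integrable[OF hS[unfolded S_def] P I] by simp
    have hm: "m k \<le> N h" using mle[OF hS] by simp
    have pt: "(scaled (g' k) r - scaled (g' l) r)\<^sup>2 = 2 * (scaled (g' k) r)\<^sup>2 + 2 * (scaled (g' l) r)\<^sup>2 - 4 * (scaled h r)\<^sup>2" for r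
      by (auto simp: scaled_def h_def g'_def power2_eq_square indicator_def field_simps)
    have "(LINT r|lborel. (scaled (g' k) r - scaled (g' l) r)\<^sup>2) = 2 * N (g' k) + 2 * N (g' l) - 4 * N h"
      unfolding pt N_def using I' ih by simp
    also have "\<dots> \<le> 2 * (m k + 1 / real (Suc k)) + 2 * (m l + 1 / real (Suc l)) - 4 * m k"
      using p(2)[of k] p(2)[of l] hm by (simp add: g'_def)
    also have "\<dots> = 2 * (m l - m k) + 2 * (1 / real (Suc k)) + 2 * (1 / real (Suc l))" by simp
    also have "\<dots> \<le> 2 * (L - m K) + 2 * (1 / real (Suc K)) + 2 * (1 / real (Suc K))"
    proof -
      have "1 / real (Suc k) \<le> 1 / real (Suc K)" "1 / real (Suc l) \<le> 1 / real (Suc K)"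
        using that by (auto intro!: divide_left_mono)
      moreover have "m K \<le> m k" using minc that by (auto simp: incseq_def)
      ultimately show ?thesis using L(2)[of l] by simp
    qed
    finally show ?thesis by simp
  qed
  have cau: "\<exists>K. \<forall>k\<ge>K. \<forall>l\<ge>K. (LINT r|lborel. (scaled (g' k) r - scaled (g' l) r)\<^sup>2) \<le> \<epsilon>" if "\<epsilon> > 0" for \<epsilon>
  proof -
    have inv: "(\<lambda>n. 1 / real (Suc n)) \<longlonglongrightarrow> 0"
      using LIMSEQ_inverse_real_of_nat by (simp add: inverse_eq_divide)
    have "(\<lambda>K. 2 * (L - m K) + 4 * (1 / real (Suc K))) \<longlonglongrightarrow> 2 * (L - L) + 4 * 0"
      by (intro tendsto_intros L inv)
    hence "eventually (\<lambda>K. 2 * (L - m K) + 4 * (1 / real (Suc K)) < \<epsilon>) sequentially"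
      using that by (intro order_tendstoD(2)[of _ "2 * (L - L) + 4 * 0"]) auto
    then obtain K where K: "2 * (L - m K) + 4 / real (Suc K) < \<epsilon>"
      by (auto simp: eventually_sequentially)
    have sym: "(LINT r|lborel. (scaled (g' k) r - scaled (g' l) r)\<^sup>2) = (LINT r|lborel. (scaled (g' l) r - scaled (g' k) r)\<^sup>2)" for k l
      by (simp add: power2_commute)
    show ?thesis
    proof (rule exI[of _ K], intro allI impI)
      fix k l assume "k \<ge> K" "l \<ge> K"
      thus "(LINT r|lborel. (scaled (g' k) r - scaled (g' l) r)\<^sup>2) \<le> \<epsilon>"
        using par[of K k l] par[of K l k] sym[of k l] K by (cases "k \<le> l") auto
    qed
  qed
  from L2_complete[of "\<lambda>k. scaled (g' k)", OF M' I' cau]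
  obtain h r where r: "strict_mono (r :: nat \<Rightarrow> nat)" and hm: "h \<in> borel_measurable lborel"
    and ae: "AE x in lborel. (\<lambda>n. scaled (g' (r n)) x) \<longlonglongrightarrow> h x"
    and hi: "integrable lborel (\<lambda>x. (h x)\<^sup>2)" and hl: "(\<lambda>n. LINT x|lborel. (scaled (g' n) x - h x)\<^sup>2) \<longlonglongrightarrow> 0"
    by blast
  define g where "g x = h x / sqrt x" for x
  have sg: "scaled g x = indicator {0<..} x * h x" for x
    by (auto simp: scaled_def g_def indicator_def)
  have gm: "set_borel_measurable lborel {a..b} g" for a b
    unfolding set_borel_measurable_def g_def using hm by measurable
  have gi2: "set_integrable lborel {a..b} (\<lambda>x. (g x)\<^sup>2)" if a: "0 < a" for a b
    unfolding set_integrable_def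
  proof (rule Bochner_Integration.integrable_bound)
    show "integrable lborel (\<lambda>x. 1 / a * (h x)\<^sup>2)" using hi by simp
    show "(\<lambda>x. indicator {a..b} x *\<^sub>R (g x)\<^sup>2) \<in> borel_measurable lborel"
      unfolding g_def using hm by measurable
    have "(h x)\<^sup>2 / x \<le> (h x)\<^sup>2 / a" if "x \<ge> a" for x
      by (rule divide_left_mono) (use that a in auto)
    thus "AE x in lborel. norm (indicator {a..b} x *\<^sub>R (g x)\<^sup>2) \<le> norm (1 / a * (h x)\<^sup>2)"
      using a by (auto simp: g_def indicator_def power_divide)
  qed
  have gi: "set_integrable lborel {a..b} g" if "0 < a" for a b
    by (rule set_integrable_square_imp[OF gm gi2[OF that]])
  have conv: "(\<lambda>k. f' k x) \<longlonglongrightarrow> f x" if x: "x > 0" for x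
    unfolding LIMSEQ_iff
  proof (intro allI impI)
    fix \<epsilon> :: real assume "\<epsilon> > 0"
    then obtain K where K: "\<And>n. n \<ge> K \<Longrightarrow> \<bar>F n x - f x\<bar> \<le> \<epsilon> / 2"
      using F[OF x] unfolding LIMSEQ_iff by (metis half_gt_zero less_imp_le real_norm_def)
    have "\<bar>f' k x - f x\<bar> \<le> \<epsilon> / 2" if "k \<ge> K" for k
      unfolding f'_def by (rule midpoints_close[OF p(1)[unfolded S_def]]) (use K that in auto)
    thus "\<exists>no. \<forall>n\<ge>no. norm (f' n x - f x) < \<epsilon>"
      using \<open>\<epsilon> > 0\<close> by (intro exI[of _ K]) force
  qed
  \<comment> \<open>Both sides are limits of \<open>f' k y - f' k x\<close>: on the left by
    pointwise convergence, on the right by the weighted Cauchy-Schwarz inequality.\<close>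
  have ftc: "f y - f x = (LINT t:{x..y}|lborel. g t)" if xy: "0 < x" "x \<le> y" for x y
  proof -
    have lim1: "(\<lambda>k. f' k y - f' k x) \<longlonglongrightarrow> f y - f x" by (intro tendsto_diff conv) (use xy in auto)
    have "(\<lambda>k. f' k y - f' k x) \<longlonglongrightarrow> (LINT t:{x..y}|lborel. g t)"
    proof (rule LIM_zero_cancel, rule tendsto_rabs_zero_cancel, rule tendsto_sandwich[OF _ _ tendsto_const])
      have q: "(\<lambda>k. sqrt ((LINT r|lborel. (scaled (g' k) r - h r)\<^sup>2) * ((y - x) / x))) \<longlonglongrightarrow> sqrt (0 * ((y - x) / x))"
        by (intro tendsto_intros hl)
      show "(\<lambda>k. sqrt ((LINT r|lborel. (scaled (g' k) r - h r)\<^sup>2) * ((y - x) / x))) \<longlonglongrightarrow> 0" using q by simp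
      show "\<forall>\<^sub>F k in sequentially. \<bar>f' k y - f' k x - (LINT t:{x..y}|lborel. g t)\<bar> \<le> sqrt ((LINT r|lborel. (scaled (g' k) r - h r)\<^sup>2) * ((y - x) / x))"
      proof (rule always_eventually, rule allI)
        fix k
        note d = primitiveD[OF P'[of k] xy(1), of y]
        have id: "set_integrable lborel {x..y} (\<lambda>t. g' k t - g t)" by (rule set_integral_diff(1)[OF d(2) gi[OF xy(1)]])
        have id2: "set_integrable lborel {x..y} (\<lambda>t. (g' k t - g t)\<^sup>2)"
          by (intro set_integrable_sq_diff d gi gi2 xy)
        have isd: "integrable lborel (\<lambda>t. (scaled (\<lambda>t. g' k t - g t) t)\<^sup>2)"
        proof (rule Bochner_Integration.integrable_bound[OF integrable_sq_diff[OF M' hm I' hi]])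
          have "scaled (\<lambda>t. g' k t - g t) = (\<lambda>t. scaled (g' k) t - indicator {0<..} t * h t)"
            by (auto simp: scaled_def g_def fun_eq_iff indicator_def field_simps)
          thus "(\<lambda>t. (scaled (\<lambda>t. g' k t - g t) t)\<^sup>2) \<in> borel_measurable lborel" using M' hm by simp
        qed (auto simp: scaled_def g_def indicator_def field_simps)
        have "\<bar>f' k y - f' k x - (LINT t:{x..y}|lborel. g t)\<bar> = \<bar>LINT t:{x..y}|lborel. g' k t - g t\<bar>"
          using d(5)[OF xy(2)] set_integral_diff(2)[OF d(2) gi[OF xy(1)]] by simp
        also have "\<dots> \<le> (LINT t:{x..y}|lborel. \<bar>g' k t - g t\<bar>)"
          by (intro set_integral_abs_le set_integrable_abs id) auto
        also have "\<dots> \<le> sqrt ((LINT t:{x..y}|lborel. t * (g' k t - g t)\<^sup>2) * ((y - x) / x))"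
          by (intro real_le_rsqrt integral_abs_square_le id id2 xy)
        also have "\<dots> \<le> sqrt ((LINT t|lborel. (scaled (\<lambda>t. g' k t - g t) t)\<^sup>2) * ((y - x) / x))"
          by (intro real_sqrt_le_mono mult_right_mono set_integral_le_scaled isd) (use xy in auto)
        also have "\<dots> \<le> sqrt ((LINT r|lborel. (scaled (g' k) r - h r)\<^sup>2) * ((y - x) / x))"
          by (intro real_sqrt_le_mono mult_right_mono integral_mono[OF isd integrable_sq_diff[OF M' hm I' hi]])
             (use xy in \<open>auto simp: scaled_def g_def indicator_def field_simps\<close>)
        finally show "\<bar>f' k y - f' k x - (LINT t:{x..y}|lborel. g t)\<bar> \<le> sqrt ((LINT r|lborel. (scaled (g' k) r - h r)\<^sup>2) * ((y - x) / x))" .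
      qed
    qed auto
    from LIMSEQ_unique[OF lim1 this] show ?thesis .
  qed
  have prim: "primitive f g"
    unfolding primitive_def ac_on_def using gi gi2 ftc by auto
  have "(\<integral>\<^sup>+x. ennreal ((h x)\<^sup>2) \<partial>lborel) \<le> ennreal e"
  proof (rule nn_integral_fatou_bound[where f = "\<lambda>n x. (scaled (g' (r n)) x)\<^sup>2"])
    show "AE x in lborel. (\<lambda>n. (scaled (g' (r n)) x)\<^sup>2) \<longlonglongrightarrow> (h x)\<^sup>2"
      using ae by eventually_elim (intro tendsto_intros)
    fix \<epsilon> :: real assume \<epsilon>: "\<epsilon> > 0"
    have "eventually (\<lambda>n. 1 / real (Suc n) < \<epsilon>) sequentially"
      using LIMSEQ_inverse_real_of_nat \<epsilon> by (intro order_tendstoD(2)[of _ 0]) (auto simp: inverse_eq_divide)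
    then obtain K where K: "\<And>n. n \<ge> K \<Longrightarrow> 1 / real (Suc n) < \<epsilon>" by (auto simp: eventually_sequentially)
    show "\<forall>\<^sub>F n in sequentially. (\<integral>\<^sup>+ x. ennreal ((scaled (g' (r n)) x)\<^sup>2) \<partial>lborel) \<le> ennreal (e + \<epsilon>)"
    proof (rule eventually_sequentiallyI[of K])
      fix n assume "K \<le> n"
      hence "r n \<ge> K" using seq_suble[OF r, of n] by simp
      from K[OF this] have "N (g' (r n)) \<le> e + \<epsilon>" using p(2)[of "r n"] me[of "r n"] by (simp add: g'_def)
      thus "(\<integral>\<^sup>+ x. ennreal ((scaled (g' (r n)) x)\<^sup>2) \<partial>lborel) \<le> ennreal (e + \<epsilon>)"
        using nn_integral_eq_integral[OF I'[of "r n"]] by (simp add: N_def ennreal_leI)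
    qed
  qed (use M' in measurable)
  moreover have "0 \<le> m 0" unfolding m_def by (rule cInf_greatest[OF ne]) (auto simp: V_def N0)
  hence "e \<ge> 0" using me[of 0] by simp
  ultimately have he: "(LINT x|lborel. (h x)\<^sup>2) \<le> e"
    by (intro integrable_of_nn_bound) (use hm in auto)
  have sgi: "integrable lborel (\<lambda>x. (scaled g x)\<^sup>2)"
    by (rule Bochner_Integration.integrable_bound[OF hi]) (use hm in \<open>auto simp: sg[abs_def] indicator_def\<close>)
  have "(LINT x|lborel. (scaled g x)\<^sup>2) \<le> (LINT x|lborel. (h x)\<^sup>2)"
    by (rule integral_mono[OF sgi hi]) (auto simp: sg indicator_def)
  with he prim sgi show thesis by (intro that) auto
qed

section \<open>Compactness for pointwise convergence\<close>

lemma hoelder_abs_bound: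
  assumes p: "primitive f g" and i: "integrable lborel (\<lambda>r. (scaled g r)\<^sup>2)"
    and e: "(LINT r|lborel. (scaled g r)\<^sup>2) \<le> e" and x: "0 < x" "x \<le> y"
  shows "\<bar>f y - f x\<bar> \<le> sqrt (e * ((y - x) / x))"
proof -
  have "(f y - f x)\<^sup>2 \<le> e * ((y - x) / x)"
    by (rule order_trans[OF primitive_hoelder[OF p i x] mult_right_mono[OF e]]) (use x in auto)
  thus ?thesis using real_sqrt_le_mono by fastforce
qed

text \<open>The Arzela-Ascoli argument: a diagonal subsequence on the positive rationals, extended
  to all points by the common modulus of continuity \<open>D\<close>.\<close>

lemma pointwise_convergent_subsequence:
  assumes P: "\<And>n. primitive (F n) (G n)" and I: "\<And>n. integrable lborel (\<lambda>r. (scaled (G n) r)\<^sup>2)"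
    and e: "\<And>n. (LINT r|lborel. (scaled (G n) r)\<^sup>2) \<le> e" and c: "c > 0" "\<And>n. \<bar>F n c\<bar> \<le> B"
  obtains r f where "strict_mono (r :: nat \<Rightarrow> nat)" "\<And>x. x > 0 \<Longrightarrow> (\<lambda>n. F (r n) x) \<longlonglongrightarrow> f x"
proof -
  define D where "D x y = sqrt (e * (\<bar>y - x\<bar> / min x y))" for x y :: real
  have H: "\<bar>F n y - F n x\<bar> \<le> D x y" if "x > 0" "y > 0" for n x y
    using hoelder_abs_bound[OF P I e, of x y n] hoelder_abs_bound[OF P I e, of y x n] that
    unfolding D_def by (cases "x \<le> y") (auto simp: min_def abs_minus_commute)
  \<comment> \<open>A bound for all \<open>F n x\<close> that depends on \<open>x\<close>. Dividing
    by it gives the uniform bound 1 required for the diagonal argument; the \<open>+ 1\<close> keeps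
    the divisor positive.\<close>
  define W where "W x = B + D c x + 1" for x
  have W: "\<bar>F n x\<bar> \<le> W x" "W x > 0" if "x > 0" for n x
  proof -
    show "\<bar>F n x\<bar> \<le> W x" using H[OF c(1) that, of n] c(2)[of n] unfolding W_def by linarith
    show "W x > 0" using H[OF c(1) that, of n] c(2)[of n] unfolding W_def by linarith
  qed
  define S where "S = {x \<in> \<rat>. x > (0::real)}"
  have "countable S" unfolding S_def by (rule countable_subset[OF _ countable_rat]) auto
  moreover have "norm (F n x / W x) \<le> 1" if "x \<in> S" for n x
    using W(1)[of x n] W(2)[of x] that by (simp add: S_def field_simps)
  ultimately obtain r where r: "strict_mono (r :: nat \<Rightarrow> nat)" "\<And>x. x \<in> S \<Longrightarrow> \<exists>l. (\<lambda>n. F (r n) x / W x) \<longlonglongrightarrow> l"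
    using function_convergent_subsequence[of S "\<lambda>n x. F n x / W x" 1] by metis
  have cS: "Cauchy (\<lambda>n. F (r n) x)" if x: "x \<in> S" for x
  proof -
    obtain l where "(\<lambda>n. F (r n) x / W x) \<longlonglongrightarrow> l" using r(2)[OF x] by blast
    from tendsto_mult_left[OF this, of "W x"] have "(\<lambda>n. F (r n) x) \<longlonglongrightarrow> W x * l"
      using W(2)[of x] x by (simp add: S_def)
    thus ?thesis by (rule LIMSEQ_imp_Cauchy)
  qed
  have "convergent (\<lambda>n. F (r n) x)" if x: "x > 0" for x
  proof (rule Cauchy_convergent, rule metric_CauchyI)
    fix \<epsilon> :: real assume \<epsilon>: "\<epsilon> > 0"
    have "((\<lambda>y. D x y) \<longlongrightarrow> D x x) (at x)"
      unfolding D_def by (intro tendsto_intros) (use x in auto)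
    hence "eventually (\<lambda>y. D x y < \<epsilon> / 3) (at x)"
      using \<epsilon> by (intro order_tendstoD(2)) (auto simp: D_def)
    then obtain d where d: "d > 0" "\<And>y. y \<noteq> x \<Longrightarrow> \<bar>y - x\<bar> < d \<Longrightarrow> D x y < \<epsilon> / 3"
      unfolding eventually_at by (auto simp: dist_real_def)
    obtain q where q: "q \<in> \<rat>" "x < q" "q < x + d" using Rats_dense_in_real[of x "x + d"] d by auto
    hence Dq: "D x q < \<epsilon> / 3" and qS: "q \<in> S" using d(2)[of q] x by (auto simp: S_def)
    obtain M where M: "\<And>m n. m \<ge> M \<Longrightarrow> n \<ge> M \<Longrightarrow> dist (F (r m) q) (F (r n) q) < \<epsilon> / 3"
      using metric_CauchyD[OF cS[OF qS], of "\<epsilon> / 3"] \<epsilon> by auto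
    have "dist (F (r m) x) (F (r n) x) < \<epsilon>" if "m \<ge> M" "n \<ge> M" for m n
      using M[OF that] H[of x q "r m"] H[of x q "r n"] x q Dq unfolding dist_real_def by linarith
    thus "\<exists>M. \<forall>m\<ge>M. \<forall>n\<ge>M. dist (F (r m) x) (F (r n) x) < \<epsilon>" by blast
  qed
  hence "(\<lambda>n. F (r n) x) \<longlonglongrightarrow> lim (\<lambda>n. F (r n) x)" if "x > 0" for x
    using that by (simp add: convergent_LIMSEQ_iff)
  with r(1) show thesis by (rule that)
qed

subsection \<open>The energy as a sum of squares\<close>

text \<open>For \<open>r \<ge> \<lambda>\<close> the counterterm \<open>\<lambda>\<^sup>2/r\<close> is absorbed by completing squares around
  the exact solution \<open>w = 1\<close>, \<open>u = \<lambda>\<^sup>2/(2r)\<close>, at the price of the total derivative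
  of \<open>\<lambda>\<^sup>2 u/r\<close>.\<close>

definition shift :: "real \<Rightarrow> real \<Rightarrow> real" where
  "shift lam r = (if r < lam then 0 else lam\<^sup>2 / (2 * r))"

text \<open>Minus the derivative of \<open>shift\<close> on either side of \<open>lam\<close>; the
  jump of \<open>shift\<close> at \<open>lam\<close> is not seen.\<close>

definition shift' :: "real \<Rightarrow> real \<Rightarrow> real" where
  "shift' lam r = (if r < lam then 0 else lam\<^sup>2 / (2 * r\<^sup>2))"

text \<open>For \<open>r \<ge> lam\<close> this is w^2 - 1 + U' with U = u - lam^2/(2r), which
  vanishes for the exact solution w = 1, U = 0.\<close>

definition strain :: "real \<Rightarrow> (real \<Rightarrow> real) \<Rightarrow> (real \<Rightarrow> real) \<Rightarrow> real \<Rightarrow> real" where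
  "strain lam u' w r = (w r)\<^sup>2 - 1 + u' r + shift' lam r"

text \<open>The term in w^2 survives only below \<open>lam\<close>; beyond \<open>lam\<close> it has
  been combined with the counterterm and absorbed into the squares. The factor r of the area element
  is included.\<close>

definition sq_density :: "real \<Rightarrow> (real \<Rightarrow> real) \<Rightarrow> (real \<Rightarrow> real) \<Rightarrow> (real \<Rightarrow> real) \<Rightarrow> (real \<Rightarrow> real) \<Rightarrow> real \<Rightarrow> real" where
  "sq_density lam u u' w w' r = r * (strain lam u' w r)\<^sup>2 + (u r - shift lam r)\<^sup>2 / r
     + lam\<^sup>2 * (r * (w' r)\<^sup>2) + (if r < lam then lam\<^sup>2 * (w r)\<^sup>2 / r else 0)"

definition sq_energy :: "real \<Rightarrow> (real \<Rightarrow> real) \<Rightarrow> (real \<Rightarrow> real) \<Rightarrow> (real \<Rightarrow> real) \<Rightarrow> (real \<Rightarrow> real) \<Rightarrow> ennreal" where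
  "sq_energy lam u u' w w' = (\<integral>\<^sup>+r. ennreal (indicator {0<..} r * sq_density lam u u' w w' r) \<partial>lborel)"

section \<open>Measurability and local integrability of the square density\<close>

lemma sq_density_nonneg: "r > 0 \<Longrightarrow> sq_density lam u u' w w' r \<ge> 0"
  by (auto simp: sq_density_def)

lemma set_integrable_indicator:
  assumes "B \<in> sets borel"
  shows "set_integrable lborel {a..b} (indicator B :: real \<Rightarrow> real)"
proof -
  have "set_integrable lborel ({a..b} \<inter> B) (\<lambda>r. 1::real)"
    by (rule set_integrable_subset[OF set_integrable_continuous[of a b]]) (use assms in auto)
  also have "?this \<longleftrightarrow> ?thesis"
    unfolding set_integrable_def by (rule arg_cong[where f = "integrable lborel"]) (auto simp: indicator_def fun_eq_iff)
  finally show ?thesis .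
qed

lemma shift'_set_integrable:
  assumes "0 < a"
  shows "set_integrable lborel {a..b} (shift' lam)" "set_integrable lborel {a..b} (\<lambda>r. (shift' lam r)\<^sup>2)"
proof -
  have i: "set_integrable lborel {a..b} (indicator {lam..} :: real \<Rightarrow> real)"
    by (rule set_integrable_indicator) simp
  have "set_integrable lborel {a..b} (\<lambda>r. (lam\<^sup>2 / (2 * r\<^sup>2)) * indicator {lam..} r)"
    by (rule set_integrable_cont_mult[OF _ i]) (use assms in \<open>auto intro!: continuous_intros\<close>)
  also have "(\<lambda>r. (lam\<^sup>2 / (2 * r\<^sup>2)) * indicator {lam..} r) = shift' lam" by (auto simp: shift'_def indicator_def fun_eq_iff)
  finally show "set_integrable lborel {a..b} (shift' lam)" .
  have "set_integrable lborel {a..b} (\<lambda>r. (lam\<^sup>2 / (2 * r\<^sup>2))\<^sup>2 * indicator {lam..} r)"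
    by (rule set_integrable_cont_mult[OF _ i]) (use assms in \<open>auto intro!: continuous_intros\<close>)
  also have "(\<lambda>r. (lam\<^sup>2 / (2 * r\<^sup>2))\<^sup>2 * indicator {lam..} r) = (\<lambda>r. (shift' lam r)\<^sup>2)" by (auto simp: shift'_def indicator_def fun_eq_iff)
  finally show "set_integrable lborel {a..b} (\<lambda>r. (shift' lam r)\<^sup>2)" .
qed

lemma strain_set_integrable:
  assumes u: "primitive u u'" and w: "primitive w w'" and a: "0 < a"
  shows "set_integrable lborel {a..b} (strain lam u' w)" "set_integrable lborel {a..b} (\<lambda>r. (strain lam u' w r)\<^sup>2)"
proof -
  note pu = primitiveD[OF u a, of b] and pw = primitiveD[OF w a, of b]
  have i1: "set_integrable lborel {a..b} (\<lambda>r. (w r)\<^sup>2 - 1)" "set_integrable lborel {a..b} (\<lambda>r. ((w r)\<^sup>2 - 1)\<^sup>2)"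
    by (intro set_integrable_continuous continuous_intros pw)+
  have e: "strain lam u' w = (\<lambda>r. ((w r)\<^sup>2 - 1 + u' r) + shift' lam r)" by (auto simp: strain_def)
  have i2: "set_integrable lborel {a..b} (\<lambda>r. (w r)\<^sup>2 - 1 + u' r)"
    "set_integrable lborel {a..b} (\<lambda>r. ((w r)\<^sup>2 - 1 + u' r)\<^sup>2)"
    by (rule set_integral_add(1)[OF i1(1) pu(2)], rule set_integrable_sq_add[OF i1(1) pu(2) i1(2) pu(3)])
  show "set_integrable lborel {a..b} (strain lam u' w)" "set_integrable lborel {a..b} (\<lambda>r. (strain lam u' w r)\<^sup>2)"
    unfolding e
    by (rule set_integral_add(1)[OF i2(1) shift'_set_integrable(1)[OF a]],
        rule set_integrable_sq_add[OF i2(1) shift'_set_integrable(1)[OF a] i2(2) shift'_set_integrable(2)[OF a]])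
qed

lemma sq_density_measurable:
  assumes u: "primitive u u'" and w: "primitive w w'"
  shows "(\<lambda>r. indicator {0<..} r * sq_density lam u u' w w' r) \<in> borel_measurable borel"
proof -
  note m = primitive_measurable[OF u] primitive_measurable[OF w]
  define um where "um x = indicator {0<..} x * u x" for x
  define um' where "um' x = indicator {0<..} x * u' x" for x
  define wm where "wm x = indicator {0<..} x * w x" for x
  define wm' where "wm' x = indicator {0<..} x * w' x" for x
  have [measurable]: "um \<in> borel_measurable borel" "um' \<in> borel_measurable borel"
    "wm \<in> borel_measurable borel" "wm' \<in> borel_measurable borel"
    using m unfolding um_def um'_def wm_def wm'_def by auto
  have "(\<lambda>r. indicator {0<..} r * sq_density lam um um' wm wm' r) \<in> borel_measurable borel"
    unfolding sq_density_def strain_def shift_def shift'_def by measurable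
  also have "(\<lambda>r. indicator {0<..} r * sq_density lam um um' wm wm' r) = (\<lambda>r. indicator {0<..} r * sq_density lam u u' w w' r)"
    by (auto simp: fun_eq_iff indicator_def sq_density_def strain_def um_def um'_def wm_def wm'_def)
  finally show ?thesis .
qed

lemma set_integrable_inverse_mult:
  fixes g :: "real \<Rightarrow> real"
  assumes "0 < a" "set_integrable lborel {a..b} g"
  shows "set_integrable lborel {a..b} (\<lambda>r. g r / r)"
proof -
  have "set_integrable lborel {a..b} (\<lambda>r. inverse r * g r)"
    by (rule set_integrable_cont_mult[OF _ assms(2)]) (use assms(1) in \<open>auto intro!: continuous_intros\<close>)
  thus ?thesis by (simp add: divide_inverse mult.commute)
qed

lemma shift_set_integrable_sq:
  assumes u: "primitive u u'" and a: "0 < a"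
  shows "set_integrable lborel {a..b} (\<lambda>r. (u r - shift lam r)\<^sup>2)"
proof (rule set_integrable_sq_diff)
  note pu = primitiveD[OF u a, of b]
  show "set_integrable lborel {a..b} u" "set_integrable lborel {a..b} (\<lambda>r. (u r)\<^sup>2)"
    by (intro set_integrable_continuous continuous_intros pu)+
  have i: "set_integrable lborel {a..b} (\<lambda>r. r * shift' lam r)"
    by (rule set_integrable_cont_mult[OF _ shift'_set_integrable(1)[OF a]]) (intro continuous_intros)
  have i2: "set_integrable lborel {a..b} (\<lambda>r. r\<^sup>2 * (shift' lam r)\<^sup>2)"
    by (rule set_integrable_cont_mult[OF _ shift'_set_integrable(2)[OF a]]) (intro continuous_intros)
  have e: "r * shift' lam r = shift lam r" for r
    by (auto simp: shift_def shift'_def power2_eq_square)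
  show "set_integrable lborel {a..b} (shift lam)" using i by (simp add: e)
  show "set_integrable lborel {a..b} (\<lambda>r. (shift lam r)\<^sup>2)" using i2 by (simp add: e[symmetric] power_mult_distrib)
qed

lemma sq_density_set_integrable:
  assumes u: "primitive u u'" and w: "primitive w w'" and a: "0 < a"
  shows "set_integrable lborel {a..b} (sq_density lam u u' w w')"
proof -
  note pw = primitiveD[OF w a, of b]
  have i1: "set_integrable lborel {a..b} (\<lambda>r. r * (strain lam u' w r)\<^sup>2)"
    by (rule set_integrable_cont_mult[OF _ strain_set_integrable(2)[OF u w a]]) (intro continuous_intros)
  have i2: "set_integrable lborel {a..b} (\<lambda>r. (u r - shift lam r)\<^sup>2 / r)"
    by (rule set_integrable_inverse_mult[OF a shift_set_integrable_sq[OF u a]])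
  have i3: "set_integrable lborel {a..b} (\<lambda>r. r * (w' r)\<^sup>2)"
    by (rule set_integrable_cont_mult[OF _ pw(3)]) (intro continuous_intros)
  have "set_integrable lborel {a..b} (\<lambda>r. (lam\<^sup>2 * (w r)\<^sup>2 / r) * indicator {..<lam} r)"
  proof (rule set_integrable_cont_mult)
    show "continuous_on {a..b} (\<lambda>r. lam\<^sup>2 * (w r)\<^sup>2 / r)" by (intro continuous_intros pw) (use a in auto)
    show "set_integrable lborel {a..b} (indicator {..<lam} :: real \<Rightarrow> real)"
      by (rule set_integrable_indicator) simp
  qed
  also have "(\<lambda>r. (lam\<^sup>2 * (w r)\<^sup>2 / r) * indicator {..<lam} r) = (\<lambda>r. if r < lam then lam\<^sup>2 * (w r)\<^sup>2 / r else 0)"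
    by (auto simp: indicator_def fun_eq_iff)
  finally have i4: "set_integrable lborel {a..b} (\<lambda>r. if r < lam then lam\<^sup>2 * (w r)\<^sup>2 / r else 0)" .
  show ?thesis
    unfolding sq_density_def[abs_def] by (intro set_integral_add(1) i1 i2 i4 set_integrable_mult_right i3)
qed

lemma set_integrable_of_nn_finite:
  fixes f :: "real \<Rightarrow> real"
  assumes "(\<lambda>r. indicator A r * f r) \<in> borel_measurable borel" "\<And>r. r \<in> A \<Longrightarrow> f r \<ge> 0"
    and "(\<integral>\<^sup>+r. ennreal (indicator A r * f r) \<partial>lborel) < \<infinity>"
  shows "set_integrable lborel A f"
  unfolding set_integrable_def real_scaleR_def
  by (rule integrableI_nonneg) (use assms in \<open>auto simp: indicator_def\<close>)

lemma nn_integral_indicator_mono: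
  fixes f :: "real \<Rightarrow> real"
  assumes "A \<subseteq> B" "\<And>r. r \<in> B \<Longrightarrow> f r \<ge> 0" "\<And>r. r \<in> A \<Longrightarrow> g r = f r"
  shows "(\<integral>\<^sup>+r. ennreal (indicator A r * g r) \<partial>lborel) \<le> (\<integral>\<^sup>+r. ennreal (indicator B r * f r) \<partial>lborel)"
  by (intro nn_integral_mono) (use assms in \<open>auto simp: indicator_def subset_iff intro!: ennreal_leI\<close>)

section \<open>Admissibility and the square energy\<close>

lemma rho_eq_sq_density:
  assumes "0 < r" "r < lam"
  shows "rho lam u w r * r = sq_density lam u (weak_deriv u) w (weak_deriv w) r"
  using assms unfolding rho_def sq_density_def strain_def shift_def shift'_def
  by (simp add: field_simps power2_eq_square)

lemma admissible_W12: "(u, w) \<in> admissible lam \<Longrightarrow> u \<in> W12_loc \<and> w \<in> W12_loc"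
  by (auto simp: admissible_def)

lemma admissible_sq_density_integrable:
  assumes lam: "lam > 0" and adm: "(u, w) \<in> admissible lam"
  shows "set_integrable lborel {0<..<R} (sq_density lam u (weak_deriv u) w (weak_deriv w))"
proof -
  define h where "h = sq_density lam u (weak_deriv u) w (weak_deriv w)"
  have u: "primitive u (weak_deriv u)" and w: "primitive w (weak_deriv w)"
    using admissible_W12[OF adm] W12_loc_primitive by auto
  \<comment> \<open>Below \<open>d\<close> the density is \<open>rho\<close> times r and
    admissibility controls it; from \<open>d\<close> on, local square integrability is
    enough.\<close>
  define d where "d = min lam (1/2)"
  have d: "d > 0" "d \<le> lam" "d < 1" using lam by (auto simp: d_def)
  have hm: "(\<lambda>r. indicator {0<..} r * h r) \<in> borel_measurable borel"
    unfolding h_def by (rule sq_density_measurable[OF u w])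
  have "set_integrable lborel {0<..<d} h"
  proof (rule set_integrable_of_nn_finite)
    have "(\<lambda>r. indicator {0<..<d} r * (indicator {0<..} r * h r)) \<in> borel_measurable borel"
      using hm by measurable
    also have "(\<lambda>r. indicator {0<..<d} r * (indicator {0<..} r * h r)) = (\<lambda>r. indicator {0<..<d} r * h r)"
      by (auto simp: indicator_def fun_eq_iff)
    finally show "(\<lambda>r. indicator {0<..<d} r * h r) \<in> borel_measurable borel" .
    have "(\<integral>\<^sup>+r. ennreal (indicator {0<..<d} r * h r) \<partial>lborel) \<le> (\<integral>\<^sup>+r. ennreal (indicator {0<..<1} r * (rho lam u w r * r)) \<partial>lborel)"
    proof (rule nn_integral_indicator_mono)
      show "rho lam u w r * r \<ge> 0" if "r \<in> {0<..<1}" for r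
        using that by (auto simp: rho_def intro!: mult_nonneg_nonneg add_nonneg_nonneg)
      show "h r = rho lam u w r * r" if "r \<in> {0<..<d}" for r
        unfolding h_def by (rule rho_eq_sq_density[symmetric]) (use that d in auto)
    qed (use d in auto)
    also have "\<dots> = (\<integral>\<^sup>+ r\<in>{0<..<1}. ennreal (rho lam u w r * r) \<partial>lborel)"
      by (intro nn_integral_cong) (auto simp: indicator_def)
    also have "\<dots> < \<infinity>" using adm by (auto simp: admissible_def)
    finally show "(\<integral>\<^sup>+r. ennreal (indicator {0<..<d} r * h r) \<partial>lborel) < \<infinity>" .
    show "h r \<ge> 0" if "r \<in> {0<..<d}" for r unfolding h_def by (rule sq_density_nonneg) (use that in auto)
  qed
  moreover have "set_integrable lborel {d..R} h" unfolding h_def by (rule sq_density_set_integrable[OF u w d(1)])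
  ultimately have "set_integrable lborel ({0<..<d} \<union> {d..R}) h" by (rule set_integrable_Un) auto
  thus ?thesis unfolding h_def[symmetric] by (rule set_integrable_subset) auto
qed

lemma sq_energy_finite_integrable:
  assumes u: "primitive u u'" and w: "primitive w w'" and fin: "sq_energy lam u u' w w' < \<infinity>"
  shows "set_integrable lborel {0<..} (sq_density lam u u' w w')"
    "sq_energy lam u u' w w' = ennreal (LINT r:{0<..}|lborel. sq_density lam u u' w w' r)"
proof -
  show i: "set_integrable lborel {0<..} (sq_density lam u u' w w')"
    by (rule set_integrable_of_nn_finite)
       (use sq_density_measurable[OF u w] fin sq_density_nonneg in \<open>auto simp: sq_energy_def\<close>)
  show "sq_energy lam u u' w w' = ennreal (LINT r:{0<..}|lborel. sq_density lam u u' w w' r)"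
    unfolding sq_energy_def set_lebesgue_integral_def
    using nn_integral_eq_integral[OF i[unfolded set_integrable_def]] sq_density_nonneg
    by (auto simp: indicator_def)
qed

lemma sq_energy_weak_deriv:
  assumes u: "primitive u u'" and w: "primitive w w'"
  shows "sq_energy lam u (weak_deriv u) w (weak_deriv w) = sq_energy lam u u' w w'"
  unfolding sq_energy_def
proof (rule nn_integral_cong_AE)
  show "AE r in lborel. ennreal (indicator {0<..} r * sq_density lam u (weak_deriv u) w (weak_deriv w) r)
          = ennreal (indicator {0<..} r * sq_density lam u u' w w' r)"
    using weak_deriv_AE[OF u] weak_deriv_AE[OF w]
    by eventually_elim (auto simp: indicator_def sq_density_def strain_def)
qed

text \<open>Lets competitors be built from explicit pairs. Below \<open>lam\<close> the two
  densities agree, and between \<open>lam\<close> and 1 (possibly an empty range) everything is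
  locally integrable.\<close>

lemma finite_sq_energy_admissible:
  assumes lam: "lam > 0" and u: "primitive u u'" and w: "primitive w w'" and fin: "sq_energy lam u u' w w' < \<infinity>"
  shows "(u, w) \<in> admissible lam"
proof -
  have W: "u \<in> W12_loc" "w \<in> W12_loc" using u w primitive_W12_loc by auto
  have du: "primitive u (weak_deriv u)" and dw: "primitive w (weak_deriv w)" using W W12_loc_primitive by auto
  define h where "h = sq_density lam u (weak_deriv u) w (weak_deriv w)"
  have fin': "sq_energy lam u (weak_deriv u) w (weak_deriv w) < \<infinity>"
    using sq_energy_weak_deriv[OF u w] fin by simp
  have hi: "set_integrable lborel {0<..} h"
    unfolding h_def by (rule sq_energy_finite_integrable(1)[OF du dw fin'])
  have "(\<integral>\<^sup>+ r\<in>{0<..<1}. ennreal (rho lam u w r * r) \<partial>lborel) < \<infinity>"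
  proof -
    define k where "k r = rho lam u w r * r" for r
    have k0: "k r \<ge> 0" if "r > 0" for r using that by (auto simp: k_def rho_def intro!: mult_nonneg_nonneg add_nonneg_nonneg)
    have "set_integrable lborel {0<..<lam} h" by (rule set_integrable_subset[OF hi]) auto
    moreover have "indicator {0<..<lam} r *\<^sub>R h r = indicator {0<..<lam} r *\<^sub>R k r" for r
      using rho_eq_sq_density[of r lam u w] by (auto simp: indicator_def h_def k_def)
    ultimately have i1: "set_integrable lborel {0<..<lam} k" by (simp only: set_integrable_def)
    have i2: "set_integrable lborel {lam..1} k"
    proof -
      note pu = primitiveD[OF du lam, of 1] and pw = primitiveD[OF dw lam, of 1]
      have j1: "set_integrable lborel {lam..1} (\<lambda>r. (w r)\<^sup>2 - 1)" "set_integrable lborel {lam..1} (\<lambda>r. ((w r)\<^sup>2 - 1)\<^sup>2)"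
        by (intro set_integrable_continuous continuous_intros pw)+
      have "set_integrable lborel {lam..1} (\<lambda>r. ((w r)\<^sup>2 - 1 + weak_deriv u r)\<^sup>2)"
        by (rule set_integrable_sq_add[OF j1(1) pu(2) j1(2) pu(3)])
      moreover have "set_integrable lborel {lam..1} (\<lambda>r. (u r / r)\<^sup>2)" "set_integrable lborel {lam..1} (\<lambda>r. (w r)\<^sup>2 / r\<^sup>2)"
        by (intro set_integrable_continuous continuous_intros pu pw; use lam in auto)+
      ultimately have "set_integrable lborel {lam..1} (rho lam u w)"
        unfolding rho_def[abs_def] by (intro set_integral_add(1) set_integrable_mult_right pw)
      from set_integrable_cont_mult[OF _ this, of "\<lambda>r. r"] show ?thesis
        by (simp add: k_def[abs_def] mult.commute)
    qed
    have "set_integrable lborel ({0<..<lam} \<union> {lam..1}) k" by (rule set_integrable_Un[OF i1 i2]) auto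
    hence i: "set_integrable lborel {0<..<1} k" by (rule set_integrable_subset) auto
    have "(\<integral>\<^sup>+ r\<in>{0<..<1}. ennreal (k r) \<partial>lborel) = (\<integral>\<^sup>+ r. ennreal (indicator {0<..<1} r *\<^sub>R k r) \<partial>lborel)"
      by (intro nn_integral_cong) (auto simp: indicator_def)
    also have "\<dots> = ennreal (LINT r|lborel. indicator {0<..<1} r *\<^sub>R k r)"
      by (rule nn_integral_eq_integral[OF i[unfolded set_integrable_def]]) (auto simp: indicator_def k0)
    finally show ?thesis by (simp add: k_def)
  qed
  with W show ?thesis by (simp add: admissible_def)
qed

section \<open>The truncated energy as squares plus boundary terms\<close>

definition counterterm :: "real \<Rightarrow> (real \<Rightarrow> real) \<Rightarrow> real" where
  "counterterm lam \<psi> = (LINT r:{0<..<lam}|lborel. lam\<^sup>2 * (\<psi> (r / lam))\<^sup>2 / r) + lam\<^sup>2 / 4"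

lemma set_integral_split:
  fixes f :: "real \<Rightarrow> real"
  assumes "0 < c" "c < R" "set_integrable lborel {0<..<c} f" "set_integrable lborel {c..R} f"
  shows "set_integrable lborel {0<..<R} f"
    "(LINT r:{0<..<R}|lborel. f r) = (LINT r:{0<..<c}|lborel. f r) + (LINT r:{c..R}|lborel. f r)"
proof -
  have i: "set_integrable lborel {c..<R} f" by (rule set_integrable_subset[OF assms(4)]) auto
  have e: "{0<..<R} = {0<..<c} \<union> {c..<R}" using assms by auto
  show "set_integrable lborel {0<..<R} f" unfolding e by (rule set_integrable_Un[OF assms(3) i]) auto
  have "(LINT r:{0<..<R}|lborel. f r) = (LINT r:{0<..<c}|lborel. f r) + (LINT r:{c..<R}|lborel. f r)"
    unfolding e by (rule set_integral_Un[OF _ assms(3) i]) auto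
  also have "(LINT r:{c..<R}|lborel. f r) = (LINT r:{c..R}|lborel. f r)"
    by (rule set_integral_countable_change[where X = "{R}"]) auto
  finally show "(LINT r:{0<..<R}|lborel. f r) = (LINT r:{0<..<c}|lborel. f r) + (LINT r:{c..R}|lborel. f r)" .
qed

lemma cutoff_counterterm_integrable:
  assumes lam: "lam > 0" and \<psi>: "cutoff \<psi>"
  shows "set_integrable lborel {0<..<lam} (\<lambda>r. lam\<^sup>2 * (\<psi> (r / lam))\<^sup>2 / r)"
proof -
  obtain \<epsilon> where \<epsilon>: "\<epsilon> > 0" "\<And>r. 0 \<le> r \<Longrightarrow> r < \<epsilon> \<Longrightarrow> \<psi> r = 0" using \<psi> unfolding cutoff_def by blast
  have "continuous_on {0..} \<psi>"
  proof -
    obtain d where d: "\<And>x. x \<in> {0..} \<Longrightarrow> d 0 x = \<psi> x"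
       "\<And>n x. x \<in> {0..} \<Longrightarrow> (d n has_real_derivative d (Suc n) x) (at x within {0..})"
      using \<psi> unfolding cutoff_def smooth_on_def by blast
    have "continuous_on {0..} (d 0)" by (rule DERIV_continuous_on[OF d(2)])
    thus ?thesis using d(1) continuous_on_cong[OF refl, of "{0..}" "d 0" \<psi>] by blast
  qed
  moreover have "0 < \<epsilon> * lam" using \<epsilon>(1) lam by simp
  ultimately have c0: "continuous_on {\<epsilon> * lam / 2..lam} (\<lambda>r. \<psi> (r / lam))"
    by (rule_tac continuous_on_compose2[of "{0..}" \<psi>]) (use lam \<epsilon>(1) in \<open>auto intro!: continuous_intros\<close>)
  have c: "continuous_on {\<epsilon> * lam / 2..lam} (\<lambda>r. lam\<^sup>2 * (\<psi> (r / lam))\<^sup>2 / r)"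
    by (intro continuous_intros c0) (use \<open>0 < \<epsilon> * lam\<close> in auto)
  have i: "set_integrable lborel {\<epsilon> * lam / 2..<lam} (\<lambda>r. lam\<^sup>2 * (\<psi> (r / lam))\<^sup>2 / r)"
    by (rule set_integrable_subset[OF set_integrable_continuous[OF c]]) auto
  have "indicator {\<epsilon> * lam / 2..<lam} r *\<^sub>R (lam\<^sup>2 * (\<psi> (r / lam))\<^sup>2 / r) = indicator {0<..<lam} r *\<^sub>R (lam\<^sup>2 * (\<psi> (r / lam))\<^sup>2 / r)" for r
  proof (cases "0 < r \<and> r < \<epsilon> * lam / 2")
    case True
    have "\<epsilon> * lam / 2 < \<epsilon> * lam" using \<epsilon>(1) lam by simp
    hence "r / lam < \<epsilon>" using True lam by (simp add: field_simps)
    thus ?thesis using \<epsilon>(2)[of "r / lam"] True lam by simp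
  next
    case False
    have "\<epsilon> * lam / 2 > 0" using \<epsilon>(1) lam by simp
    thus ?thesis using False by (auto simp: indicator_def not_less)
  qed
  thus ?thesis using i by (simp only: set_integrable_def)
qed

text \<open>With X = w^2 - 1 + u' the term lam^2 (w^2 - 1)/r equals lam^2 X/r - lam^2 u'/r. The
  first part is the cross term of one square. Adding and subtracting lam^2 u/r^2 supplies the cross
  term of the other and completes -lam^2 u'/r to a total derivative. Each square leaves lam^4/(4
  r^3).\<close>

lemma renormalized_density_eq:
  assumes "lam \<le> r" "0 < lam" "\<psi> (r / lam) = 1"
  shows "renormalized_density lam \<psi> u w r = sq_density lam u (weak_deriv u) w (weak_deriv w) r
     - (lam ^ 4 / (2 * r ^ 3) + lam\<^sup>2 * (weak_deriv u r * inverse r + u r * (- ((inverse r)\<^sup>2))))"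
proof -
  have r: "r > 0" using assms by simp
  define X where "X = (w r)\<^sup>2 - 1 + weak_deriv u r"
  define L where "L = lam\<^sup>2"
  have L4: "lam ^ 4 = L * L" by (simp add: L_def power2_eq_square power4_eq_xxxx)
  have a: "r * (X + L / (2 * r\<^sup>2))\<^sup>2 = r * X\<^sup>2 + X * L / r + L * L / (4 * r ^ 3)"
    using r by (simp add: field_simps power2_eq_square power3_eq_cube)
  have b: "(u r - L / (2 * r))\<^sup>2 / r = (u r)\<^sup>2 / r - u r * L / r\<^sup>2 + L * L / (4 * r ^ 3)"
    using r by (simp add: field_simps power2_eq_square power3_eq_cube)
  have "renormalized_density lam \<psi> u w r = r * X\<^sup>2 + (u r)\<^sup>2 / r + L * (r * (weak_deriv w r)\<^sup>2) + L * ((w r)\<^sup>2 - 1) / r"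
    unfolding renormalized_density_def rho_def assms(3) X_def[symmetric] L_def[symmetric]
    using r by (simp add: field_simps power2_eq_square)
  also have "(w r)\<^sup>2 - 1 = X - weak_deriv u r" by (simp add: X_def)
  also have "r * X\<^sup>2 + (u r)\<^sup>2 / r + L * (r * (weak_deriv w r)\<^sup>2) + L * (X - weak_deriv u r) / r =
      (r * (X + L / (2 * r\<^sup>2))\<^sup>2 + (u r - L / (2 * r))\<^sup>2 / r + L * (r * (weak_deriv w r)\<^sup>2))
      - (L * L / (2 * r ^ 3) + L * (weak_deriv u r * inverse r + u r * (- ((inverse r)\<^sup>2))))"
    unfolding a b using r by (simp add: field_simps power2_eq_square power3_eq_cube)
  also have "r * (X + L / (2 * r\<^sup>2))\<^sup>2 + (u r - L / (2 * r))\<^sup>2 / r + L * (r * (weak_deriv w r)\<^sup>2)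
       = sq_density lam u (weak_deriv u) w (weak_deriv w) r"
    using assms(1) by (simp add: sq_density_def strain_def shift_def shift'_def X_def L_def)
  finally show ?thesis unfolding L4 L_def .
qed

text \<open>Integration of the preceding identity from \<open>lam\<close> to \<open>R\<close>. The
  \<open>lam\<^sup>2 / 4\<close> in \<open>counterterm\<close> is the integral of lam^4/(2 r^3) from
  \<open>lam\<close> to infinity, and \<open>lam * u lam\<close> is the boundary value of lam^2 u/r
  at \<open>lam\<close>.\<close>

lemma truncated_energy_formula:
  assumes lam: "lam > 0" and \<psi>: "cutoff \<psi>" and adm: "(u, w) \<in> admissible lam" and R: "R > lam"
  shows "set_integrable lborel {0<..<R} (renormalized_density lam \<psi> u w)"
    "truncated_energy lam \<psi> u w R = (LINT r:{0<..<R}|lborel. sq_density lam u (weak_deriv u) w (weak_deriv w) r)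
        + lam * u lam - counterterm lam \<psi> + lam ^ 4 / (4 * R\<^sup>2) - lam\<^sup>2 * (u R / R)"
proof -
  have u: "primitive u (weak_deriv u)"
    using admissible_W12[OF adm] W12_loc_primitive by auto
  define h where "h = sq_density lam u (weak_deriv u) w (weak_deriv w)"
  define g where "g r = lam ^ 4 / (2 * r ^ 3) + lam\<^sup>2 * (weak_deriv u r * inverse r + u r * (- ((inverse r)\<^sup>2)))" for r
  define f where "f r = - (lam ^ 4 / (4 * r\<^sup>2)) + lam\<^sup>2 * (u r * inverse r)" for r
  \<comment> \<open>What has to be subtracted from the square density: the genuine counterterm below
    \<open>lam\<close>, and beyond it the derivative of \<open>f\<close>.\<close>
  define c where "c r = (if r < lam then lam\<^sup>2 * (\<psi> (r / lam))\<^sup>2 / r else g r)" for r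
  have hi: "set_integrable lborel {0<..<R} h"
    unfolding h_def by (rule admissible_sq_density_integrable[OF lam adm])
  have gac: "ac_on lam R f g"
  proof -
    have "((\<lambda>r. - (lam ^ 4 / (4 * r\<^sup>2))) has_real_derivative lam ^ 4 / (2 * x ^ 3)) (at x)" if "x \<in> {lam..R}" for x
      using that lam by (auto intro!: derivative_eq_intros simp: field_simps power2_eq_square power3_eq_cube)
    moreover have "continuous_on {lam..R} (\<lambda>x. lam ^ 4 / (2 * x ^ 3))"
      by (intro continuous_intros) (use lam in auto)
    ultimately have a1: "ac_on lam R (\<lambda>r. - (lam ^ 4 / (4 * r\<^sup>2))) (\<lambda>x. lam ^ 4 / (2 * x ^ 3))"
      by (rule_tac ac_on_C1) (blast intro: has_field_derivative_at_within)+
    have "((\<lambda>r. inverse r) has_real_derivative - ((inverse x)\<^sup>2)) (at x)" if "x \<in> {lam..R}" for x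
      using DERIV_inverse[of x] that lam by (simp add: numeral_2_eq_2)
    moreover have "continuous_on {lam..R} (\<lambda>x. - ((inverse x)\<^sup>2))"
      by (intro continuous_intros) (use lam in auto)
    ultimately have a2: "ac_on lam R (\<lambda>r. inverse r) (\<lambda>x. - ((inverse x)\<^sup>2))"
      by (rule_tac ac_on_C1) (blast intro: has_field_derivative_at_within)+
    show ?thesis
      unfolding f_def[abs_def] g_def[abs_def]
      by (intro ac_on_add[OF a1] ac_on_cmult ac_on_mult[OF _ a2] primitiveD(1)[OF u lam])
  qed
  have c1: "set_integrable lborel {0<..<lam} c"
    using cutoff_counterterm_integrable[OF lam \<psi>]
    by (subst set_integrable_cong[OF refl refl, of _ _ "\<lambda>r. lam\<^sup>2 * (\<psi> (r / lam))\<^sup>2 / r"]) (auto simp: c_def)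
  have c1': "(LINT r:{0<..<lam}|lborel. c r) = counterterm lam \<psi> - lam\<^sup>2 / 4"
    unfolding counterterm_def
    by (simp, rule set_lebesgue_integral_cong) (auto simp: c_def)
  have gi: "set_integrable lborel {lam..R} g" using gac by (auto simp: ac_on_def)
  have c2: "set_integrable lborel {lam..R} c"
    using gi by (subst set_integrable_cong[OF refl refl, of _ _ g]) (auto simp: c_def)
  have "(LINT r:{lam..R}|lborel. c r) = (LINT r:{lam..R}|lborel. g r)"
    by (rule set_lebesgue_integral_cong) (auto simp: c_def)
  also have "\<dots> = f R - f lam" using ac_onD(1)[OF gac, of lam R] R by simp
  finally have c2': "(LINT r:{lam..R}|lborel. c r) = f R - f lam" .
  note ci = set_integral_split[OF lam R c1 c2]
  have pt: "renormalized_density lam \<psi> u w r = h r - c r" if "r \<in> {0<..<R}" for r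
  proof (cases "r < lam")
    case True
    thus ?thesis using rho_eq_sq_density[of r lam u w] that
      by (simp add: c_def h_def renormalized_density_def left_diff_distrib power2_eq_square)
  next
    case False
    hence "\<psi> (r / lam) = 1" using \<psi> lam by (simp add: cutoff_def)
    from renormalized_density_eq[of lam r \<psi> u w, OF _ lam this] False show ?thesis
      by (simp add: c_def h_def g_def)
  qed
  have i: "set_integrable lborel {0<..<R} (\<lambda>r. h r - c r)" by (rule set_integral_diff(1)[OF hi ci(1)])
  show "set_integrable lborel {0<..<R} (renormalized_density lam \<psi> u w)"
    using i by (subst set_integrable_cong[OF refl refl, of _ _ "\<lambda>r. h r - c r"]) (auto simp: pt)
  have "truncated_energy lam \<psi> u w R = (LINT r:{0<..<R}|lborel. h r - c r)"
    unfolding truncated_energy_def by (rule set_lebesgue_integral_cong) (auto simp: pt)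
  also have "\<dots> = (LINT r:{0<..<R}|lborel. h r) - (LINT r:{0<..<R}|lborel. c r)"
    by (rule set_integral_diff(2)[OF hi ci(1)])
  also have "(LINT r:{0<..<R}|lborel. c r) = counterterm lam \<psi> - lam\<^sup>2 / 4 + (f R - f lam)"
    using ci(2) c1' c2' by simp
  also have "f R = - (lam ^ 4 / (4 * R\<^sup>2)) + lam\<^sup>2 * (u R / R)" by (simp add: f_def inverse_eq_divide)
  also have "f lam = - (lam\<^sup>2 / 4) + lam * u lam"
  proof -
    have "lam ^ 4 / (4 * lam\<^sup>2) = lam\<^sup>2 / 4" using lam by (simp add: power2_eq_square power4_eq_xxxx)
    moreover have "lam\<^sup>2 * (u lam * inverse lam) = lam * u lam" using lam by (simp add: power2_eq_square)
    ultimately show ?thesis unfolding f_def by linarith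
  qed
  finally show "truncated_energy lam \<psi> u w R = (LINT r:{0<..<R}|lborel. sq_density lam u (weak_deriv u) w (weak_deriv w) r)
        + lam * u lam - counterterm lam \<psi> + lam ^ 4 / (4 * R\<^sup>2) - lam\<^sup>2 * (u R / R)"
    by (simp add: h_def)
qed

text \<open>Since \<open>U' \<le> 1 + |Y|\<close>, a large value of \<open>U\<close> at \<open>b\<close> forces large values
  just to the left of \<open>b\<close>, and a large negative value at \<open>a\<close> forces large negative values
  just to the right of \<open>a\<close>.\<close>

lemma one_sided_growth:
  assumes U: "ac_on a b U U'" and ab: "0 < a" "a < b" and k: "k > 0"
    and Y: "set_integrable lborel {a..b} Y" "set_integrable lborel {a..b} (\<lambda>t. (Y t)\<^sup>2)"
    and le: "\<And>t. t \<in> {a..b} \<Longrightarrow> U' t \<le> 1 + Y t"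
    and J1: "(LINT t:{a..b}|lborel. (U t)\<^sup>2 / t) \<le> J" and J2: "(LINT t:{a..b}|lborel. t * (Y t)\<^sup>2) \<le> J"
  shows "U b \<le> sqrt (J * b / (b - a)) + (b - a) + k * J / 2 + (b - a) / a / (2 * k)"
    "- U a \<le> sqrt (J * b / (b - a)) + (b - a) + k * J / 2 + (b - a) / a / (2 * k)"
proof -
  have Uc: "continuous_on {a..b} U" by (rule ac_on_continuous[OF U])
  have qc: "continuous_on {a..b} (\<lambda>t. (U t)\<^sup>2 / t)" using ab by (intro continuous_intros Uc) auto
  \<comment> \<open>The minimum of U^2/t is at most its mean, so at \<open>s\<close> the size of
    \<open>U\<close> is controlled by \<open>J\<close>. From there the one-sided bound leads right
    to \<open>b\<close> and, read backwards, left to \<open>a\<close>.\<close>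
  obtain s where s: "s \<in> {a..b}" "\<And>t. t \<in> {a..b} \<Longrightarrow> (U s)\<^sup>2 / s \<le> (U t)\<^sup>2 / t"
    using continuous_attains_inf[OF _ _ qc] ab by auto
  have "(LINT t:{a..b}|lborel. (U s)\<^sup>2 / s) \<le> (LINT t:{a..b}|lborel. (U t)\<^sup>2 / t)"
    by (rule set_integral_mono) (use s qc in \<open>auto intro!: set_integrable_continuous continuous_intros\<close>)
  also have "(LINT t:{a..b}|lborel. (U s)\<^sup>2 / s) = (b - a) * ((U s)\<^sup>2 / s)"
    using ab by (simp add: set_lebesgue_integral_def)
  finally have "(b - a) * ((U s)\<^sup>2 / s) \<le> J" using J1 by simp
  hence "(U s)\<^sup>2 \<le> J * s / (b - a)" using ab s(1) by (simp add: field_simps)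
  moreover have "J \<ge> 0"
  proof -
    have "0 \<le> (LINT t:{a..b}|lborel. (U t)\<^sup>2 / t)"
      unfolding set_lebesgue_integral_def using ab by (auto intro!: integral_nonneg_AE simp: indicator_def)
    thus ?thesis using J1 by simp
  qed
  hence "J * s / (b - a) \<le> J * b / (b - a)" using s(1) ab by (intro divide_right_mono mult_left_mono) auto
  ultimately have Us: "\<bar>U s\<bar> \<le> sqrt (J * b / (b - a))" by (intro real_le_rsqrt) simp
  have Yb: "(LINT t:{a..b}|lborel. \<bar>Y t\<bar>) \<le> k * J / 2 + (b - a) / a / (2 * k)"
  proof -
    have "(LINT t:{a..b}|lborel. \<bar>Y t\<bar>) \<le> k * (LINT t:{a..b}|lborel. t * (Y t)\<^sup>2) / 2 + (b - a) / a / (2 * k)"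
      by (rule integral_abs_AM_GM) (use ab k Y in auto)
    also have "k * (LINT t:{a..b}|lborel. t * (Y t)\<^sup>2) / 2 \<le> k * J / 2" using J2 k by simp
    finally show ?thesis by simp
  qed
  have inc: "U y - U x \<le> (b - a) + (LINT t:{a..b}|lborel. \<bar>Y t\<bar>)" if xy: "a \<le> x" "x \<le> y" "y \<le> b" for x y
  proof -
    have i: "set_integrable lborel {a..b} (\<lambda>t. 1 + \<bar>Y t\<bar>)"
      by (intro set_integral_add(1) set_integrable_abs Y set_integrable_continuous) simp
    have "U y - U x = (LINT t:{x..y}|lborel. U' t)" by (rule ac_onD(1)[OF U xy])
    also have "\<dots> \<le> (LINT t:{x..y}|lborel. 1 + \<bar>Y t\<bar>)"
    proof (rule set_integral_mono)
      show "set_integrable lborel {x..y} U'" by (rule ac_onD(2)[OF U xy])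
      show "set_integrable lborel {x..y} (\<lambda>t. 1 + \<bar>Y t\<bar>)" by (rule set_integrable_subinterval[OF i]) (use xy in auto)
      show "U' t \<le> 1 + \<bar>Y t\<bar>" if "t \<in> {x..y}" for t using le[of t] that xy by force
    qed
    also have "\<dots> \<le> (LINT t:{a..b}|lborel. 1 + \<bar>Y t\<bar>)"
      unfolding set_lebesgue_integral_def
      by (rule integral_mono') (use i xy in \<open>auto simp: set_integrable_def indicator_def\<close>)
    also have "\<dots> = (LINT t:{a..b}|lborel. 1) + (LINT t:{a..b}|lborel. \<bar>Y t\<bar>)"
      by (intro set_integral_add(2) set_integrable_abs Y set_integrable_continuous) simp
    also have "(LINT t:{a..b}|lborel. 1) = b - a" using ab by (simp add: set_lebesgue_integral_def)
    finally show ?thesis .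
  qed
  show "U b \<le> sqrt (J * b / (b - a)) + (b - a) + k * J / 2 + (b - a) / a / (2 * k)"
    using inc[of s b] s(1) Us Yb by auto
  show "- U a \<le> sqrt (J * b / (b - a)) + (b - a) + k * J / 2 + (b - a) / a / (2 * k)"
    using inc[of a s] s(1) Us Yb by auto
qed

section \<open>Growth of the excess u - lam^2/(2r)\<close>

lemma primitive_excess:
  assumes "primitive u u'"
  shows "primitive (\<lambda>r. u r - lam\<^sup>2 / (2 * r)) (\<lambda>r. u' r + lam\<^sup>2 / (2 * r\<^sup>2))"
proof -
  have "primitive (\<lambda>r. lam\<^sup>2 / (2 * r)) (\<lambda>r. - (lam\<^sup>2 / (2 * r\<^sup>2)))"
    by (rule primitive_continuous)
       (auto intro!: derivative_eq_intros continuous_intros simp: field_simps power2_eq_square)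
  from primitive_diff[OF assms this] show ?thesis by simp
qed

lemma sq_density_parts:
  assumes u: "primitive u u'" and w: "primitive w w'" and lam: "lam > 0" and a: "lam \<le> a"
    and J: "(LINT r:{a..b}|lborel. sq_density lam u u' w w' r) \<le> J"
  shows "(LINT t:{a..b}|lborel. (u t - lam\<^sup>2 / (2 * t))\<^sup>2 / t) \<le> J"
    "(LINT t:{a..b}|lborel. t * (strain lam u' w t)\<^sup>2) \<le> J"
    "(LINT t:{a..b}|lborel. lam\<^sup>2 * (t * (w' t)\<^sup>2)) \<le> J"
proof -
  have a0: "a > 0" using lam a by simp
  note i = sq_density_set_integrable[OF u w a0, of b lam]
  have le: "(LINT t:{a..b}|lborel. f t) \<le> J"
    if "\<And>t. lam \<le> t \<Longrightarrow> 0 < t \<Longrightarrow> f t \<le> sq_density lam u u' w w' t" for f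
  proof -
    have "(LINT t:{a..b}|lborel. f t) \<le> (LINT r:{a..b}|lborel. sq_density lam u u' w w' r)"
      unfolding set_lebesgue_integral_def
    proof (rule integral_mono')
      show "integrable lborel (\<lambda>r. indicator {a..b} r *\<^sub>R sq_density lam u u' w w' r)"
        using i by (simp add: set_integrable_def)
      show "indicator {a..b} t *\<^sub>R f t \<le> indicator {a..b} t *\<^sub>R sq_density lam u u' w w' t" for t
        using that[of t] a a0 by (simp add: indicator_def)
      show "0 \<le> indicator {a..b} t *\<^sub>R sq_density lam u u' w w' t" for t
        using sq_density_nonneg[of t] a0 by (simp add: indicator_def)
    qed
    thus ?thesis using J by simp
  qed
  show "(LINT t:{a..b}|lborel. (u t - lam\<^sup>2 / (2 * t))\<^sup>2 / t) \<le> J"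
    "(LINT t:{a..b}|lborel. t * (strain lam u' w t)\<^sup>2) \<le> J"
    "(LINT t:{a..b}|lborel. lam\<^sup>2 * (t * (w' t)\<^sup>2)) \<le> J"
    by (rule le; simp add: sq_density_def shift_def)+
qed

text \<open>The hypothesis of \<open>one_sided_growth\<close> holds because the strain exceeds U' by
  w^2 - 1, which is at least -1.\<close>

lemma excess_growth:
  assumes u: "primitive u u'" and w: "primitive w w'" and lam: "lam > 0" and a: "lam \<le> a" "a < b" and k: "k > 0"
    and J: "(LINT r:{a..b}|lborel. sq_density lam u u' w w' r) \<le> J"
  shows "u b - lam\<^sup>2 / (2 * b) \<le> sqrt (J * b / (b - a)) + (b - a) + k * J / 2 + (b - a) / a / (2 * k)"
    "- (u a - lam\<^sup>2 / (2 * a)) \<le> sqrt (J * b / (b - a)) + (b - a) + k * J / 2 + (b - a) / a / (2 * k)"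
proof -
  have a0: "a > 0" using lam a by simp
  note P = primitiveD(1)[OF primitive_excess[OF u, of lam] a0, of b]
  have le: "u' t + lam\<^sup>2 / (2 * t\<^sup>2) \<le> 1 + strain lam u' w t" if "t \<in> {a..b}" for t
    using that a by (auto simp: strain_def shift'_def)
  note g = one_sided_growth[OF P a0 a(2) k strain_set_integrable[OF u w a0] le sq_density_parts(1,2)[OF u w lam a(1) J]]
  show "u b - lam\<^sup>2 / (2 * b) \<le> sqrt (J * b / (b - a)) + (b - a) + k * J / 2 + (b - a) / a / (2 * k)"
    "- (u a - lam\<^sup>2 / (2 * a)) \<le> sqrt (J * b / (b - a)) + (b - a) + k * J / 2 + (b - a) / a / (2 * k)"
    using g by auto
qed

lemma set_integral_subset_le:
  fixes h :: "real \<Rightarrow> real"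
  assumes "set_integrable lborel B h" "{a<..<b} \<subseteq> B" "\<And>r. r \<in> B \<Longrightarrow> h r \<ge> 0"
  shows "(LINT r:{a..b}|lborel. h r) \<le> (LINT r:B|lborel. h r)"
proof -
  have "(LINT r:{a<..<b}|lborel. h r) \<le> (LINT r:B|lborel. h r)"
    unfolding set_lebesgue_integral_def
    by (rule integral_mono') (use assms in \<open>auto simp: set_integrable_def indicator_def subset_iff\<close>)
  thus ?thesis by (simp add: set_integral_openclosed)
qed

text \<open>The growth bounds are applied on intervals of length \<epsilon>R just left and just
  right of R. The drift over them is \<epsilon>R and all other contributions are bounded
  independently of R, so |U(R)|/R is eventually below any given size.\<close>

lemma excess_sublinear:
  assumes lam: "lam > 0" and u: "primitive u u'" and w: "primitive w w'" and fin: "sq_energy lam u u' w w' < \<infinity>"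
  shows "((\<lambda>r. (u r - lam\<^sup>2 / (2 * r)) / r) \<longlongrightarrow> 0) at_top"
proof (rule tendstoI)
  fix e :: real assume e: "e > 0"
  define U where "U r = u r - lam\<^sup>2 / (2 * r)" for r
  define h where "h = sq_density lam u u' w w'"
  define J where "J = (LINT r:{0<..}|lborel. h r)"
  have hi: "set_integrable lborel {0<..} h" unfolding h_def by (rule sq_energy_finite_integrable(1)[OF u w fin])
  have hJ: "(LINT r:{a..b}|lborel. h r) \<le> J" if "0 < a" for a b
    unfolding J_def by (rule set_integral_subset_le[OF hi]) (use that in \<open>auto simp: h_def sq_density_nonneg\<close>)
  have J0: "J \<ge> 0" using hJ[of 1 0] by (simp add: set_lebesgue_integral_def)
  \<comment> \<open>The bound 1/2 keeps the left interval beyond \<open>lam\<close> once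
    \<open>R \<ge> 2 * lam\<close>; the bound \<open>e / 2\<close> leaves the other half of
    \<open>e\<close> for C/R.\<close>
  define \<epsilon> where "\<epsilon> = min (1/2) (e / 2)"
  have \<epsilon>: "\<epsilon> > 0" "\<epsilon> \<le> 1/2" "\<epsilon> \<le> e / 2" using e by (auto simp: \<epsilon>_def)
  \<comment> \<open>Covers both intervals with the parameter \<open>k = 1\<close>; the factor 2
    under the root is needed on the right one, where the endpoint is (1 + \<epsilon>)R.\<close>
  define C where "C = sqrt (2 * J / \<epsilon>) + J / 2 + 1"
  have bd: "\<bar>U R\<bar> \<le> C + \<epsilon> * R" if R: "R \<ge> 2 * lam" for R
  proof -
    have R0: "R > 0" using R lam by simp
    have "U R \<le> sqrt (J * R / (R - (1 - \<epsilon>) * R)) + (R - (1 - \<epsilon>) * R) + 1 * J / 2 + (R - (1 - \<epsilon>) * R) / ((1 - \<epsilon>) * R) / (2 * 1)"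
      unfolding U_def
    proof (rule excess_growth(1)[OF u w lam])
      have "lam \<le> 1/2 * R" using R by simp
      also have "\<dots> \<le> (1 - \<epsilon>) * R" by (rule mult_right_mono) (use \<epsilon> R0 in auto)
      finally show "lam \<le> (1 - \<epsilon>) * R" .
      show "(1 - \<epsilon>) * R < R" using \<epsilon> R0 by simp
      show "(LINT r:{(1 - \<epsilon>) * R..R}|lborel. sq_density lam u u' w w' r) \<le> J"
        unfolding h_def[symmetric] by (rule hJ) (use \<epsilon> R0 in simp)
    qed simp
    also have "J * R / (R - (1 - \<epsilon>) * R) = J / \<epsilon>" using R0 \<epsilon> by (simp add: field_simps)
    also have "sqrt (J / \<epsilon>) \<le> sqrt (2 * J / \<epsilon>)" using J0 \<epsilon> by (intro real_sqrt_le_mono divide_right_mono) auto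
    also have "R - (1 - \<epsilon>) * R = \<epsilon> * R" by (simp add: algebra_simps)
    also have "\<epsilon> * R / ((1 - \<epsilon>) * R) / (2 * 1) \<le> 1" using R0 \<epsilon> by (simp add: field_simps)
    finally have 1: "U R \<le> C + \<epsilon> * R" by (simp add: C_def)
    have "- U R \<le> sqrt (J * ((1 + \<epsilon>) * R) / ((1 + \<epsilon>) * R - R)) + ((1 + \<epsilon>) * R - R) + 1 * J / 2 + ((1 + \<epsilon>) * R - R) / R / (2 * 1)"
      unfolding U_def
    proof (rule excess_growth(2)[OF u w lam])
      show "R < (1 + \<epsilon>) * R" using \<epsilon> R0 by simp
      show "(LINT r:{R..(1 + \<epsilon>) * R}|lborel. sq_density lam u u' w w' r) \<le> J"
        unfolding h_def[symmetric] by (rule hJ[OF R0])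
    qed (use R lam in auto)
    also have "(1 + \<epsilon>) * R - R = \<epsilon> * R" by (simp add: algebra_simps)
    also have "J * ((1 + \<epsilon>) * R) / (\<epsilon> * R) = J * (1 + \<epsilon>) / \<epsilon>" using R0 \<epsilon> by (simp add: field_simps)
    also have "sqrt (J * (1 + \<epsilon>) / \<epsilon>) \<le> sqrt (2 * J / \<epsilon>)"
    proof (intro real_sqrt_le_mono divide_right_mono)
      show "J * (1 + \<epsilon>) \<le> 2 * J" using mult_left_mono[OF _ J0, of "1 + \<epsilon>" 2] \<epsilon> by simp
    qed (use \<epsilon> in auto)
    also have "\<epsilon> * R / R / (2 * 1) \<le> 1" using R0 \<epsilon> by (simp add: field_simps)
    finally have "- U R \<le> C + \<epsilon> * R" by (simp add: C_def)
    with 1 show ?thesis by simp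
  qed
  have "((\<lambda>R. C / R) \<longlongrightarrow> 0) at_top" by real_asymp
  hence "eventually (\<lambda>R. C / R < e / 2) at_top" using e by (intro order_tendstoD(2)) auto
  moreover have "eventually (\<lambda>R. R \<ge> 2 * lam) at_top" by (rule eventually_ge_at_top)
  ultimately show "eventually (\<lambda>R. dist ((u R - lam\<^sup>2 / (2 * R)) / R) 0 < e) at_top"
  proof eventually_elim
    case (elim R)
    have R0: "R > 0" using elim lam by simp
    have "\<bar>U R\<bar> / R \<le> (C + \<epsilon> * R) / R" using bd[OF elim(2)] R0 by (intro divide_right_mono) auto
    also have "\<dots> = C / R + \<epsilon>" using R0 by (simp add: field_simps)
    also have "\<dots> < e" using elim(1) \<epsilon>(3) by linarith
    finally show ?case using R0 by (simp add: U_def)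
  qed
qed

section \<open>The limit defining the energy\<close>

lemma partial_sq_energy_tendsto:
  assumes lam: "lam > 0" and adm: "(u, w) \<in> admissible lam"
  shows "((\<lambda>R. ereal (LINT r:{0<..<R}|lborel. sq_density lam u (weak_deriv u) w (weak_deriv w) r))
            \<longlongrightarrow> enn2ereal (sq_energy lam u (weak_deriv u) w (weak_deriv w))) at_top"
proof -
  define h where "h = sq_density lam u (weak_deriv u) w (weak_deriv w)"
  have u: "primitive u (weak_deriv u)" and w: "primitive w (weak_deriv w)"
    using admissible_W12[OF adm] W12_loc_primitive by auto
  have hm: "(\<lambda>r. indicator {0<..} r * h r) \<in> borel_measurable borel"
    unfolding h_def by (rule sq_density_measurable[OF u w])
  have h0: "r > 0 \<Longrightarrow> h r \<ge> 0" for r unfolding h_def by (rule sq_density_nonneg)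
  have hi: "set_integrable lborel {0<..<R} h" for R
    unfolding h_def by (rule admissible_sq_density_integrable[OF lam adm])
  define \<Phi> where "\<Phi> R = (\<integral>\<^sup>+r. ennreal (indicator {0<..<R} r * h r) \<partial>lborel)" for R
  have \<Phi>: "\<Phi> R = ennreal (LINT r:{0<..<R}|lborel. h r)" for R
    unfolding \<Phi>_def set_lebesgue_integral_def
    using nn_integral_eq_integral[OF hi[unfolded set_integrable_def]] h0 by (auto simp: indicator_def)
  have mono: "\<Phi> R \<le> \<Phi> S" if "R \<le> S" for R S
    unfolding \<Phi>_def by (rule nn_integral_indicator_mono) (use that h0 in auto)
  define N where "N = sq_energy lam u (weak_deriv u) w (weak_deriv w)"
  have le: "\<Phi> R \<le> N" for R
    unfolding \<Phi>_def N_def sq_energy_def h_def[symmetric] by (rule nn_integral_indicator_mono) (use h0 in auto)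
  have sup: "(SUP n::nat. \<Phi> (real n)) = N"
  proof -
    have "N = (\<integral>\<^sup>+r. (SUP n::nat. ennreal (indicator {0<..<real n} r * h r)) \<partial>lborel)"
      unfolding N_def sq_energy_def h_def[symmetric]
    proof (rule nn_integral_cong)
      fix r :: real
      show "ennreal (indicator {0<..} r * h r) = (SUP n::nat. ennreal (indicator {0<..<real n} r * h r))"
      proof (rule antisym)
        obtain n :: nat where n: "real n > r" using reals_Archimedean2 by blast
        have "ennreal (indicator {0<..} r * h r) = ennreal (indicator {0<..<real n} r * h r)"
          using n by (auto simp: indicator_def)
        thus "ennreal (indicator {0<..} r * h r) \<le> (SUP n::nat. ennreal (indicator {0<..<real n} r * h r))"
          by (auto intro: SUP_upper2[of n])
        show "(SUP n::nat. ennreal (indicator {0<..<real n} r * h r)) \<le> ennreal (indicator {0<..} r * h r)"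
          by (intro SUP_least ennreal_leI) (auto simp: indicator_def h0)
      qed
    qed
    also have "\<dots> = (SUP n::nat. \<Phi> (real n))"
      unfolding \<Phi>_def
    proof (rule nn_integral_monotone_convergence_SUP)
      show "incseq (\<lambda>n r. ennreal (indicator {0<..<real n} r * h r))"
        unfolding incseq_def le_fun_def by (intro allI impI ennreal_leI) (auto simp: indicator_def h0)
      fix n :: nat
      have "(\<lambda>r. indicator {0<..<real n} r * (indicator {0<..} r * h r)) \<in> borel_measurable borel" using hm by measurable
      also have "(\<lambda>r. indicator {0<..<real n} r * (indicator {0<..} r * h r)) = (\<lambda>r. indicator {0<..<real n} r * h r)"
        by (auto simp: indicator_def fun_eq_iff)
      finally show "(\<lambda>r. ennreal (indicator {0<..<real n} r * h r)) \<in> borel_measurable lborel" by simp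
    qed
    finally show ?thesis by simp
  qed
  have "(\<Phi> \<longlongrightarrow> N) at_top"
  proof (rule increasing_tendsto)
    show "eventually (\<lambda>R. \<Phi> R \<le> N) at_top" using le by simp
    fix y assume "y < N"
    then obtain n :: nat where "y < \<Phi> (real n)" unfolding sup[symmetric] by (auto simp: less_SUP_iff)
    hence "y < \<Phi> R" if "R \<ge> real n" for R using mono[OF that] by (rule less_le_trans)
    thus "eventually (\<lambda>R. y < \<Phi> R) at_top" by (rule eventually_mono[OF eventually_ge_at_top])
  qed
  hence "((\<lambda>R. enn2ereal (\<Phi> R)) \<longlongrightarrow> enn2ereal N) at_top" by (rule tendsto_enn2erealI)
  moreover have "enn2ereal (\<Phi> R) = ereal (LINT r:{0<..<R}|lborel. h r)" for R
  proof -
    have "0 \<le> (LINT r:{0<..<R}|lborel. h r)"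
      unfolding set_lebesgue_integral_def using h0 by (auto intro!: integral_nonneg_AE simp: indicator_def)
    thus ?thesis unfolding \<Phi> by simp
  qed
  ultimately show ?thesis by (simp add: h_def N_def)
qed

text \<open>If the square energy is finite, the boundary term at R vanishes by
  \<open>excess_sublinear\<close>. If it is infinite, that term may grow, but for large R it takes
  away at most half of the square energy inside radius R plus a constant, so the truncated energies
  still diverge to infinity.\<close>

theorem truncated_energy_tendsto:
  assumes lam: "lam > 0" and \<psi>: "cutoff \<psi>" and adm: "(u, w) \<in> admissible lam"
  shows "((\<lambda>R. ereal (truncated_energy lam \<psi> u w R)) \<longlongrightarrow>
     enn2ereal (sq_energy lam u (weak_deriv u) w (weak_deriv w)) + ereal (lam * u lam - counterterm lam \<psi>)) at_top"
proof -
  define h where "h = sq_density lam u (weak_deriv u) w (weak_deriv w)"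
  define N where "N = sq_energy lam u (weak_deriv u) w (weak_deriv w)"
  define J where "J R = (LINT r:{0<..<R}|lborel. h r)" for R
  define c where "c = lam * u lam - counterterm lam \<psi>"
  have u: "primitive u (weak_deriv u)" and w: "primitive w (weak_deriv w)"
    using admissible_W12[OF adm] W12_loc_primitive by auto
  have JN: "((\<lambda>R. ereal (J R)) \<longlongrightarrow> enn2ereal N) at_top"
    unfolding J_def N_def h_def by (rule partial_sq_energy_tendsto[OF lam adm])
  have h0: "r > 0 \<Longrightarrow> h r \<ge> 0" for r unfolding h_def by (rule sq_density_nonneg)
  have hi: "set_integrable lborel {0<..<R} h" for R
    unfolding h_def by (rule admissible_sq_density_integrable[OF lam adm])
  have form: "truncated_energy lam \<psi> u w R = J R + c + lam ^ 4 / (4 * R\<^sup>2) - lam\<^sup>2 * (u R / R)" if "R > lam" for R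
    using truncated_energy_formula(2)[OF lam \<psi> adm that] by (simp add: J_def h_def c_def)
  show ?thesis
  proof (cases "N < \<infinity>")
    case True
    then obtain N' where N': "N = ennreal N'" "N' \<ge> 0" by (cases N) auto
    have JN': "(J \<longlongrightarrow> N') at_top" using JN N' by (simp add: lim_ereal)
    have uR: "((\<lambda>r. (u r - lam\<^sup>2 / (2 * r)) / r) \<longlongrightarrow> 0) at_top"
      by (rule excess_sublinear[OF lam u w]) (use True in \<open>simp add: N_def\<close>)
    have "((\<lambda>r. J r + c + lam ^ 4 / (4 * r\<^sup>2) - lam\<^sup>2 * ((u r - lam\<^sup>2 / (2 * r)) / r + lam\<^sup>2 / (2 * r) / r)) \<longlongrightarrow> N' + c + 0 - lam\<^sup>2 * (0 + 0)) at_top"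
      by (intro tendsto_intros JN' uR; real_asymp)
    hence "((\<lambda>r. J r + c + lam ^ 4 / (4 * r\<^sup>2) - lam\<^sup>2 * ((u r - lam\<^sup>2 / (2 * r)) / r + lam\<^sup>2 / (2 * r) / r)) \<longlongrightarrow> N' + c) at_top" by simp
    hence "((\<lambda>R. truncated_energy lam \<psi> u w R) \<longlongrightarrow> N' + c) at_top"
    proof (rule Lim_transform_eventually)
      show "\<forall>\<^sub>F r in at_top. J r + c + lam ^ 4 / (4 * r\<^sup>2) - lam\<^sup>2 * ((u r - lam\<^sup>2 / (2 * r)) / r + lam\<^sup>2 / (2 * r) / r) = truncated_energy lam \<psi> u w r"
        using eventually_gt_at_top[of lam]
      proof eventually_elim
        case (elim r)
        show ?case unfolding form[OF elim] by (simp add: diff_divide_distrib)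
      qed
    qed
    thus ?thesis unfolding N_def[symmetric] c_def[symmetric] using N' by (simp add: lim_ereal)
  next
    case False
    hence N: "N = \<infinity>" by (metis infinity_ennreal_def top.not_eq_extremum)
    have Jt: "filterlim J at_top at_top" using JN N by (simp add: tendsto_PInfty_eq_at_top)
    \<comment> \<open>\<open>R \<ge> 2 * lam\<close> puts the interval from R/2 to R beyond
      \<open>lam\<close>, and \<open>R \<ge> 4 * lam\<^sup>2\<close> makes the coefficient 2 lam^2/R
      of \<open>J R\<close> at most 1/2.\<close>
    have bd: "J R / 2 + (c - 2 * lam\<^sup>2 - 2) \<le> truncated_energy lam \<psi> u w R" if R: "R \<ge> 2 * lam" "R \<ge> 4 * lam\<^sup>2" "R \<ge> 1" for R
    proof -
      have R0: "R > 0" using R by simp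
      have J0: "J R \<ge> 0" unfolding J_def set_lebesgue_integral_def using h0 by (auto intro!: integral_nonneg_AE simp: indicator_def)
      have "u R - lam\<^sup>2 / (2 * R) \<le> sqrt (J R * R / (R - R/2)) + (R - R/2) + 1 * J R / 2 + (R - R/2) / (R/2) / (2 * 1)"
      proof (rule excess_growth(1)[OF u w lam])
        show "(LINT r:{R / 2..R}|lborel. sq_density lam u (weak_deriv u) w (weak_deriv w) r) \<le> J R"
          unfolding h_def[symmetric] J_def by (rule set_integral_subset_le[OF hi]) (use R0 h0 in auto)
      qed (use R R0 lam in auto)
      also have "J R * R / (R - R / 2) = 2 * J R" using R0 by (simp add: field_simps)
      also have "sqrt (2 * J R) \<le> 1 + J R"
        by (rule real_le_lsqrt) (use J0 in \<open>auto simp: power2_eq_square algebra_simps\<close>)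
      also have "(R - R / 2) / (R / 2) / (2 * 1) = 1 / 2" using R0 by simp
      finally have "u R \<le> 2 * J R + R + 2 + lam\<^sup>2 / (2 * R)" using R0 J0 by linarith
      hence "u R / R \<le> (2 * J R + R + 2 + lam\<^sup>2 / (2 * R)) / R" using R0 by (intro divide_right_mono) auto
      also have "\<dots> = 2 * J R / R + 1 + 2 / R + lam\<^sup>2 / (2 * R\<^sup>2)" using R0 by (simp add: field_simps power2_eq_square)
      finally have "lam\<^sup>2 * (u R / R) \<le> lam\<^sup>2 * (2 * J R / R + 1 + 2 / R + lam\<^sup>2 / (2 * R\<^sup>2))"
        by (intro mult_left_mono) auto
      also have "\<dots> = J R * (2 * lam\<^sup>2 / R) + lam\<^sup>2 + 2 * lam\<^sup>2 / R + lam ^ 4 / (2 * R\<^sup>2)"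
        by (simp add: algebra_simps power2_eq_square power4_eq_xxxx)
      also have "J R * (2 * lam\<^sup>2 / R) \<le> J R * (1/2)" by (rule mult_left_mono) (use R R0 J0 in \<open>auto simp: field_simps\<close>)
      also have "2 * lam\<^sup>2 / R \<le> 1/2" using R R0 by (simp add: field_simps)
      finally have "lam\<^sup>2 * (u R / R) \<le> J R / 2 + lam\<^sup>2 + 1/2 + lam ^ 4 / (2 * R\<^sup>2)" by simp
      moreover have "lam ^ 4 / (4 * R\<^sup>2) \<le> 1/2"
      proof -
        have "(4 * lam\<^sup>2)\<^sup>2 \<le> R\<^sup>2" by (rule power_mono) (use R in auto)
        hence "16 * lam ^ 4 \<le> R\<^sup>2" by (simp add: power_mult_distrib flip: power_mult)
        moreover have "lam ^ 4 \<ge> 0" by simp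
        ultimately have "lam ^ 4 \<le> 2 * R\<^sup>2" by linarith
        thus ?thesis using R0 by (simp add: field_simps)
      qed
      moreover have "lam ^ 4 / (2 * R\<^sup>2) = 2 * (lam ^ 4 / (4 * R\<^sup>2))" by simp
      moreover have "lam\<^sup>2 \<ge> 0" by simp
      moreover have "truncated_energy lam \<psi> u w R = J R + c + lam ^ 4 / (4 * R\<^sup>2) - lam\<^sup>2 * (u R / R)"
        by (rule form) (use R(1) lam in linarith)
      ultimately show ?thesis by linarith
    qed
    have "filterlim (\<lambda>R. (c - 2 * lam\<^sup>2 - 2) + (1/2) * J R) at_top at_top"
      by (intro filterlim_tendsto_add_at_top[OF tendsto_const] filterlim_tendsto_pos_mult_at_top[OF tendsto_const _ Jt]) simp
    hence "filterlim (\<lambda>R. truncated_energy lam \<psi> u w R) at_top at_top"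
    proof (rule filterlim_at_top_mono)
      show "\<forall>\<^sub>F R in at_top. (c - 2 * lam\<^sup>2 - 2) + (1/2) * J R \<le> truncated_energy lam \<psi> u w R"
        using eventually_ge_at_top[of "2 * lam"] eventually_ge_at_top[of "4 * lam\<^sup>2"] eventually_ge_at_top[of 1]
      proof eventually_elim
        case (elim R) thus ?case using bd[of R] by simp
      qed
    qed
    thus ?thesis unfolding N_def[symmetric] N by (simp add: tendsto_PInfty_eq_at_top)
  qed
qed

lemma energy_eq:
  assumes "lam > 0" "cutoff \<psi>" "(u, w) \<in> admissible lam"
  shows "energy lam \<psi> u w = enn2ereal (sq_energy lam u (weak_deriv u) w (weak_deriv w)) + ereal (lam * u lam - counterterm lam \<psi>)"
  unfolding energy_def by (rule tendsto_Lim[OF _ truncated_energy_tendsto[OF assms]]) simp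

text \<open>The lower growth bound on the interval from \<open>lam\<close> to 2 \<open>lam\<close>.
  That only half of \<open>N\<close> appears is the point: \<open>N + lam * u lam\<close> then
  controls \<open>N\<close>, which gives both boundedness below and coercivity.\<close>

lemma boundary_value_bound:
  assumes lam: "lam > 0" and u: "primitive u u'" and w: "primitive w w'" and fin: "sq_energy lam u u' w w' = ennreal N" "N \<ge> 0"
  shows "lam * u lam \<ge> - N / 2 - 4 * lam\<^sup>2"
proof -
  define h where "h = sq_density lam u u' w w'"
  have hi: "set_integrable lborel {0<..} h" "ennreal N = ennreal (LINT r:{0<..}|lborel. h r)"
    using sq_energy_finite_integrable[OF u w] fin by (auto simp: h_def)
  have "0 \<le> (LINT r:{0<..}|lborel. h r)"
    unfolding set_lebesgue_integral_def by (auto intro!: integral_nonneg_AE simp: indicator_def h_def sq_density_nonneg)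
  hence N: "N = (LINT r:{0<..}|lborel. h r)" using hi(2) fin(2) by simp
  have "- (u lam - lam\<^sup>2 / (2 * lam)) \<le> sqrt (N * (2 * lam) / (2 * lam - lam)) + (2 * lam - lam) + (1 / (2 * lam)) * N / 2 + (2 * lam - lam) / lam / (2 * (1 / (2 * lam)))"
  proof (rule excess_growth(2)[OF u w lam])
    show "(LINT r:{lam..2 * lam}|lborel. sq_density lam u u' w w' r) \<le> N"
      unfolding N h_def[symmetric] by (rule set_integral_subset_le[OF hi(1)]) (use lam in \<open>auto simp: h_def sq_density_nonneg\<close>)
  qed (use lam in auto)
  also have "\<dots> = sqrt (2 * N) + 2 * lam + N / (4 * lam)" using lam by (simp add: field_simps)
  finally have "lam * (- (u lam - lam\<^sup>2 / (2 * lam))) \<le> lam * (sqrt (2 * N) + 2 * lam + N / (4 * lam))"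
    by (rule mult_left_mono) (use lam in simp)
  hence 1: "- (lam * u lam) + lam\<^sup>2 / 2 \<le> lam * sqrt (2 * N) + 2 * lam\<^sup>2 + N / 4"
    using lam by (simp add: algebra_simps power2_eq_square)
  \<comment> \<open>Chosen so that \<open>lam * sqrt (2 * N)\<close> costs only N/4, which together
    with the N/4 already present makes N/2.\<close>
  have "0 \<le> (sqrt (2 * N) / 2 - 2 * lam)\<^sup>2" by simp
  also have "\<dots> = N / 2 - 2 * (lam * sqrt (2 * N)) + 4 * lam\<^sup>2"
    using fin(2) by (simp add: power2_diff power_divide power_mult_distrib)
  finally have "lam * sqrt (2 * N) \<le> N / 4 + 2 * lam\<^sup>2" by simp
  thus ?thesis using 1 zero_le_power2[of lam] by linarith
qed

subsection \<open>Constructions with primitives\<close>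

lemma primitive_piecewise:
  assumes p1: "primitive f1 g1" and p2: "primitive f2 g2" and c: "f1 c = f2 c"
  shows "primitive (\<lambda>r. if r < c then f1 r else f2 r) (\<lambda>r. if r < c then g1 r else g2 r)"
  unfolding primitive_def
proof (intro allI impI)
  fix a b :: real assume ab: "0 < a" "a \<le> b"
  define f where "f r = (if r < c then f1 r else f2 r)" for r
  define g where "g r = (if r < c then g1 r else g2 r)" for r
  have left: "ac_on x y f g \<and> set_integrable lborel {x..y} (\<lambda>r. (g r)\<^sup>2)" if xy: "0 < x" "y \<le> c" for x y
  proof -
    note d = primitiveD[OF p1 xy(1), of y]
    have ae: "AE r in lborel. r \<in> {x..y} \<longrightarrow> g1 r = g r"
      using AE_lborel_singleton[of c] by eventually_elim (use xy in \<open>auto simp: g_def\<close>)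
    have e: "set_integrable lborel {x..y} (\<lambda>r. h (g1 r)) = set_integrable lborel {x..y} (\<lambda>r. h (g r))" for h :: "real \<Rightarrow> real"
      unfolding set_integrable_def
      by (rule integrable_discrete_difference[where X = "{c}"]) (use xy in \<open>auto simp: g_def indicator_def\<close>)
    have gi: "set_integrable lborel {x..y} g" using d(2) e[where h = "\<lambda>x. x"] by simp
    have "ac_on x y f g"
    proof (rule ac_on_cong[OF d(1) _ ae])
      show "f1 r = f r" if "r \<in> {x..y}" for r using that xy c by (cases "r = c") (auto simp: f_def)
      show "set_borel_measurable lborel {x..y} g"
        using gi by (auto simp: set_integrable_def set_borel_measurable_def)
    qed
    thus ?thesis using d(3) e[where h = "\<lambda>x. x\<^sup>2"] by simp
  qed
  have right: "ac_on x y f g \<and> set_integrable lborel {x..y} (\<lambda>r. (g r)\<^sup>2)" if xy: "0 < x" "c \<le> x" for x y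
  proof -
    note d = primitiveD[OF p2 xy(1), of y]
    have e: "set_integrable lborel {x..y} (\<lambda>r. h (g2 r)) = set_integrable lborel {x..y} (\<lambda>r. h (g r))" for h :: "real \<Rightarrow> real"
      by (rule set_integrable_cong) (use xy in \<open>auto simp: g_def\<close>)
    have gi: "set_integrable lborel {x..y} g" using d(2) e[where h = "\<lambda>x. x"] by simp
    have "ac_on x y f g"
    proof (rule ac_on_cong[OF d(1)])
      show "set_borel_measurable lborel {x..y} g"
        using gi by (auto simp: set_integrable_def set_borel_measurable_def)
    qed (use xy in \<open>auto simp: f_def g_def\<close>)
    thus ?thesis using d(3) e[where h = "\<lambda>x. x\<^sup>2"] by simp
  qed
  have "ac_on a b f g \<and> set_integrable lborel {a..b} (\<lambda>r. (g r)\<^sup>2)"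
  proof (cases "a < c \<and> c < b")
    case False
    thus ?thesis using left[of a b] right[of a b] ab by force
  next
    case True
    hence l: "ac_on a c f g \<and> set_integrable lborel {a..c} (\<lambda>r. (g r)\<^sup>2)"
      and r: "ac_on c b f g \<and> set_integrable lborel {c..b} (\<lambda>r. (g r)\<^sup>2)" using left[of a c] right[of c b] ab by auto
    have "set_integrable lborel ({a..c} \<union> {c..b}) (\<lambda>r. (g r)\<^sup>2)" by (rule set_integrable_Un) (use l r in auto)
    moreover have "{a..c} \<union> {c..b} = {a..b}" using True by auto
    ultimately show ?thesis using ac_on_combine[of a c f g b] l r True by auto
  qed
  thus "ac_on a b (\<lambda>r. if r < c then f1 r else f2 r) (\<lambda>r. if r < c then g1 r else g2 r) \<and>
    set_integrable lborel {a..b} (\<lambda>r. (if r < c then g1 r else g2 r)\<^sup>2)"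
    by (simp add: f_def[abs_def] g_def[abs_def])
qed

text \<open>At most one of the two intervals is nondegenerate.\<close>

definition signed_integral :: "real \<Rightarrow> (real \<Rightarrow> real) \<Rightarrow> real \<Rightarrow> real" where
  "signed_integral c g x = (LINT t:{c..x}|lborel. g t) - (LINT t:{x..c}|lborel. g t)"

lemma primitive_signed_integral:
  assumes c: "0 < c"
    and g: "\<And>a b. 0 < a \<Longrightarrow> set_integrable lborel {a..b} g" "\<And>a b. 0 < a \<Longrightarrow> set_integrable lborel {a..b} (\<lambda>t. (g t)\<^sup>2)"
  shows "primitive (signed_integral c g) g"
proof -
  have *: "signed_integral c g y - signed_integral c g x = (LINT t:{x..y}|lborel. g t)" if xy: "0 < x" "x \<le> y" for x y
  proof -
    have e0: "(LINT t:{x..y}|lborel. g t) = 0" if "y < x" for x y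
      using that by (simp add: set_lebesgue_integral_def)
    consider "y \<le> c" | "x < c" "c < y" | "c \<le> x" by linarith
    thus ?thesis
    proof cases
      case 1
      have "(LINT t:{x..c}|lborel. g t) = (LINT t:{x..y}|lborel. g t) + (LINT t:{y..c}|lborel. g t)"
        by (rule set_integral_combine) (use g xy 1 in auto)
      moreover have "(LINT t:{c..y}|lborel. g t) = 0" "(LINT t:{c..x}|lborel. g t) = 0"
        using 1 xy e0 set_integral_singleton[of c g] by (cases "y = c"; cases "x = c"; force)+
      ultimately show ?thesis by (simp add: signed_integral_def)
    next
      case 2
      have "(LINT t:{x..y}|lborel. g t) = (LINT t:{x..c}|lborel. g t) + (LINT t:{c..y}|lborel. g t)"
        by (rule set_integral_combine) (use g xy 2 in auto)
      thus ?thesis using 2 e0[of c y] e0[of x c] by (simp add: signed_integral_def del: atLeastatMost_empty)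
    next
      case 3
      have "(LINT t:{c..y}|lborel. g t) = (LINT t:{c..x}|lborel. g t) + (LINT t:{x..y}|lborel. g t)"
        by (rule set_integral_combine) (use g xy 3 c in auto)
      moreover have "(LINT t:{y..c}|lborel. g t) = 0" "(LINT t:{x..c}|lborel. g t) = 0"
        using 3 xy e0 set_integral_singleton[of c g] by (cases "y = c"; cases "x = c"; force)+
      ultimately show ?thesis by (simp add: signed_integral_def)
    qed
  qed
  show ?thesis unfolding primitive_def ac_on_def using g * by auto
qed

text \<open>Smooth approximation of the modulus by the root of f^2 + e^2, followed by dominated
  convergence. Where \<open>f\<close> vanishes, \<open>sgn\<close> selects the derivative 0.\<close>

lemma primitive_abs:
  assumes p: "primitive f g"
  shows "primitive (\<lambda>r. \<bar>f r\<bar>) (\<lambda>r. sgn (f r) * g r)"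
proof -
  have meas: "set_borel_measurable lborel {a..b} (\<lambda>r. sgn (f r) * g r)" if "0 < a" for a b
  proof -
    have fm: "(\<lambda>x. indicator {a..b} x * f x) \<in> borel_measurable borel"
      using set_integrable_continuous[OF primitiveD(4)[OF p that, of b]] by (auto simp: set_integrable_def)
    have gm: "(\<lambda>x. indicator {a..b} x * g x) \<in> borel_measurable borel"
      using primitiveD(2)[OF p that, of b] by (auto simp: set_integrable_def)
    have "(\<lambda>x. sgn (indicator {a..b} x * f x) * (indicator {a..b} x * g x)) \<in> borel_measurable borel"
      using fm gm by measurable
    also have "(\<lambda>x. sgn (indicator {a..b} x * f x) * (indicator {a..b} x * g x)) = (\<lambda>x. indicator {a..b} x *\<^sub>R (sgn (f x) * g x))"
      by (auto simp: indicator_def fun_eq_iff)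
    finally show ?thesis by (simp add: set_borel_measurable_def)
  qed
  have sqi: "set_integrable lborel {a..b} (\<lambda>r. (sgn (f r) * g r)\<^sup>2)" if "0 < a" for a b
  proof -
    have "(\<lambda>x. (indicator {a..b} x *\<^sub>R (sgn (f x) * g x))\<^sup>2) \<in> borel_measurable lborel"
      using meas[OF that, of b] unfolding set_borel_measurable_def by measurable
    also have "(\<lambda>x. (indicator {a..b} x *\<^sub>R (sgn (f x) * g x))\<^sup>2) = (\<lambda>x. indicator {a..b} x *\<^sub>R (sgn (f x) * g x)\<^sup>2)"
      by (auto simp: indicator_def fun_eq_iff)
    finally have m: "(\<lambda>x. indicator {a..b} x *\<^sub>R (sgn (f x) * g x)\<^sup>2) \<in> borel_measurable lborel" .
    show ?thesis
      unfolding set_integrable_def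
      by (rule Bochner_Integration.integrable_bound[OF primitiveD(3)[OF p that, of b, unfolded set_integrable_def] m])
         (auto simp: indicator_def sgn_if power_mult_distrib)
  qed
  have ftc: "\<bar>f y\<bar> - \<bar>f x\<bar> = (LINT t:{x..y}|lborel. sgn (f t) * g t)" if xy: "0 < x" "x \<le> y" for x y
  proof -
    note d = primitiveD[OF p xy(1), of y]
    define e where "e n = 1 / real (Suc n)" for n
    have e0: "e n > 0" for n by (simp add: e_def)
    have elim: "e \<longlonglongrightarrow> 0" using LIMSEQ_inverse_real_of_nat by (simp add: e_def[abs_def] inverse_eq_divide)
    have pos: "t\<^sup>2 + (e n)\<^sup>2 > 0" for t n using e0[of n] by (simp add: add_nonneg_pos)
    have ac: "ac_on x y (\<lambda>r. sqrt ((f r)\<^sup>2 + (e n)\<^sup>2)) (\<lambda>r. f r / sqrt ((f r)\<^sup>2 + (e n)\<^sup>2) * g r)" for n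
    proof (rule ac_on_chain[OF d(1)])
      show "((\<lambda>t. sqrt (t\<^sup>2 + (e n)\<^sup>2)) has_real_derivative t / sqrt (t\<^sup>2 + (e n)\<^sup>2)) (at t)" for t
        using pos[of t n] by (auto intro!: derivative_eq_intros simp: field_simps)
      show "continuous_on UNIV (\<lambda>t. t / sqrt (t\<^sup>2 + (e n)\<^sup>2))"
        by (intro continuous_intros) (use e0[of n] in \<open>auto simp: add_nonneg_eq_0_iff\<close>)
    qed
    have l1: "(\<lambda>n. sqrt ((f y)\<^sup>2 + (e n)\<^sup>2) - sqrt ((f x)\<^sup>2 + (e n)\<^sup>2)) \<longlonglongrightarrow> sqrt ((f y)\<^sup>2 + 0\<^sup>2) - sqrt ((f x)\<^sup>2 + 0\<^sup>2)"
      by (intro tendsto_intros elim)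
    have eq: "sqrt ((f y)\<^sup>2 + (e n)\<^sup>2) - sqrt ((f x)\<^sup>2 + (e n)\<^sup>2) = (LINT t:{x..y}|lborel. f t / sqrt ((f t)\<^sup>2 + (e n)\<^sup>2) * g t)" for n
      using ac_onD(1)[OF ac, of x y] xy by simp
    have l2: "(\<lambda>n. LINT t:{x..y}|lborel. f t / sqrt ((f t)\<^sup>2 + (e n)\<^sup>2) * g t) \<longlonglongrightarrow> (LINT t:{x..y}|lborel. sgn (f t) * g t)"
      unfolding set_lebesgue_integral_def
    proof (rule integral_dominated_convergence)
      show "integrable lborel (\<lambda>t. \<bar>indicator {x..y} t *\<^sub>R g t\<bar>)" using d(2) by (simp add: set_integrable_def)
      show "(\<lambda>t. indicator {x..y} t *\<^sub>R (sgn (f t) * g t)) \<in> borel_measurable lborel"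
        using meas[OF xy(1), of y] by (simp add: set_borel_measurable_def)
      show "(\<lambda>t. indicator {x..y} t *\<^sub>R (f t / sqrt ((f t)\<^sup>2 + (e n)\<^sup>2) * g t)) \<in> borel_measurable lborel" for n
        using ac[of n] by (auto simp: ac_on_def set_integrable_def)
      show "AE t in lborel. (\<lambda>n. indicator {x..y} t *\<^sub>R (f t / sqrt ((f t)\<^sup>2 + (e n)\<^sup>2) * g t)) \<longlonglongrightarrow> indicator {x..y} t *\<^sub>R (sgn (f t) * g t)"
      proof (rule AE_I2)
        fix t
        have "(\<lambda>n. f t / sqrt ((f t)\<^sup>2 + (e n)\<^sup>2)) \<longlonglongrightarrow> sgn (f t)"
        proof (cases "f t = 0")
          case False
          have "(\<lambda>n. f t / sqrt ((f t)\<^sup>2 + (e n)\<^sup>2)) \<longlonglongrightarrow> f t / sqrt ((f t)\<^sup>2 + 0\<^sup>2)"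
            by (intro tendsto_intros elim) (use False in auto)
          thus ?thesis using False by (simp add: sgn_if real_sqrt_abs abs_if split: if_splits)
        qed simp
        thus "(\<lambda>n. indicator {x..y} t *\<^sub>R (f t / sqrt ((f t)\<^sup>2 + (e n)\<^sup>2) * g t)) \<longlonglongrightarrow> indicator {x..y} t *\<^sub>R (sgn (f t) * g t)"
          by (intro tendsto_intros)
      qed
      show "AE t in lborel. norm (indicator {x..y} t *\<^sub>R (f t / sqrt ((f t)\<^sup>2 + (e n)\<^sup>2) * g t)) \<le> \<bar>indicator {x..y} t *\<^sub>R g t\<bar>" for n
      proof (rule AE_I2)
        fix t
        have "\<bar>f t\<bar> \<le> sqrt ((f t)\<^sup>2 + (e n)\<^sup>2)" by (rule real_le_rsqrt) simp
        hence "\<bar>f t / sqrt ((f t)\<^sup>2 + (e n)\<^sup>2)\<bar> \<le> 1" using pos[of "f t" n] by (simp add: abs_divide)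
        hence "\<bar>f t / sqrt ((f t)\<^sup>2 + (e n)\<^sup>2)\<bar> * \<bar>g t\<bar> \<le> 1 * \<bar>g t\<bar>" by (rule mult_right_mono) simp
        thus "norm (indicator {x..y} t *\<^sub>R (f t / sqrt ((f t)\<^sup>2 + (e n)\<^sup>2) * g t)) \<le> \<bar>indicator {x..y} t *\<^sub>R g t\<bar>"
          by (simp add: indicator_def abs_mult)
      qed
    qed
    show ?thesis using LIMSEQ_unique[OF l1[unfolded eq] l2] by simp
  qed
  show ?thesis unfolding primitive_def ac_on_def
    using set_integrable_square_imp[OF meas sqi] sqi ftc by auto
qed

lemma sq_energy_abs_le: "sq_energy lam u u' (\<lambda>r. \<bar>w r\<bar>) (\<lambda>r. sgn (w r) * w' r) \<le> sq_energy lam u u' w w'"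
  unfolding sq_energy_def
proof (intro nn_integral_mono ennreal_leI)
  fix r :: real
  have "lam\<^sup>2 * (r * (sgn (w r) * w' r)\<^sup>2) \<le> lam\<^sup>2 * (r * (w' r)\<^sup>2)" if "r > 0"
    using that by (intro mult_left_mono) (auto simp: sgn_if power_mult_distrib)
  thus "indicator {0<..} r * sq_density lam u u' (\<lambda>r. \<bar>w r\<bar>) (\<lambda>r. sgn (w r) * w' r) r \<le> indicator {0<..} r * sq_density lam u u' w w' r"
    by (auto simp: indicator_def sq_density_def strain_def)
qed

text \<open>The exact solution beyond \<open>lam\<close>, continued linearly to 0: the square
  density vanishes beyond \<open>lam\<close> and is bounded below it.\<close>

lemma finite_sq_energy_exists:
  assumes lam: "lam > 0"
  obtains u u' w w' where "primitive u u'" "primitive w w'" "sq_energy lam u u' w w' < \<infinity>"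
proof -
  define u where "u r = (if r < lam then r / 2 else lam\<^sup>2 / (2 * r))" for r
  define u' where "u' r = (if r < lam then 1 / 2 else - (lam\<^sup>2 / (2 * r\<^sup>2)))" for r
  define w where "w r = (if r < lam then r / lam else 1)" for r
  define w' where "w' r = (if r < lam then 1 / lam else 0)" for r
  have pu: "primitive u u'"
    unfolding u_def[abs_def] u'_def[abs_def]
  proof (rule primitive_piecewise)
    show "primitive (\<lambda>r. r / 2) (\<lambda>r. 1 / 2)"
      by (rule primitive_continuous) (auto intro!: derivative_eq_intros)
    show "primitive (\<lambda>r. lam\<^sup>2 / (2 * r)) (\<lambda>r. - (lam\<^sup>2 / (2 * r\<^sup>2)))"
      by (rule primitive_continuous)
         (auto intro!: derivative_eq_intros continuous_intros simp: field_simps power2_eq_square)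
  qed (use lam in \<open>simp add: power2_eq_square\<close>)
  have pw: "primitive w w'"
    unfolding w_def[abs_def] w'_def[abs_def]
  proof (rule primitive_piecewise)
    show "primitive (\<lambda>r. r / lam) (\<lambda>r. 1 / lam)"
      by (rule primitive_continuous) (use lam in \<open>auto intro!: derivative_eq_intros\<close>)
    show "primitive (\<lambda>r. 1) (\<lambda>r. 0)"
      by (rule primitive_continuous) auto
  qed (use lam in simp)
  have "sq_density lam u u' w w' r \<le> 4 * lam" if r: "0 < r" "r < lam" for r
  proof -
    have q: "0 \<le> (r / lam)\<^sup>2" "(r / lam)\<^sup>2 \<le> 1" using r lam by (auto simp: power_le_one)
    have "((r / lam)\<^sup>2 - 1 + 1 / 2)\<^sup>2 \<le> 1\<^sup>2" using q by (subst abs_le_square_iff[symmetric]) linarith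
    hence "r * ((r / lam)\<^sup>2 - 1 + 1 / 2)\<^sup>2 \<le> r * 1" using r by (intro mult_left_mono) auto
    moreover have "sq_density lam u u' w w' r = r * ((r / lam)\<^sup>2 - 1 + 1 / 2)\<^sup>2 + r / 4 + r + r"
      using r lam by (simp add: sq_density_def strain_def shift_def shift'_def u_def u'_def w_def w'_def power2_eq_square)
    ultimately show ?thesis using r by linarith
  qed
  moreover have "sq_density lam u u' w w' r = 0" if "lam \<le> r" for r
    using that by (simp add: sq_density_def strain_def shift_def shift'_def u_def u'_def w_def w'_def)
  ultimately have "indicator {0<..} r * sq_density lam u u' w w' r \<le> (4 * lam) * indicator {0<..<lam} r" for r
    by (cases "r < lam") (auto simp: indicator_def)
  hence "sq_energy lam u u' w w' \<le> (\<integral>\<^sup>+r. ennreal ((4 * lam) * indicator {0<..<lam} r) \<partial>lborel)"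
    unfolding sq_energy_def by (intro nn_integral_mono ennreal_leI) auto
  also have "\<dots> = ennreal (4 * lam) * (\<integral>\<^sup>+r. indicator {0<..<lam} r \<partial>lborel)"
    using lam by (subst nn_integral_cmult[symmetric]) (auto intro!: nn_integral_cong simp: ennreal_mult' indicator_def)
  also have "\<dots> < \<infinity>" using lam by (simp add: ennreal_mult_less_top)
  finally show thesis using that pu pw by blast
qed

subsection \<open>Existence of minimizers\<close>

text \<open>The part of the square density free of derivatives; pointwise convergence and Fatou
  handle it, while the two squares with derivatives need weak limits.\<close>

definition rest_density :: "real \<Rightarrow> (real \<Rightarrow> real) \<Rightarrow> (real \<Rightarrow> real) \<Rightarrow> real \<Rightarrow> real" where
  "rest_density lam u w r = (u r - shift lam r)\<^sup>2 / r + (if r < lam then lam\<^sup>2 * (w r)\<^sup>2 / r else 0)"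

lemma sq_density_decomp:
  "indicator {0<..} r * sq_density lam u u' w w' r =
     (scaled (strain lam u' w) r)\<^sup>2 + lam\<^sup>2 * (scaled w' r)\<^sup>2 + indicator {0<..} r * rest_density lam u w r"
  by (simp add: sq_density_def rest_density_def scaled_sq algebra_simps indicator_def)

lemma strain_measurable:
  assumes u: "primitive u u'" and w: "primitive w w'"
  shows "scaled (strain lam u' w) \<in> borel_measurable borel"
proof (rule scaled_measurable)
  show "(\<lambda>x. indicator {0<..} x * strain lam u' w x) \<in> borel_measurable borel"
    by (rule borel_measurable_pos_realI)
       (use strain_set_integrable(1)[OF u w] in \<open>auto simp: set_integrable_def set_borel_measurable_def\<close>)
qed

lemma rest_density_measurable:
  assumes u: "primitive u u'" and w: "primitive w w'"
  shows "(\<lambda>r. indicator {0<..} r * rest_density lam u w r) \<in> borel_measurable borel"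
proof -
  have [measurable]: "(\<lambda>r. indicator {0<..} r * sq_density lam u u' w w' r) \<in> borel_measurable borel"
    "scaled (strain lam u' w) \<in> borel_measurable borel" "scaled w' \<in> borel_measurable borel"
    using sq_density_measurable[OF u w] strain_measurable[OF u w] scaled_measurable[OF primitive_measurable(1)[OF w]] by auto
  have "(\<lambda>r. indicator {0<..} r * sq_density lam u u' w w' r - (scaled (strain lam u' w) r)\<^sup>2 - lam\<^sup>2 * (scaled w' r)\<^sup>2) \<in> borel_measurable borel"
    by measurable
  thus ?thesis by (simp add: sq_density_decomp)
qed

lemma rest_density_nonneg: "0 \<le> indicator {0<..} r * rest_density lam u w r"
  by (auto simp: rest_density_def indicator_def)

lemma finite_sq_energy_parts:
  assumes lam: "lam > 0" and u: "primitive u u'" and w: "primitive w w'"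
    and N: "sq_energy lam u u' w w' = ennreal N" "N \<ge> 0"
  shows "integrable lborel (\<lambda>r. (scaled (strain lam u' w) r)\<^sup>2)"
    "integrable lborel (\<lambda>r. (scaled w' r)\<^sup>2)"
    "integrable lborel (\<lambda>r. indicator {0<..} r * rest_density lam u w r)"
    "N = (LINT r|lborel. (scaled (strain lam u' w) r)\<^sup>2) + lam\<^sup>2 * (LINT r|lborel. (scaled w' r)\<^sup>2)
        + (LINT r|lborel. indicator {0<..} r * rest_density lam u w r)"
proof -
  define h where "h r = indicator {0<..} r * sq_density lam u u' w w' r" for r
  have h0: "h r \<ge> 0" for r by (auto simp: h_def indicator_def sq_density_nonneg)
  have hi: "integrable lborel h"
    using sq_energy_finite_integrable(1)[OF u w] N by (simp add: h_def[abs_def] set_integrable_def)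
  have [measurable]: "scaled (strain lam u' w) \<in> borel_measurable borel" "scaled w' \<in> borel_measurable borel"
    "(\<lambda>r. indicator {0<..} r * rest_density lam u w r) \<in> borel_measurable borel"
    using strain_measurable[OF u w] scaled_measurable[OF primitive_measurable(1)[OF w]] rest_density_measurable[OF u w] by auto
  have dec: "h r = (scaled (strain lam u' w) r)\<^sup>2 + lam\<^sup>2 * (scaled w' r)\<^sup>2 + indicator {0<..} r * rest_density lam u w r" for r
    unfolding h_def by (rule sq_density_decomp)
  have nn: "0 \<le> lam\<^sup>2 * (scaled w' r)\<^sup>2" for r by simp
  show 1: "integrable lborel (\<lambda>r. (scaled (strain lam u' w) r)\<^sup>2)"
    by (rule Bochner_Integration.integrable_bound[OF hi])
       (use dec nn rest_density_nonneg[of _ lam u w] in \<open>auto intro!: AE_I2\<close>)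
  have "integrable lborel (\<lambda>r. lam\<^sup>2 * (scaled w' r)\<^sup>2)"
    by (rule Bochner_Integration.integrable_bound[OF hi])
       (use dec nn rest_density_nonneg[of _ lam u w] in \<open>auto intro!: AE_I2\<close>)
  thus 2: "integrable lborel (\<lambda>r. (scaled w' r)\<^sup>2)" using lam by simp
  show 3: "integrable lborel (\<lambda>r. indicator {0<..} r * rest_density lam u w r)"
    by (rule Bochner_Integration.integrable_bound[OF hi])
       (use dec nn rest_density_nonneg[of _ lam u w] in \<open>auto intro!: AE_I2 simp: abs_of_nonneg\<close>)
  have "ennreal N = (\<integral>\<^sup>+r. ennreal (h r) \<partial>lborel)" using N(1) by (simp add: sq_energy_def h_def)
  also have "\<dots> = ennreal (LINT r|lborel. h r)" by (rule nn_integral_eq_integral[OF hi]) (simp add: h0)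
  finally have "N = (LINT r|lborel. h r)" using N(2) h0 by (simp add: integral_nonneg_AE)
  also have "\<dots> = (LINT r|lborel. (scaled (strain lam u' w) r)\<^sup>2) + lam\<^sup>2 * (LINT r|lborel. (scaled w' r)\<^sup>2)
        + (LINT r|lborel. indicator {0<..} r * rest_density lam u w r)"
    unfolding dec using 1 2 3 by simp
  finally show "N = (LINT r|lborel. (scaled (strain lam u' w) r)\<^sup>2) + lam\<^sup>2 * (LINT r|lborel. (scaled w' r)\<^sup>2)
        + (LINT r|lborel. indicator {0<..} r * rest_density lam u w r)" .
qed

text \<open>The term lam^2 w^2/r below \<open>lam\<close> yields a point \<open>s\<close> between
  lam/2 and \<open>lam\<close> where \<open>w\<close> is controlled, and the modulus of continuity
  carries this to \<open>lam\<close>.\<close>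

lemma w_boundary_bound:
  assumes lam: "lam > 0" and u: "primitive u u'" and w: "primitive w w'"
    and N: "sq_energy lam u u' w w' = ennreal N" "0 \<le> N" "N \<le> C"
  shows "\<bar>w lam\<bar> \<le> sqrt (2 * C / lam\<^sup>2) + sqrt (C / lam\<^sup>2)"
proof -
  note parts = finite_sq_energy_parts[OF lam u w N(1,2)]
  have X0: "0 \<le> (LINT r|lborel. (scaled (strain lam u' w) r)\<^sup>2)" "0 \<le> (LINT r|lborel. (scaled w' r)\<^sup>2)"
    "0 \<le> (LINT r|lborel. indicator {0<..} r * rest_density lam u w r)"
    by (auto intro!: integral_nonneg_AE rest_density_nonneg)
  have wN: "lam\<^sup>2 * (LINT r|lborel. (scaled w' r)\<^sup>2) \<le> C" using parts(4) X0 N by linarith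
  have wN0: "0 \<le> lam\<^sup>2 * (LINT r|lborel. (scaled w' r)\<^sup>2)" using X0 by simp
  have wC: "(LINT r|lborel. (scaled w' r)\<^sup>2) \<le> C / lam\<^sup>2"
    using wN lam by (subst pos_le_divide_eq) (auto simp: mult.commute)
  have l0: "0 < lam / 2" using lam by simp
  have c: "continuous_on {lam/2..lam} (\<lambda>r. (w r)\<^sup>2)"
    by (intro continuous_intros primitiveD(4)[OF w l0])
  obtain s where s: "s \<in> {lam/2..lam}" "\<And>r. r \<in> {lam/2..lam} \<Longrightarrow> (w s)\<^sup>2 \<le> (w r)\<^sup>2"
    using continuous_attains_inf[OF _ _ c] lam by auto
  have "(LINT r:{lam/2<..<lam}|lborel. lam * (w s)\<^sup>2) \<le> (LINT r|lborel. indicator {0<..} r * rest_density lam u w r)"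
    unfolding set_lebesgue_integral_def
  proof (rule integral_mono'[OF parts(3)])
    fix r
    show "indicator {lam/2<..<lam} r *\<^sub>R (lam * (w s)\<^sup>2) \<le> indicator {0<..} r * rest_density lam u w r"
    proof (cases "r \<in> {lam/2<..<lam}")
      case True
      hence r: "r > 0" "r < lam" using lam by auto
      have "lam * (w s)\<^sup>2 \<le> lam * (w r)\<^sup>2" using s(2)[of r] True lam by (intro mult_left_mono) auto
      also have "\<dots> = lam * (lam * (w r)\<^sup>2) / lam" using lam by simp
      also have "\<dots> \<le> lam * (lam * (w r)\<^sup>2) / r" by (rule divide_left_mono) (use r lam in auto)
      also have "\<dots> \<le> rest_density lam u w r" using r by (simp add: rest_density_def power2_eq_square mult.assoc)
      finally show ?thesis using True r by simp
    qed (use rest_density_nonneg in simp)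
  qed (rule rest_density_nonneg)
  also have "\<dots> \<le> C" using parts(4) X0 N wN0 by linarith
  also have "(LINT r:{lam/2<..<lam}|lborel. lam * (w s)\<^sup>2) = lam / 2 * (lam * (w s)\<^sup>2)"
    using lam by (simp add: set_lebesgue_integral_def)
  finally have "(w s)\<^sup>2 \<le> 2 * C / lam\<^sup>2" using lam by (simp add: field_simps power2_eq_square)
  hence 1: "\<bar>w s\<bar> \<le> sqrt (2 * C / lam\<^sup>2)" by (intro real_le_rsqrt) simp
  have "\<bar>w lam - w s\<bar> \<le> sqrt (C / lam\<^sup>2 * ((lam - s) / s))"
    by (rule hoelder_abs_bound[OF w parts(2) wC]) (use s lam in auto)
  also have "\<dots> \<le> sqrt (C / lam\<^sup>2)"
  proof (rule real_sqrt_le_mono)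
    have "(lam - s) / s \<le> 1" using s lam by (simp add: field_simps)
    thus "C / lam\<^sup>2 * ((lam - s) / s) \<le> C / lam\<^sup>2" using mult_left_mono[of "(lam - s) / s" 1 "C / lam\<^sup>2"] N by simp
  qed
  finally show ?thesis using 1 by linarith
qed

lemma signed_integral_tendsto:
  assumes conv: "\<And>t. t > 0 \<Longrightarrow> (\<lambda>n. g n t) \<longlonglongrightarrow> h t"
    and c: "0 < c" and x: "0 < x"
    and meas: "\<And>n a b. 0 < a \<Longrightarrow> set_borel_measurable lborel {a..b} (g n)"
      "\<And>a b. 0 < a \<Longrightarrow> set_borel_measurable lborel {a..b} h"
    and bd: "\<And>a b. 0 < a \<Longrightarrow> \<exists>B. \<forall>n. \<forall>t\<in>{a..b}. \<bar>g n t\<bar> \<le> B"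
  shows "(\<lambda>n. signed_integral c (g n) x) \<longlonglongrightarrow> signed_integral c h x"
proof -
  have *: "(\<lambda>n. LINT t:{a..b}|lborel. g n t) \<longlonglongrightarrow> (LINT t:{a..b}|lborel. h t)" if a: "0 < a" for a b
  proof -
    obtain B where B: "\<And>n t. t \<in> {a..b} \<Longrightarrow> \<bar>g n t\<bar> \<le> B" using bd[OF a] by metis
    show ?thesis
      unfolding set_lebesgue_integral_def
    proof (rule integral_dominated_convergence)
      show "integrable lborel (\<lambda>t. indicator {a..b} t *\<^sub>R B)"
        using set_integrable_continuous[of a b "\<lambda>t. B"] by (simp add: set_integrable_def)
      show "AE t in lborel. (\<lambda>n. indicator {a..b} t *\<^sub>R g n t) \<longlonglongrightarrow> indicator {a..b} t *\<^sub>R h t"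
      proof (rule AE_I2)
        fix t show "(\<lambda>n. indicator {a..b} t *\<^sub>R g n t) \<longlonglongrightarrow> indicator {a..b} t *\<^sub>R h t"
          by (cases "t \<in> {a..b}") (use conv[of t] a in auto)
      qed
      show "AE t in lborel. norm (indicator {a..b} t *\<^sub>R g n t) \<le> indicator {a..b} t *\<^sub>R B" for n
        using B by (auto simp: indicator_def)
    qed (use meas[OF a] in \<open>auto simp: set_borel_measurable_def\<close>)
  qed
  show ?thesis unfolding signed_integral_def by (intro tendsto_diff * c x)
qed

text \<open>The nonlinearity w^2 is hidden in \<open>F n\<close>, whose derivative is the strain
  itself. So \<open>w n\<close> and \<open>F n\<close> both have weighted square integrable
  derivatives with bounded norms, and the limit of \<open>u n\<close> is recovered by subtracting
  the limit of the integrals of \<open>V n\<close>.\<close>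

theorem sq_energy_minimizer:
  assumes lam: "lam > 0"
  obtains u u' w w' N where "primitive u u'" "primitive w w'" "sq_energy lam u u' w w' = ennreal N" "N \<ge> 0"
    "\<And>v v' y y' M. primitive v v' \<Longrightarrow> primitive y y' \<Longrightarrow> sq_energy lam v v' y y' = ennreal M \<Longrightarrow> M \<ge> 0 \<Longrightarrow>
       N + lam * u lam \<le> M + lam * v lam"
proof -
  define T where "T = {N + lam * u lam | u u' w w' N. primitive u u' \<and> primitive w w' \<and> sq_energy lam u u' w w' = ennreal N \<and> N \<ge> 0}"
  define m where "m = Inf T"
  have lower: "t \<ge> - 4 * lam\<^sup>2" if "t \<in> T" for t
    using that boundary_value_bound[OF lam] unfolding T_def by fastforce
  have bdd: "bdd_below T" by (rule bdd_belowI[OF lower])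
  have ne: "T \<noteq> {}"
  proof -
    obtain u u' w w' where p: "primitive u u'" "primitive w w'" and "sq_energy lam u u' w w' < \<infinity>"
      using finite_sq_energy_exists[OF lam] by blast
    from this(3) obtain N where N: "sq_energy lam u u' w w' = ennreal N" "N \<ge> 0"
      by (cases "sq_energy lam u u' w w'") auto
    hence "N + lam * u lam \<in> T" unfolding T_def using p by blast
    thus ?thesis by blast
  qed
  have "\<exists>t\<in>T. t < m + 1 / real (Suc n)" for n
    using cInf_lessD[OF ne, of "m + 1 / real (Suc n)"] by (auto simp: m_def)
  hence "\<exists>u u' w w' N. primitive u u' \<and> primitive w w' \<and> sq_energy lam u u' w w' = ennreal N \<and> N \<ge> 0 \<and> N + lam * u lam < m + 1 / real (Suc n)" for n
    unfolding T_def by blast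
  then obtain u u' w w' N where seq: "\<And>n. primitive (u n) (u' n)" "\<And>n. primitive (w n) (w' n)"
    "\<And>n. sq_energy lam (u n) (u' n) (w n) (w' n) = ennreal (N n)" "\<And>n::nat. N n \<ge> 0"
    "\<And>n. N n + lam * u n lam < m + 1 / real (Suc n)"
    by metis
  have seq5: "N n + lam * u n lam < m + 1" for n by (rule less_le_trans[OF seq(5)]) simp
  have mle: "m \<le> N n + lam * u n lam" for n
    unfolding m_def by (rule cInf_lower[OF _ bdd]) (use seq in \<open>unfold T_def, blast\<close>)
  \<comment> \<open>From N/2 - 4 lam^2 \<le> N + lam u(lam) < m + 1.\<close>
  define C where "C = 2 * (m + 1 + 4 * lam\<^sup>2)"
  have NC: "N n \<le> C" for n
  proof -
    have "- N n / 2 - 4 * lam\<^sup>2 \<le> lam * u n lam" by (rule boundary_value_bound[OF lam seq(1,2,3,4)])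
    hence "N n + (- N n / 2 - 4 * lam\<^sup>2) < m + 1" using seq5[of n] by (rule_tac le_less_trans) auto
    thus ?thesis by (simp add: C_def field_simps)
  qed
  have C0: "C \<ge> 0" using NC[of 0] seq(4)[of 0] by simp
  define X where "X n = strain lam (u' n) (w n)" for n
  define a where "a n = (LINT r|lborel. (scaled (X n) r)\<^sup>2)" for n
  define b where "b n = (LINT r|lborel. (scaled (w' n) r)\<^sup>2)" for n
  define d where "d n = (LINT r|lborel. indicator {0<..} r * rest_density lam (u n) (w n) r)" for n
  note parts = finite_sq_energy_parts[OF lam seq(1,2,3,4), folded X_def]
  have ab0: "a n \<ge> 0" "b n \<ge> 0" "d n \<ge> 0" for n
    unfolding a_def b_def d_def by (auto intro!: integral_nonneg_AE rest_density_nonneg)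
  have sumN: "N n = a n + lam\<^sup>2 * b n + d n" for n using parts(4)[of n] by (simp add: a_def b_def d_def)
  have aC: "a n \<le> C" for n using sumN[of n] ab0[of n] NC[of n] mult_nonneg_nonneg[OF zero_le_power2[of lam] ab0(2)[of n]] by linarith
  have bC: "b n \<le> C / lam\<^sup>2" for n
  proof -
    have "lam\<^sup>2 * b n \<le> C" using sumN[of n] ab0[of n] NC[of n] by linarith
    thus ?thesis using lam by (subst pos_le_divide_eq) (auto simp: mult.commute)
  qed
  define V where "V n r = (w n r)\<^sup>2 - 1 + shift' lam r" for n r
  have Vint: "set_integrable lborel {x..y} (\<lambda>r. (v r)\<^sup>2 - 1 + shift' lam r)"
    "set_integrable lborel {x..y} (\<lambda>r. ((v r)\<^sup>2 - 1 + shift' lam r)\<^sup>2)" if v: "primitive v v'" and x: "0 < x" for v v' x y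
  proof -
    have "primitive (\<lambda>r. 0) (\<lambda>r. 0)" by (rule primitive_continuous) auto
    from strain_set_integrable[OF this v x] show "set_integrable lborel {x..y} (\<lambda>r. (v r)\<^sup>2 - 1 + shift' lam r)"
      "set_integrable lborel {x..y} (\<lambda>r. ((v r)\<^sup>2 - 1 + shift' lam r)\<^sup>2)" by (auto simp: strain_def[abs_def])
  qed
  have Vp: "primitive (signed_integral lam (V n)) (V n)" for n
    unfolding V_def[abs_def] by (rule primitive_signed_integral[OF lam]) (use Vint[OF seq(2)[of n]] in auto)
  \<comment> \<open>The added integral starts at \<open>lam\<close>, so
    \<open>F n lam = u n lam\<close> and the bound on the boundary value anchors the
    sequence.\<close>
  define F where "F n r = u n r + signed_integral lam (V n) r" for n r
  have Fp: "primitive (F n) (X n)" for n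
    using primitive_add[OF seq(1)[of n] Vp[of n]] unfolding F_def[abs_def]
    by (rule primitive_cong) (auto simp: X_def strain_def V_def)
  have s0: "signed_integral lam g lam = 0" for g
    by (simp add: signed_integral_def)
  define B where "B = (\<bar>m\<bar> + 1 + C / 2 + 4 * lam\<^sup>2) / lam"
  have Fb: "\<bar>F n lam\<bar> \<le> B" for n
  proof -
    have "lam * u n lam \<le> m + 1" using seq(4)[of n] seq5[of n] by linarith
    moreover have "lam * u n lam \<ge> - (C / 2) - 4 * lam\<^sup>2" using boundary_value_bound[OF lam seq(1,2,3,4), of n] NC[of n] by linarith
    ultimately have "\<bar>lam * u n lam\<bar> \<le> \<bar>m\<bar> + 1 + C / 2 + 4 * lam\<^sup>2" using C0 zero_le_power2[of lam] by linarith
    hence "lam * \<bar>u n lam\<bar> \<le> \<bar>m\<bar> + 1 + C / 2 + 4 * lam\<^sup>2" using lam by (simp add: abs_mult)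
    thus ?thesis unfolding B_def F_def s0 using lam by (simp add: field_simps)
  qed
  define B2 where "B2 = sqrt (2 * C / lam\<^sup>2) + sqrt (C / lam\<^sup>2)"
  have wb: "\<bar>w n lam\<bar> \<le> B2" for n unfolding B2_def by (rule w_boundary_bound[OF lam seq(1,2,3,4) NC])
  \<comment> \<open>Weak limits are taken with convergent norms, so \<open>a\<close> and
    \<open>b\<close> are made to converge before the pointwise subsequences are extracted.\<close>
  have "bounded (range (\<lambda>n. (a n, b n)))"
  proof (rule bounded_subset)
    show "bounded ({0..C} \<times> {0..C / lam\<^sup>2})" by (intro bounded_Times bounded_closed_interval)
    show "range (\<lambda>n. (a n, b n)) \<subseteq> {0..C} \<times> {0..C / lam\<^sup>2}" using ab0 aC bC by auto
  qed
  then obtain l r1 where r1: "strict_mono (r1 :: nat \<Rightarrow> nat)" "((\<lambda>n. (a n, b n)) \<circ> r1) \<longlonglongrightarrow> l"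
    using bounded_imp_convergent_subsequence by blast
  define A where "A = fst l"
  define Bl where "Bl = snd l"
  have ar1: "(\<lambda>n. a (r1 n)) \<longlonglongrightarrow> A" and br1: "(\<lambda>n. b (r1 n)) \<longlonglongrightarrow> Bl"
    using tendsto_fst[OF r1(2)] tendsto_snd[OF r1(2)] by (auto simp: o_def A_def Bl_def)
  obtain r2 W where r2: "strict_mono (r2 :: nat \<Rightarrow> nat)" "\<And>x. x > 0 \<Longrightarrow> (\<lambda>n. w (r1 (r2 n)) x) \<longlonglongrightarrow> W x"
    using pointwise_convergent_subsequence[of "\<lambda>n. w (r1 n)" "\<lambda>n. w' (r1 n)" "C / lam\<^sup>2" lam B2]
      seq(2) parts(2) bC[unfolded b_def] lam wb by metis
  obtain r3 Fl where r3: "strict_mono (r3 :: nat \<Rightarrow> nat)" "\<And>x. x > 0 \<Longrightarrow> (\<lambda>n. F (r1 (r2 (r3 n))) x) \<longlonglongrightarrow> Fl x"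
    using pointwise_convergent_subsequence[of "\<lambda>n. F (r1 (r2 n))" "\<lambda>n. X (r1 (r2 n))" C lam B]
      Fp parts(1) aC[unfolded a_def] lam Fb by metis
  define r where "r n = r1 (r2 (r3 n))" for n
  have rm: "strict_mono r" using r1(1) r2(1) r3(1) by (simp add: strict_mono_def r_def)
  have wlim: "(\<lambda>n. w (r n) x) \<longlonglongrightarrow> W x" if "x > 0" for x
    using LIMSEQ_subseq_LIMSEQ[OF r2(2)[OF that] r3(1)] by (simp add: o_def r_def)
  have Flim: "(\<lambda>n. F (r n) x) \<longlonglongrightarrow> Fl x" if "x > 0" for x using r3(2)[OF that] by (simp add: r_def)
  have r23: "strict_mono (r2 \<circ> r3)" using r2(1) r3(1) by (rule strict_mono_o)
  have alim: "(\<lambda>n. a (r n)) \<longlonglongrightarrow> A" and blim: "(\<lambda>n. b (r n)) \<longlonglongrightarrow> Bl"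
    using LIMSEQ_subseq_LIMSEQ[OF ar1 r23] LIMSEQ_subseq_LIMSEQ[OF br1 r23] by (auto simp: o_def r_def)
  obtain W' where W': "primitive W W'" "integrable lborel (\<lambda>r. (scaled W' r)\<^sup>2)" "(LINT r|lborel. (scaled W' r)\<^sup>2) \<le> Bl"
    using weak_limit_primitive[of "\<lambda>n. w (r n)" "\<lambda>n. w' (r n)" Bl W] seq(2) parts(2) blim[unfolded b_def] wlim by metis
  obtain Xl where Xl: "primitive Fl Xl" "integrable lborel (\<lambda>r. (scaled Xl r)\<^sup>2)" "(LINT r|lborel. (scaled Xl r)\<^sup>2) \<le> A"
    using weak_limit_primitive[of "\<lambda>n. F (r n)" "\<lambda>n. X (r n)" A Fl] Fp parts(1) alim[unfolded a_def] Flim by metis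
  define Vl where "Vl t = (W t)\<^sup>2 - 1 + shift' lam t" for t
  define U where "U t = Fl t - signed_integral lam Vl t" for t
  define U' where "U' t = Xl t - Vl t" for t
  have "primitive (signed_integral lam Vl) Vl"
    unfolding Vl_def[abs_def] by (rule primitive_signed_integral[OF lam]) (use Vint[OF W'(1)] in auto)
  hence Up: "primitive U U'" unfolding U_def[abs_def] U'_def[abs_def] by (rule primitive_diff[OF Xl(1)])
  have strain: "strain lam U' W = Xl" by (auto simp: strain_def U'_def Vl_def)
  have ulim: "(\<lambda>n. u (r n) x) \<longlonglongrightarrow> U x" if x: "x > 0" for x
  proof -
    have "(\<lambda>n. signed_integral lam (V (r n)) x) \<longlonglongrightarrow> signed_integral lam Vl x"
    proof (rule signed_integral_tendsto[OF _ lam x])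
      show "(\<lambda>n. V (r n) t) \<longlonglongrightarrow> Vl t" if "t > 0" for t
        unfolding V_def Vl_def by (intro tendsto_intros wlim that)
      show "set_borel_measurable lborel {s..y} (V (r n))" if "0 < s" for n s y
        using Vint(1)[OF seq(2)[of "r n"] that, of y] by (auto simp: V_def[abs_def] set_integrable_def set_borel_measurable_def)
      show "set_borel_measurable lborel {s..y} Vl" if "0 < s" for s y
        using Vint(1)[OF W'(1) that, of y] by (auto simp: Vl_def[abs_def] set_integrable_def set_borel_measurable_def)
      fix s y :: real assume s: "0 < s"
      \<comment> \<open>A bound for all \<open>w n\<close> between \<open>s\<close> and
        \<open>y\<close>, valid on either side of \<open>lam\<close>: distances to
        \<open>lam\<close> are at most \<bar>y\<bar> + lam and left endpoints at least
        \<open>min s lam\<close>. It provides the dominating constant.\<close>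
      define D where "D = B2 + sqrt (C / lam\<^sup>2 * ((\<bar>y\<bar> + lam) / min s lam))"
      have wD: "\<bar>w n t\<bar> \<le> D" if t: "t \<in> {s..y}" for n t
      proof -
        have mono: "sqrt (C / lam\<^sup>2 * (p / q)) \<le> sqrt (C / lam\<^sup>2 * ((\<bar>y\<bar> + lam) / min s lam))"
          if "0 \<le> p" "p \<le> \<bar>y\<bar> + lam" "min s lam \<le> q" for p q
          using that s lam C0 by (intro real_sqrt_le_mono mult_left_mono frac_le) auto
        have "\<bar>w n t - w n lam\<bar> \<le> sqrt (C / lam\<^sup>2 * ((\<bar>y\<bar> + lam) / min s lam))"
        proof (cases "t \<le> lam")
          case True
          have "\<bar>w n lam - w n t\<bar> \<le> sqrt (C / lam\<^sup>2 * ((lam - t) / t))"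
            by (rule hoelder_abs_bound[OF seq(2) parts(2) bC[unfolded b_def]]) (use t s True in auto)
          also have "\<dots> \<le> sqrt (C / lam\<^sup>2 * ((\<bar>y\<bar> + lam) / min s lam))" by (rule mono) (use True t s in auto)
          finally show ?thesis by (simp add: abs_minus_commute)
        next
          case False
          have "\<bar>w n t - w n lam\<bar> \<le> sqrt (C / lam\<^sup>2 * ((t - lam) / lam))"
            by (rule hoelder_abs_bound[OF seq(2) parts(2) bC[unfolded b_def]]) (use False lam in auto)
          also have "\<dots> \<le> sqrt (C / lam\<^sup>2 * ((\<bar>y\<bar> + lam) / min s lam))" by (rule mono) (use False t lam in auto)
          finally show ?thesis .
        qed
        thus ?thesis using wb[of n] unfolding D_def by linarith
      qed
      have "\<bar>V (r n) t\<bar> \<le> D\<^sup>2 + 1 + lam\<^sup>2 / (2 * s\<^sup>2)" if t: "t \<in> {s..y}" for n t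
      proof -
        have "(w (r n) t)\<^sup>2 \<le> D\<^sup>2" using wD[OF t, of "r n"] by (intro abs_le_square_iff[THEN iffD1]) simp
        moreover have "0 \<le> shift' lam t" "shift' lam t \<le> lam\<^sup>2 / (2 * s\<^sup>2)"
          using t s by (auto simp: shift'_def intro!: divide_left_mono mult_mono power_mono)
        ultimately show ?thesis unfolding V_def using zero_le_power2[of "w (r n) t"] by linarith
      qed
      thus "\<exists>B. \<forall>n. \<forall>t\<in>{s..y}. \<bar>V (r n) t\<bar> \<le> B" by blast
    qed
    from tendsto_diff[OF Flim[OF x] this] show ?thesis by (simp add: F_def U_def)
  qed
  \<comment> \<open>The limit of the derivative-free parts, determined by the other limits because
    the total converges to \<open>m\<close>. The three lower bounds then add up to exactly
    \<open>m - lam * U lam\<close>.\<close>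
  define D where "D = m - lam * U lam - A - lam\<^sup>2 * Bl"
  have Nlim: "(\<lambda>n. N (r n)) \<longlonglongrightarrow> m - lam * U lam"
  proof -
    have "(\<lambda>n. N n + lam * u n lam) \<longlonglongrightarrow> m"
    proof (rule tendsto_sandwich[where f = "\<lambda>_. m" and h = "\<lambda>n. m + 1 / real (Suc n)"])
      show "(\<lambda>n. m + 1 / real (Suc n)) \<longlonglongrightarrow> m"
        using tendsto_add[OF tendsto_const LIMSEQ_inverse_real_of_nat, of m] by (simp add: inverse_eq_divide)
      show "\<forall>\<^sub>F n in sequentially. N n + lam * u n lam \<le> m + 1 / real (Suc n)" using seq(5) by (simp add: less_imp_le)
      show "\<forall>\<^sub>F n in sequentially. m \<le> N n + lam * u n lam" using mle by simp
    qed simp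
    from LIMSEQ_subseq_LIMSEQ[OF this rm] have "(\<lambda>n. N (r n) + lam * u (r n) lam) \<longlonglongrightarrow> m" by (simp add: o_def)
    from tendsto_diff[OF this tendsto_mult[OF tendsto_const ulim[OF lam], of lam]] show ?thesis by simp
  qed
  have dlim: "(\<lambda>n. d (r n)) \<longlonglongrightarrow> D"
  proof -
    have "(\<lambda>n. N (r n) - a (r n) - lam\<^sup>2 * b (r n)) \<longlonglongrightarrow> m - lam * U lam - A - lam\<^sup>2 * Bl"
      by (intro tendsto_intros Nlim alim blim)
    thus ?thesis by (simp add: sumN D_def)
  qed
  have D0: "D \<ge> 0" by (rule LIMSEQ_le_const[OF dlim]) (use ab0 in auto)
  have A0: "A \<ge> 0" by (rule LIMSEQ_le_const[OF alim]) (use ab0 in auto)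
  have Bl0: "Bl \<ge> 0" by (rule LIMSEQ_le_const[OF blim]) (use ab0 in auto)
  have restle: "(\<integral>\<^sup>+t. ennreal (indicator {0<..} t * rest_density lam U W t) \<partial>lborel) \<le> ennreal D"
  proof (rule nn_integral_fatou_bound[where f = "\<lambda>n t. indicator {0<..} t * rest_density lam (u (r n)) (w (r n)) t"])
    show "(\<lambda>t. indicator {0<..} t * rest_density lam (u (r n)) (w (r n)) t) \<in> borel_measurable lborel" for n
      using rest_density_measurable[OF seq(1,2), of lam "r n" "r n"] by simp
    show "AE t in lborel. (\<lambda>n. indicator {0<..} t * rest_density lam (u (r n)) (w (r n)) t) \<longlonglongrightarrow> indicator {0<..} t * rest_density lam U W t"
    proof (rule AE_I2)
      fix t :: real
      show "(\<lambda>n. indicator {0<..} t * rest_density lam (u (r n)) (w (r n)) t) \<longlonglongrightarrow> indicator {0<..} t * rest_density lam U W t"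
      proof (cases "t > 0")
        case True
        hence t0: "t \<noteq> 0" by simp
        have "(\<lambda>n. rest_density lam (u (r n)) (w (r n)) t) \<longlonglongrightarrow> rest_density lam U W t"
          unfolding rest_density_def by (cases "t < lam") (auto intro!: tendsto_intros ulim wlim simp: True t0)
        thus ?thesis by (intro tendsto_intros)
      qed simp
    qed
    fix e :: real assume "e > 0"
    hence "eventually (\<lambda>n. d (r n) < D + e) sequentially" by (intro order_tendstoD(2)[OF dlim]) simp
    thus "\<forall>\<^sub>F n in sequentially. (\<integral>\<^sup>+ t. ennreal (indicator {0<..} t * rest_density lam (u (r n)) (w (r n)) t) \<partial>lborel) \<le> ennreal (D + e)"
    proof eventually_elim
      case (elim n)
      thus ?case
        using nn_integral_eq_integral[OF parts(3)[of "r n"]] rest_density_nonneg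
        by (simp add: d_def ennreal_leI)
    qed
  qed
  have "sq_energy lam U U' W W' = (\<integral>\<^sup>+t. ennreal ((scaled Xl t)\<^sup>2) + ennreal (lam\<^sup>2 * (scaled W' t)\<^sup>2) + ennreal (indicator {0<..} t * rest_density lam U W t) \<partial>lborel)"
    unfolding sq_energy_def sq_density_decomp strain
    by (intro nn_integral_cong) (simp add: ennreal_plus rest_density_nonneg)
  also have "\<dots> = (\<integral>\<^sup>+t. ennreal ((scaled Xl t)\<^sup>2) \<partial>lborel) + (\<integral>\<^sup>+t. ennreal (lam\<^sup>2 * (scaled W' t)\<^sup>2) \<partial>lborel)
      + (\<integral>\<^sup>+t. ennreal (indicator {0<..} t * rest_density lam U W t) \<partial>lborel)"
  proof -
    have [measurable]: "scaled Xl \<in> borel_measurable borel" "scaled W' \<in> borel_measurable borel"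
      "(\<lambda>t. indicator {0<..} t * rest_density lam U W t) \<in> borel_measurable borel"
      using scaled_measurable[OF primitive_measurable(1)[OF Xl(1)]] scaled_measurable[OF primitive_measurable(1)[OF W'(1)]]
        rest_density_measurable[OF Up W'(1)] by auto
    show ?thesis by (simp add: nn_integral_add)
  qed
  also have "\<dots> \<le> ennreal A + ennreal (lam\<^sup>2 * Bl) + ennreal D"
  proof (intro add_mono restle)
    show "(\<integral>\<^sup>+t. ennreal ((scaled Xl t)\<^sup>2) \<partial>lborel) \<le> ennreal A"
      using nn_integral_eq_integral[OF Xl(2)] Xl(3) by (simp add: ennreal_leI)
    have "integrable lborel (\<lambda>t. lam\<^sup>2 * (scaled W' t)\<^sup>2)" using W'(2) by simp
    from nn_integral_eq_integral[OF this] show "(\<integral>\<^sup>+t. ennreal (lam\<^sup>2 * (scaled W' t)\<^sup>2) \<partial>lborel) \<le> ennreal (lam\<^sup>2 * Bl)"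
      using W'(3) by (simp add: ennreal_leI mult_left_mono)
  qed
  also have "\<dots> = ennreal (m - lam * U lam)"
    using A0 Bl0 D0 by (simp add: ennreal_plus[symmetric] D_def del: ennreal_plus)
  finally have le: "sq_energy lam U U' W W' \<le> ennreal (m - lam * U lam)" .
  hence "sq_energy lam U U' W W' < \<infinity>" using ennreal_less_top le_less_trans by (metis infinity_ennreal_def)
  then obtain Nl where Nl: "sq_energy lam U U' W W' = ennreal Nl" "Nl \<ge> 0" by (cases "sq_energy lam U U' W W'") auto
  have "m - lam * U lam \<ge> 0" using A0 Bl0 D0 by (simp add: D_def) (smt (verit) mult_nonneg_nonneg zero_le_power2)
  hence Nle: "Nl + lam * U lam \<le> m" using le Nl by simp
  show thesis
  proof (rule that[OF Up W'(1) Nl])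
    fix v v' y y' M
    assume *: "primitive v v'" "primitive y y'" "sq_energy lam v v' y y' = ennreal M" "0 \<le> M"
    have "m \<le> M + lam * v lam"
      unfolding m_def by (rule cInf_lower[OF _ bdd]) (use * in \<open>unfold T_def, blast\<close>)
    thus "Nl + lam * U lam \<le> M + lam * v lam" using Nle by simp
  qed
qed

text \<open>Passing to |w| does not raise the square energy and leaves the boundary value
  \<open>u lam\<close> unchanged, so the new pair is still a minimizer.\<close>

lemma minimizer_exists:
  assumes lam: "lam > 0" and \<psi>: "cutoff \<psi>"
  shows "\<exists>u w. is_minimizer lam \<psi> u w \<and> (\<forall>r>0. w r \<ge> 0) \<and> energy lam \<psi> u w < \<infinity>"
proof -
  obtain u u' w w' N where m: "primitive u u'" "primitive w w'" "sq_energy lam u u' w w' = ennreal N" "N \<ge> 0"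
    and min: "\<And>v v' y y' M. primitive v v' \<Longrightarrow> primitive y y' \<Longrightarrow> sq_energy lam v v' y y' = ennreal M \<Longrightarrow> M \<ge> 0 \<Longrightarrow>
       N + lam * u lam \<le> M + lam * v lam"
    using sq_energy_minimizer[OF lam] by metis
  define y where "y r = \<bar>w r\<bar>" for r
  define y' where "y' r = sgn (w r) * w' r" for r
  have yp: "primitive y y'" unfolding y_def[abs_def] y'_def[abs_def] by (rule primitive_abs[OF m(2)])
  have le: "sq_energy lam u u' y y' \<le> ennreal N"
    using sq_energy_abs_le[of lam u u' w w'] m(3) by (simp add: y_def[abs_def] y'_def[abs_def])
  hence fin: "sq_energy lam u u' y y' < \<infinity>" using ennreal_less_top le_less_trans by (metis infinity_ennreal_def)
  then obtain M where M: "sq_energy lam u u' y y' = ennreal M" "M \<ge> 0" by (cases "sq_energy lam u u' y y'") auto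
  have MN: "M \<le> N" using le M m(4) by simp
  have adm: "(u, y) \<in> admissible lam" by (rule finite_sq_energy_admissible[OF lam m(1) yp fin])
  have E: "energy lam \<psi> u y = ereal (M + lam * u lam - counterterm lam \<psi>)"
    using energy_eq[OF lam \<psi> adm] sq_energy_weak_deriv[OF m(1) yp, of lam] M by simp
  have "energy lam \<psi> u y \<le> energy lam \<psi> v z" if vz: "(v, z) \<in> admissible lam" for v z
  proof -
    have p: "primitive v (weak_deriv v)" "primitive z (weak_deriv z)"
      using admissible_W12[OF vz] W12_loc_primitive by auto
    show ?thesis
    proof (cases "sq_energy lam v (weak_deriv v) z (weak_deriv z) = \<infinity>")
      case True
      thus ?thesis using energy_eq[OF lam \<psi> vz] by simp
    next
      case False
      then obtain K where K: "sq_energy lam v (weak_deriv v) z (weak_deriv z) = ennreal K" "K \<ge> 0"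
        by (cases "sq_energy lam v (weak_deriv v) z (weak_deriv z)") auto
      have "N + lam * u lam \<le> K + lam * v lam" by (rule min[OF p K])
      thus ?thesis unfolding E using energy_eq[OF lam \<psi> vz] K MN by simp
    qed
  qed
  hence "is_minimizer lam \<psi> u y" using adm by (auto simp: is_minimizer_def)
  thus ?thesis using E by (intro exI[of _ u] exI[of _ y]) (auto simp: y_def)
qed

subsection \<open>Euler-Lagrange equations\<close>

text \<open>Minimality freed from limits and from the choice of weak derivatives;
  \<open>counterterm\<close>, a constant, drops out.\<close>

definition sq_minimal :: "real \<Rightarrow> (real \<Rightarrow> real) \<Rightarrow> (real \<Rightarrow> real) \<Rightarrow> (real \<Rightarrow> real) \<Rightarrow> (real \<Rightarrow> real) \<Rightarrow> real \<Rightarrow> bool" where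
  "sq_minimal lam u u' w w' N \<longleftrightarrow> primitive u u' \<and> primitive w w' \<and> sq_energy lam u u' w w' = ennreal N \<and> N \<ge> 0 \<and>
     (\<forall>v v' y y' M. primitive v v' \<longrightarrow> primitive y y' \<longrightarrow> sq_energy lam v v' y y' = ennreal M \<longrightarrow> M \<ge> 0 \<longrightarrow>
       N + lam * u lam \<le> M + lam * v lam)"

text \<open>A change supported beyond \<open>lam\<close> keeps \<open>u lam\<close>, so the boundary
  terms cancel and only the densities on a compact interval are compared.\<close>

lemma local_variation:
  assumes min: "sq_minimal lam u u' w w' N" and lam: "0 < lam" "lam < a"
    and v: "primitive v v'" and y: "primitive y y'"
    and out: "\<And>r. r > 0 \<Longrightarrow> r \<notin> {a..b} \<Longrightarrow> v r = u r \<and> v' r = u' r \<and> y r = w r \<and> y' r = w' r"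
  shows "0 \<le> (LINT r:{a..b}|lborel. sq_density lam v v' y y' r - sq_density lam u u' w w' r)"
proof -
  define h where "h = sq_density lam u u' w w'"
  define k where "k = sq_density lam v v' y y'"
  have u: "primitive u u'" and w: "primitive w w'" and N: "sq_energy lam u u' w w' = ennreal N" "N \<ge> 0"
    using min by (auto simp: sq_minimal_def)
  have hi: "set_integrable lborel {0<..} h" "ennreal N = ennreal (LINT r:{0<..}|lborel. h r)"
    using sq_energy_finite_integrable[OF u w] N by (auto simp: h_def)
  have h0: "r > 0 \<Longrightarrow> h r \<ge> 0" and k0: "r > 0 \<Longrightarrow> k r \<ge> 0" for r by (auto simp: h_def k_def sq_density_nonneg)
  have "0 \<le> (LINT r:{0<..}|lborel. h r)"
    unfolding set_lebesgue_integral_def using h0 by (auto intro!: integral_nonneg_AE simp: indicator_def)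
  hence NI: "N = (LINT r:{0<..}|lborel. h r)" using hi(2) N(2) by simp
  have a0: "a > 0" using lam by simp
  have di: "set_integrable lborel {a..b} (\<lambda>r. k r - h r)"
    unfolding h_def k_def by (intro set_integral_diff(1) sq_density_set_integrable u w v y a0)
  have e: "indicator {0<..} r *\<^sub>R k r = indicator {0<..} r *\<^sub>R h r + indicator {a..b} r *\<^sub>R (k r - h r)" for r
  proof (cases "r \<in> {a..b}")
    case True thus ?thesis using a0 by (simp add: indicator_def)
  next
    case False
    have "k r = h r" if "r > 0" using out[OF that False] by (simp add: h_def k_def sq_density_def strain_def)
    thus ?thesis using False by (simp add: indicator_def)
  qed
  have ki: "integrable lborel (\<lambda>r. indicator {0<..} r *\<^sub>R k r)"
    unfolding e using hi(1) di by (simp add: set_integrable_def)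
  define M where "M = (LINT r|lborel. indicator {0<..} r *\<^sub>R k r)"
  have M: "M = N + (LINT r:{a..b}|lborel. k r - h r)"
    unfolding M_def e NI set_lebesgue_integral_def
    by (rule Bochner_Integration.integral_add) (use hi(1) di in \<open>auto simp: set_integrable_def\<close>)
  have M0: "M \<ge> 0" unfolding M_def using k0 by (auto intro!: integral_nonneg_AE simp: indicator_def)
  have "sq_energy lam v v' y y' = ennreal M"
    unfolding sq_energy_def M_def k_def[symmetric] using nn_integral_eq_integral[OF ki] k0
    by (auto simp: indicator_def)
  hence "N + lam * u lam \<le> M + lam * v lam" using min v y M0 unfolding sq_minimal_def by blast
  moreover have "v lam = u lam" using out[of lam] lam by simp
  ultimately show ?thesis using M by (simp add: h_def k_def)
qed

text \<open>Degree 4 is what a variation of \<open>w\<close> produces, since w^2 occurs inside a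
  square. The polynomial has a minimum at 0, so its derivative there vanishes.\<close>

lemma variation_coeff_zero:
  fixes c1 :: real
  assumes "\<And>t. 0 \<le> t * c1 + t\<^sup>2 * c2 + t ^ 3 * c3 + t ^ 4 * c4"
  shows "c1 = 0"
proof -
  have "((\<lambda>t. t * c1 + t\<^sup>2 * c2 + t ^ 3 * c3 + t ^ 4 * c4) has_real_derivative c1) (at 0)"
    by (auto intro!: derivative_eq_intros)
  thus ?thesis by (rule DERIV_local_min[of _ _ _ 1]) (use assms in auto)
qed

section \<open>From weak equations to classical ones\<close>

lemma set_integrable_L2_mult:
  fixes f g :: "real \<Rightarrow> real"
  assumes "set_integrable M A f" "set_integrable M A (\<lambda>x. (f x)\<^sup>2)" "set_integrable M A g" "set_integrable M A (\<lambda>x. (g x)\<^sup>2)"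
  shows "set_integrable M A (\<lambda>x. f x * g x)"
proof -
  have "set_integrable M A (\<lambda>x. (1/2) * ((f x + g x)\<^sup>2 - (f x)\<^sup>2 - (g x)\<^sup>2))"
    by (intro set_integrable_mult_right set_integral_diff(1) set_integrable_sq_add assms)
  also have "(\<lambda>x. (1/2) * ((f x + g x)\<^sup>2 - (f x)\<^sup>2 - (g x)\<^sup>2)) = (\<lambda>x. f x * g x)"
    by (auto simp: power2_sum)
  finally show ?thesis .
qed

definition loc_L2 :: "(real \<Rightarrow> real) \<Rightarrow> bool" where
  "loc_L2 g \<longleftrightarrow> (\<forall>a b. 0 < a \<longrightarrow> set_integrable lborel {a..b} g \<and> set_integrable lborel {a..b} (\<lambda>t. (g t)\<^sup>2))"

lemma loc_L2D: "loc_L2 g \<Longrightarrow> 0 < a \<Longrightarrow> set_integrable lborel {a..b} g"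
  "loc_L2 g \<Longrightarrow> 0 < a \<Longrightarrow> set_integrable lborel {a..b} (\<lambda>t. (g t)\<^sup>2)"
  by (auto simp: loc_L2_def)

lemma loc_L2_primitive: "primitive f g \<Longrightarrow> loc_L2 g"
  by (auto simp: loc_L2_def dest: primitiveD)

lemma loc_L2_continuous:
  assumes "continuous_on {0<..} g"
  shows "loc_L2 g"
  unfolding loc_L2_def
proof (intro allI impI conjI)
  fix a b :: real assume "0 < a"
  hence c: "continuous_on {a..b} g" by (intro continuous_on_subset[OF assms]) auto
  show "set_integrable lborel {a..b} g" "set_integrable lborel {a..b} (\<lambda>t. (g t)\<^sup>2)"
    by (intro set_integrable_continuous continuous_intros c)+
qed

lemma loc_L2_diff: "loc_L2 f \<Longrightarrow> loc_L2 g \<Longrightarrow> loc_L2 (\<lambda>t. f t - g t)"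
  unfolding loc_L2_def by (auto intro: set_integral_diff(1) set_integrable_sq_diff)

lemma loc_L2_cont_mult:
  assumes c: "continuous_on {0<..} h" and g: "loc_L2 g"
  shows "loc_L2 (\<lambda>t. h t * g t)"
  unfolding loc_L2_def
proof (intro allI impI conjI)
  fix a b :: real assume a: "0 < a"
  have h: "continuous_on {a..b} h" by (rule continuous_on_subset[OF c]) (use a in auto)
  show "set_integrable lborel {a..b} (\<lambda>t. h t * g t)" by (rule set_integrable_cont_mult[OF h loc_L2D(1)[OF g a]])
  have "set_integrable lborel {a..b} (\<lambda>t. (h t)\<^sup>2 * (g t)\<^sup>2)"
    by (rule set_integrable_cont_mult[OF _ loc_L2D(2)[OF g a]]) (intro continuous_intros h)
  thus "set_integrable lborel {a..b} (\<lambda>t. (h t * g t)\<^sup>2)" by (simp add: power_mult_distrib)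
qed

lemma primitive_signed_integral':
  "0 < c \<Longrightarrow> loc_L2 g \<Longrightarrow> primitive (signed_integral c g) g"
  by (rule primitive_signed_integral) (auto dest: loc_L2D)

lemma signed_integral_same: "signed_integral c g c = 0"
  by (simp add: signed_integral_def)

text \<open>Testing with the truncated primitive of \<open>q - Q - c\<close> itself, where \<open>Q' = S\<close> and
  \<open>c\<close> is the mean of \<open>q - Q\<close>, gives \<open>\<integral> (q - Q - c)\<^sup>2 = 0\<close>.\<close>

lemma weak_equation_AE:
  assumes ab: "0 < a" "a < b" and q: "loc_L2 q" and S: "loc_L2 S"
    and weak: "\<And>\<eta> \<eta>'. primitive \<eta> \<eta>' \<Longrightarrow> (\<And>r. r > 0 \<Longrightarrow> r \<notin> {a..b} \<Longrightarrow> \<eta> r = 0 \<and> \<eta>' r = 0) \<Longrightarrow>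
        (LINT r:{a..b}|lborel. q r * \<eta>' r + S r * \<eta> r) = 0"
  shows "\<exists>c. AE r in lborel. r \<in> {a..b} \<longrightarrow> q r = signed_integral a S r + c"
proof -
  define Q where "Q = signed_integral a S"
  have Qp: "primitive Q S" unfolding Q_def by (rule primitive_signed_integral'[OF ab(1) S])
  have qQ: "loc_L2 (\<lambda>r. q r - Q r)"
    by (rule loc_L2_diff[OF q loc_L2_continuous[OF primitive_continuous_on[OF Qp]]])
  define c where "c = (LINT r:{a..b}|lborel. q r - Q r) / (b - a)"
  define e where "e r = q r - Q r - c" for r
  have eL: "loc_L2 e" unfolding e_def[abs_def] by (intro loc_L2_diff qQ loc_L2_continuous) simp
  have "(LINT r:{a..b}|lborel. e r) = (LINT r:{a..b}|lborel. q r - Q r) - (LINT r:{a..b}|lborel. c)"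
    unfolding e_def by (intro set_integral_diff(2) loc_L2D[OF qQ ab(1)] set_integrable_continuous) simp
  also have "(LINT r:{a..b}|lborel. c) = c * (b - a)" using ab by (simp add: set_lebesgue_integral_def)
  finally have e0: "(LINT r:{a..b}|lborel. e r) = 0" using ab by (simp add: c_def)
  \<comment> \<open>The mean was subtracted exactly so that \<open>F\<close> vanishes at both ends
    and can be continued by 0 to an admissible test function.\<close>
  define F where "F = signed_integral a e"
  have Fp: "primitive F e" unfolding F_def by (rule primitive_signed_integral'[OF ab(1) eL])
  have Fa: "F a = 0" by (simp add: F_def signed_integral_same)
  have Fb: "F b = 0" using primitiveD(5)[OF Fp ab(1), of b] ab e0 Fa by simp
  have zp: "primitive (\<lambda>r. 0) (\<lambda>r. 0)" by (rule primitive_continuous) auto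
  define \<eta> where "\<eta> r = (if r < a then 0 else if r < b then F r else 0)" for r
  define \<eta>' where "\<eta>' r = (if r < a then 0 else if r < b then e r else 0)" for r
  have \<eta>p: "primitive \<eta> \<eta>'"
    unfolding \<eta>_def[abs_def] \<eta>'_def[abs_def]
    by (intro primitive_piecewise zp Fp) (use Fa Fb ab in auto)
  have "(LINT r:{a..b}|lborel. q r * \<eta>' r + S r * \<eta> r) = 0"
    by (rule weak[OF \<eta>p]) (use ab in \<open>auto simp: \<eta>_def \<eta>'_def\<close>)
  also have "(LINT r:{a..b}|lborel. q r * \<eta>' r + S r * \<eta> r) = (LINT r:{a..b}|lborel. q r * \<eta>' r) + (LINT r:{a..b}|lborel. S r * \<eta> r)"
  proof (rule set_integral_add(2))
    show "set_integrable lborel {a..b} (\<lambda>r. q r * \<eta>' r)"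
      by (intro set_integrable_L2_mult loc_L2D[OF q ab(1)] primitiveD[OF \<eta>p ab(1)])
    show "set_integrable lborel {a..b} (\<lambda>r. S r * \<eta> r)"
      using set_integrable_cont_mult[OF primitiveD(4)[OF \<eta>p ab(1)] loc_L2D(1)[OF S ab(1)], of b] by (simp add: mult.commute)
  qed
  also have "(LINT r:{a..b}|lborel. S r * \<eta> r) = - (LINT r:{a..b}|lborel. Q r * \<eta>' r)"
  proof -
    note m = ac_on_mult[OF primitiveD(1)[OF Qp ab(1), of b] primitiveD(1)[OF \<eta>p ab(1), of b]]
    have "0 = (LINT r:{a..b}|lborel. S r * \<eta> r + Q r * \<eta>' r)"
      using ac_onD(1)[OF m, of a b] ab Fa by (simp add: \<eta>_def)
    also have "\<dots> = (LINT r:{a..b}|lborel. S r * \<eta> r) + (LINT r:{a..b}|lborel. Q r * \<eta>' r)"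
    proof (rule set_integral_add(2))
      show "set_integrable lborel {a..b} (\<lambda>r. S r * \<eta> r)"
        using set_integrable_cont_mult[OF primitiveD(4)[OF \<eta>p ab(1)] loc_L2D(1)[OF S ab(1)], of b] by (simp add: mult.commute)
      show "set_integrable lborel {a..b} (\<lambda>r. Q r * \<eta>' r)"
        by (rule set_integrable_cont_mult[OF primitiveD(4)[OF Qp ab(1)] primitiveD(2)[OF \<eta>p ab(1)]])
    qed
    finally show ?thesis by simp
  qed
  finally have "(LINT r:{a..b}|lborel. q r * \<eta>' r) - (LINT r:{a..b}|lborel. Q r * \<eta>' r) = 0" by simp
  moreover have "(LINT r:{a..b}|lborel. q r * \<eta>' r) - (LINT r:{a..b}|lborel. Q r * \<eta>' r) = (LINT r:{a..b}|lborel. q r * \<eta>' r - Q r * \<eta>' r)"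
    by (rule set_integral_diff(2)[symmetric])
       (intro set_integrable_L2_mult loc_L2D[OF q ab(1)] primitiveD[OF \<eta>p ab(1)]
         set_integrable_cont_mult[OF primitiveD(4)[OF Qp ab(1)] primitiveD(2)[OF \<eta>p ab(1)]])+
  moreover have "(LINT r:{a..b}|lborel. q r * \<eta>' r - Q r * \<eta>' r) = (LINT r:{a..b}|lborel. (e r)\<^sup>2 + c * e r)"
  proof -
    \<comment> \<open>The right endpoint is removed first because \<eta>' is 0 there by the case
      distinction, whereas \<open>e b\<close> need not be.\<close>
    have "(LINT r:{a..b}|lborel. q r * \<eta>' r - Q r * \<eta>' r) = (LINT r:{a..<b}|lborel. q r * \<eta>' r - Q r * \<eta>' r)"
      by (rule set_integral_countable_change[where X = "{b}"]) auto
    also have "\<dots> = (LINT r:{a..<b}|lborel. (e r)\<^sup>2 + c * e r)"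
      by (rule set_lebesgue_integral_cong) (auto simp: \<eta>'_def e_def power2_eq_square algebra_simps)
    also have "\<dots> = (LINT r:{a..b}|lborel. (e r)\<^sup>2 + c * e r)"
      by (rule set_integral_countable_change[where X = "{b}"]) auto
    finally show ?thesis .
  qed
  moreover have "(LINT r:{a..b}|lborel. (e r)\<^sup>2 + c * e r) = (LINT r:{a..b}|lborel. (e r)\<^sup>2) + (LINT r:{a..b}|lborel. c * e r)"
    by (rule set_integral_add(2)) (intro set_integrable_mult_right loc_L2D[OF eL ab(1)])+
  ultimately have "(LINT r:{a..b}|lborel. (e r)\<^sup>2) = 0" using e0 by simp
  hence "AE r in lborel. indicator {a..b} r *\<^sub>R (e r)\<^sup>2 = 0"
    unfolding set_lebesgue_integral_def
    using integral_nonneg_eq_0_iff_AE[OF loc_L2D(2)[OF eL ab(1), of b, unfolded set_integrable_def]] by (simp add: indicator_def)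
  hence "AE r in lborel. r \<in> {a..b} \<longrightarrow> q r = signed_integral a S r + c"
    by eventually_elim (auto simp: indicator_def e_def Q_def)
  thus ?thesis by blast
qed

text \<open>The constants for different \<open>b\<close> coincide because two of them are valid on
  the common interval from \<open>a\<close> to \<open>a + 1\<close>, which has positive
  measure.\<close>

lemma weak_equation_AE_half_line:
  assumes a: "0 < a" and q: "loc_L2 q" and S: "loc_L2 S"
    and weak: "\<And>b \<eta> \<eta>'. a < b \<Longrightarrow> primitive \<eta> \<eta>' \<Longrightarrow> (\<And>r. r > 0 \<Longrightarrow> r \<notin> {a..b} \<Longrightarrow> \<eta> r = 0 \<and> \<eta>' r = 0) \<Longrightarrow>
        (LINT r:{a..b}|lborel. q r * \<eta>' r + S r * \<eta> r) = 0"
  obtains c where "AE r in lborel. r \<ge> a \<longrightarrow> q r = signed_integral a S r + c"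
proof -
  have "\<exists>c. AE r in lborel. r \<in> {a..b} \<longrightarrow> q r = signed_integral a S r + c" if "a < b" for b
    by (rule weak_equation_AE[OF a that q S weak[OF that]])
  then obtain c where c: "\<And>b. a < b \<Longrightarrow> AE r in lborel. r \<in> {a..b} \<longrightarrow> q r = signed_integral a S r + c b" by metis
  have cc: "c b = c (a + 1)" if b: "b \<ge> a + 1" for b
  proof (rule ccontr)
    assume ne: "c b \<noteq> c (a + 1)"
    have "AE r in lborel. r \<in> {a..b} \<longrightarrow> q r = signed_integral a S r + c b" by (rule c) (use b in simp)
    moreover have "AE r in lborel. r \<in> {a..a+1} \<longrightarrow> q r = signed_integral a S r + c (a + 1)" by (rule c) simp
    ultimately have "AE r in lborel. r \<notin> {a..a+1}"
      by eventually_elim (use ne b in auto)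
    hence "emeasure lborel {a..a+1} = 0" by (subst (asm) AE_iff_measurable[of "{a..a+1}"]) auto
    thus False by simp
  qed
  have "AE r in lborel. r \<in> {a..a + 1 + real n} \<longrightarrow> q r = signed_integral a S r + c (a + 1)" for n :: nat
    using c[of "a + 1 + real n"] cc[of "a + 1 + real n"] by simp
  hence "AE r in lborel. \<forall>n::nat. r \<in> {a..a + 1 + real n} \<longrightarrow> q r = signed_integral a S r + c (a + 1)"
    unfolding AE_all_countable by blast
  hence "AE r in lborel. r \<ge> a \<longrightarrow> q r = signed_integral a S r + c (a + 1)"
  proof eventually_elim
    case (elim r)
    obtain n :: nat where "real n > r - a" using reals_Archimedean2 by blast
    thus ?case using elim[rule_format, of n] by auto
  qed
  thus thesis by (rule that)
qed

text \<open>An a.e. derivative with a continuous representative is a classical one; this is the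
  regularity step for the Euler-Lagrange equations.\<close>

lemma has_real_derivative_of_primitive:
  assumes p: "primitive f g" and a: "0 < a" and ae: "AE r in lborel. r \<ge> a \<longrightarrow> g r = k r"
    and k: "continuous_on {a..} k" and r: "r > a"
  shows "(f has_real_derivative k r) (at r)"
proof -
  have kc: "continuous_on {a..r+1} k" by (rule continuous_on_subset[OF k]) auto
  have eq: "f x = f a + integral {a..x} k" if x: "x \<in> {a..r+1}" for x
  proof -
    have ki: "set_integrable lborel {a..x} k" by (rule set_integrable_continuous, rule continuous_on_subset[OF k]) auto
    have "f x - f a = (LINT t:{a..x}|lborel. g t)" using primitiveD(5)[OF p a] x by simp
    also have "\<dots> = (LINT t:{a..x}|lborel. k t)"
      unfolding set_lebesgue_integral_def
    proof (rule integral_cong_AE)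
      show "AE t in lborel. indicator {a..x} t *\<^sub>R g t = indicator {a..x} t *\<^sub>R k t"
        using ae by eventually_elim (auto simp: indicator_def)
    qed (use ki primitiveD(2)[OF p a, of x] in \<open>auto simp: set_integrable_def\<close>)
    also have "\<dots> = integral {a..x} k" by (rule set_borel_integral_eq_integral(2)[OF ki])
    finally show ?thesis by simp
  qed
  have "((\<lambda>x. f a + integral {a..x} k) has_real_derivative k r) (at r within {a..r+1})"
    using integral_has_real_derivative[OF kc, of r] r by (auto intro!: derivative_eq_intros)
  hence "((\<lambda>x. f a + integral {a..x} k) has_real_derivative k r) (at r)"
    using at_within_interior[of r "{a..r+1}"] r by simp
  thus ?thesis
  proof (rule has_field_derivative_transform_within_open[where S = "{a<..<r+1}"])
    show "f a + integral {a..x} k = f x" if "x \<in> {a<..<r+1}" for x by (rule eq[symmetric]) (use that in auto)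
  qed (use r in auto)
qed

lemma strain_loc_L2:
  assumes "primitive u u'" "primitive w w'"
  shows "loc_L2 (\<lambda>r. r * strain lam u' w r)"
proof (rule loc_L2_cont_mult)
  show "loc_L2 (strain lam u' w)" using strain_set_integrable[OF assms] by (auto simp: loc_L2_def)
qed (intro continuous_intros)

text \<open>Along \<open>u + t * \<eta>\<close> the density is quadratic in \<open>t\<close>; twice
  the stated integral is its linear coefficient.\<close>

lemma weak_equation_u:
  assumes min: "sq_minimal lam u u' w w' N" and lam: "0 < lam" "lam < a"
    and \<eta>: "primitive \<eta> \<eta>'" and out: "\<And>r. r > 0 \<Longrightarrow> r \<notin> {a..b} \<Longrightarrow> \<eta> r = 0 \<and> \<eta>' r = 0"
  shows "(LINT r:{a..b}|lborel. r * strain lam u' w r * \<eta>' r + (u r - lam\<^sup>2 / (2 * r)) / r * \<eta> r) = 0"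
proof -
  have u: "primitive u u'" and w: "primitive w w'" using min by (auto simp: sq_minimal_def)
  have a: "a > 0" using lam by simp
  define q where "q r = r * strain lam u' w r" for r
  define S where "S r = (u r - lam\<^sup>2 / (2 * r)) / r" for r
  have q: "loc_L2 q" unfolding q_def[abs_def] by (rule strain_loc_L2[OF u w])
  note uc = primitiveD(4)[OF u a, of b] and \<eta>c = primitiveD(4)[OF \<eta> a, of b]
  have Sc: "continuous_on {a..b} S" unfolding S_def[abs_def] by (intro continuous_intros uc) (use a in auto)
  have i1: "set_integrable lborel {a..b} (\<lambda>r. q r * \<eta>' r + S r * \<eta> r)"
    by (intro set_integral_add(1) set_integrable_L2_mult loc_L2D[OF q a] primitiveD[OF \<eta> a]
        set_integrable_continuous continuous_on_mult Sc \<eta>c)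
  have i2: "set_integrable lborel {a..b} (\<lambda>r. r * (\<eta>' r)\<^sup>2 + (\<eta> r)\<^sup>2 / r)"
    by (intro set_integral_add(1) set_integrable_cont_mult primitiveD[OF \<eta> a] set_integrable_continuous continuous_intros \<eta>c)
       (use a in auto)
  define L where "L = (LINT r:{a..b}|lborel. q r * \<eta>' r + S r * \<eta> r)"
  define K where "K = (LINT r:{a..b}|lborel. r * (\<eta>' r)\<^sup>2 + (\<eta> r)\<^sup>2 / r)"
  have "0 \<le> t * (2 * L) + t\<^sup>2 * K + t ^ 3 * 0 + t ^ 4 * 0" for t
  proof -
    have "primitive (\<lambda>r. u r + t * \<eta> r) (\<lambda>r. u' r + t * \<eta>' r)"
      by (intro primitive_add[OF u] primitive_cmult \<eta>)
    hence "0 \<le> (LINT r:{a..b}|lborel. sq_density lam (\<lambda>r. u r + t * \<eta> r) (\<lambda>r. u' r + t * \<eta>' r) w w' r - sq_density lam u u' w w' r)"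
      by (rule local_variation[OF min lam _ w]) (use out in auto)
    also have "\<dots> = (LINT r:{a..b}|lborel. (2 * t) * (q r * \<eta>' r + S r * \<eta> r) + t\<^sup>2 * (r * (\<eta>' r)\<^sup>2 + (\<eta> r)\<^sup>2 / r))"
    proof -
      have "sq_density lam (\<lambda>r. u r + t * \<eta> r) (\<lambda>r. u' r + t * \<eta>' r) w w' r - sq_density lam u u' w w' r
          = (2 * t) * (q r * \<eta>' r + S r * \<eta> r) + t\<^sup>2 * (r * (\<eta>' r)\<^sup>2 + (\<eta> r)\<^sup>2 / r)" if "r \<in> {a..b}" for r
      proof -
        have r: "r > 0" "\<not> r < lam" using that lam by auto
        have s: "strain lam (\<lambda>r. u' r + t * \<eta>' r) w r = strain lam u' w r + t * \<eta>' r" by (simp add: strain_def)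
        define D where "D = u r - shift lam r"
        have e: "u r + t * \<eta> r - shift lam r = D + t * \<eta> r" by (simp add: D_def)
        have e2: "u r - lam\<^sup>2 / (2 * r) = D" using r by (simp add: D_def shift_def)
        show ?thesis
          unfolding sq_density_def s e D_def[symmetric] q_def S_def e2 using r(2)
          by (simp add: power2_sum add_divide_distrib distrib_left power_mult_distrib)
      qed
      thus ?thesis by (intro set_lebesgue_integral_cong allI impI) simp_all
    qed
    also have "\<dots> = (LINT r:{a..b}|lborel. (2 * t) * (q r * \<eta>' r + S r * \<eta> r)) + (LINT r:{a..b}|lborel. t\<^sup>2 * (r * (\<eta>' r)\<^sup>2 + (\<eta> r)\<^sup>2 / r))"
      by (rule set_integral_add(2)) (intro set_integrable_mult_right i1 i2)+
    also have "\<dots> = t * (2 * L) + t\<^sup>2 * K" unfolding L_def K_def by (simp only: set_integral_mult_right)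
    finally show ?thesis by simp
  qed
  from variation_coeff_zero[OF this] show ?thesis by (simp add: L_def q_def S_def)
qed

text \<open>Along \<open>w + t * \<eta>\<close> the strain is quadratic in \<open>t\<close> and the
  density quartic; the quadratic, cubic and quartic coefficients matter only through their
  integrability.\<close>

lemma weak_equation_w:
  assumes min: "sq_minimal lam u u' w w' N" and lam: "0 < lam" "lam < a"
    and \<eta>: "primitive \<eta> \<eta>'" and out: "\<And>r. r > 0 \<Longrightarrow> r \<notin> {a..b} \<Longrightarrow> \<eta> r = 0 \<and> \<eta>' r = 0"
  shows "(LINT r:{a..b}|lborel. lam\<^sup>2 * r * w' r * \<eta>' r + (2 * w r) * (r * strain lam u' w r) * \<eta> r) = 0"
proof -
  have u: "primitive u u'" and w: "primitive w w'" using min by (auto simp: sq_minimal_def)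
  have a: "a > 0" using lam by simp
  define q where "q r = r * strain lam u' w r" for r
  have q: "loc_L2 q" unfolding q_def[abs_def] by (rule strain_loc_L2[OF u w])
  note wc = primitiveD(4)[OF w a, of b] and \<eta>c = primitiveD(4)[OF \<eta> a, of b]
  have j1: "set_integrable lborel {a..b} (\<lambda>r. (lam\<^sup>2 * r) * (w' r * \<eta>' r))"
    by (intro set_integrable_cont_mult set_integrable_L2_mult primitiveD[OF w a] primitiveD[OF \<eta> a] continuous_intros)
  have j2: "set_integrable lborel {a..b} (\<lambda>r. (2 * w r * \<eta> r) * q r)"
    by (intro set_integrable_cont_mult loc_L2D[OF q a] continuous_intros wc \<eta>c)
  have i1: "set_integrable lborel {a..b} (\<lambda>r. lam\<^sup>2 * r * w' r * \<eta>' r + (2 * w r) * q r * \<eta> r)"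
    using set_integral_add(1)[OF j1 j2] by (simp add: mult_ac)
  have j3: "set_integrable lborel {a..b} (\<lambda>r. 4 * r * (w r)\<^sup>2 * (\<eta> r)\<^sup>2)"
    by (intro set_integrable_continuous continuous_intros wc \<eta>c)
  have j4: "set_integrable lborel {a..b} (\<lambda>r. (2 * (\<eta> r)\<^sup>2) * q r)"
    by (intro set_integrable_cont_mult loc_L2D[OF q a] continuous_intros \<eta>c)
  have j5: "set_integrable lborel {a..b} (\<lambda>r. (lam\<^sup>2 * r) * (\<eta>' r)\<^sup>2)"
    by (intro set_integrable_cont_mult primitiveD[OF \<eta> a] continuous_intros)
  have i2: "set_integrable lborel {a..b} (\<lambda>r. 4 * r * (w r)\<^sup>2 * (\<eta> r)\<^sup>2 + (2 * (\<eta> r)\<^sup>2) * q r + (lam\<^sup>2 * r) * (\<eta>' r)\<^sup>2)"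
    by (intro set_integral_add(1) j3 j4 j5)
  have i3: "set_integrable lborel {a..b} (\<lambda>r. 4 * r * w r * (\<eta> r) ^ 3)"
    by (intro set_integrable_continuous continuous_intros wc \<eta>c)
  have i4: "set_integrable lborel {a..b} (\<lambda>r. r * (\<eta> r) ^ 4)"
    by (intro set_integrable_continuous continuous_intros \<eta>c)
  define L where "L = (LINT r:{a..b}|lborel. lam\<^sup>2 * r * w' r * \<eta>' r + (2 * w r) * q r * \<eta> r)"
  define K2 where "K2 = (LINT r:{a..b}|lborel. 4 * r * (w r)\<^sup>2 * (\<eta> r)\<^sup>2 + (2 * (\<eta> r)\<^sup>2) * q r + (lam\<^sup>2 * r) * (\<eta>' r)\<^sup>2)"
  define K3 where "K3 = (LINT r:{a..b}|lborel. 4 * r * w r * (\<eta> r) ^ 3)"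
  define K4 where "K4 = (LINT r:{a..b}|lborel. r * (\<eta> r) ^ 4)"
  have "0 \<le> t * (2 * L) + t\<^sup>2 * K2 + t ^ 3 * K3 + t ^ 4 * K4" for t
  proof -
    have "primitive (\<lambda>r. w r + t * \<eta> r) (\<lambda>r. w' r + t * \<eta>' r)"
      by (intro primitive_add[OF w] primitive_cmult \<eta>)
    hence "0 \<le> (LINT r:{a..b}|lborel. sq_density lam u u' (\<lambda>r. w r + t * \<eta> r) (\<lambda>r. w' r + t * \<eta>' r) r - sq_density lam u u' w w' r)"
      by (rule local_variation[OF min lam u]) (use out in auto)
    also have "\<dots> = (LINT r:{a..b}|lborel. (2 * t) * (lam\<^sup>2 * r * w' r * \<eta>' r + (2 * w r) * q r * \<eta> r)
        + t\<^sup>2 * (4 * r * (w r)\<^sup>2 * (\<eta> r)\<^sup>2 + (2 * (\<eta> r)\<^sup>2) * q r + (lam\<^sup>2 * r) * (\<eta>' r)\<^sup>2)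
        + t ^ 3 * (4 * r * w r * (\<eta> r) ^ 3) + t ^ 4 * (r * (\<eta> r) ^ 4))"
    proof -
      have "sq_density lam u u' (\<lambda>r. w r + t * \<eta> r) (\<lambda>r. w' r + t * \<eta>' r) r - sq_density lam u u' w w' r
          = (2 * t) * (lam\<^sup>2 * r * w' r * \<eta>' r + (2 * w r) * q r * \<eta> r)
        + t\<^sup>2 * (4 * r * (w r)\<^sup>2 * (\<eta> r)\<^sup>2 + (2 * (\<eta> r)\<^sup>2) * q r + (lam\<^sup>2 * r) * (\<eta>' r)\<^sup>2)
        + t ^ 3 * (4 * r * w r * (\<eta> r) ^ 3) + t ^ 4 * (r * (\<eta> r) ^ 4)" if "r \<in> {a..b}" for r
      proof -
        have r: "\<not> r < lam" using that lam by auto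
        have s: "strain lam u' (\<lambda>r. w r + t * \<eta> r) r = strain lam u' w r + (2 * t * w r * \<eta> r + t\<^sup>2 * (\<eta> r)\<^sup>2)"
          by (simp add: strain_def power2_eq_square algebra_simps)
        show ?thesis
          unfolding sq_density_def s q_def using r
          by (simp add: power2_eq_square power3_eq_cube power4_eq_xxxx algebra_simps)
      qed
      thus ?thesis by (intro set_lebesgue_integral_cong allI impI) simp_all
    qed
    also have "\<dots> = (LINT r:{a..b}|lborel. (2 * t) * (lam\<^sup>2 * r * w' r * \<eta>' r + (2 * w r) * q r * \<eta> r))
        + (LINT r:{a..b}|lborel. t\<^sup>2 * (4 * r * (w r)\<^sup>2 * (\<eta> r)\<^sup>2 + (2 * (\<eta> r)\<^sup>2) * q r + (lam\<^sup>2 * r) * (\<eta>' r)\<^sup>2))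
        + (LINT r:{a..b}|lborel. t ^ 3 * (4 * r * w r * (\<eta> r) ^ 3)) + (LINT r:{a..b}|lborel. t ^ 4 * (r * (\<eta> r) ^ 4))"
    proof -
      note k1 = set_integrable_mult_right[OF i1, of "2 * t"] and k2 = set_integrable_mult_right[OF i2, of "t\<^sup>2"]
        and k3 = set_integrable_mult_right[OF i3, of "t ^ 3"] and k4 = set_integrable_mult_right[OF i4, of "t ^ 4"]
      note k12 = set_integral_add[OF k1 k2]
      note k123 = set_integral_add[OF k12(1) k3]
      show ?thesis unfolding set_integral_add(2)[OF k123(1) k4] k123(2) k12(2) ..
    qed
    also have "\<dots> = t * (2 * L) + t\<^sup>2 * K2 + t ^ 3 * K3 + t ^ 4 * K4"
      unfolding L_def K2_def K3_def K4_def by (simp only: set_integral_mult_right)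
    finally show ?thesis .
  qed
  from variation_coeff_zero[OF this] show ?thesis by (simp add: L_def q_def)
qed

text \<open>Both weak equations say that a flux, r times the strain or lam^2 r w', has an integrable
  weak derivative. So the fluxes have continuous representatives \<open>q\<close> and
  \<open>p\<close>; reading the definitions of the fluxes backwards gives classical derivatives of U
  and \<open>w\<close>.\<close>

theorem euler_lagrange_system:
  assumes min: "sq_minimal lam u u' w w' N" and lam: "0 < lam"
  obtains p q where
    "\<And>r. r > 2 * lam \<Longrightarrow> (q has_real_derivative (u r - lam\<^sup>2 / (2 * r)) / r) (at r)"
    "\<And>r. r > 2 * lam \<Longrightarrow> ((\<lambda>r. u r - lam\<^sup>2 / (2 * r)) has_real_derivative q r / r - ((w r)\<^sup>2 - 1)) (at r)"
    "\<And>r. r > 2 * lam \<Longrightarrow> (w has_real_derivative p r / (lam\<^sup>2 * r)) (at r)"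
    "\<And>r. r > 2 * lam \<Longrightarrow> (p has_real_derivative 2 * q r * w r) (at r)"
proof -
  have u: "primitive u u'" and w: "primitive w w'" using min by (auto simp: sq_minimal_def)
  \<comment> \<open>A convenient radius strictly beyond \<open>lam\<close>, as variations must leave
    \<open>u lam\<close> untouched.\<close>
  define a where "a = 2 * lam"
  have a: "0 < a" "lam < a" using lam by (auto simp: a_def)
  have aset: "{a..} \<subseteq> {0<..}" using a by auto
  define U where "U r = u r - lam\<^sup>2 / (2 * r)" for r
  define U' where "U' r = u' r + lam\<^sup>2 / (2 * r\<^sup>2)" for r
  have Up: "primitive U U'" unfolding U_def[abs_def] U'_def[abs_def] by (rule primitive_excess[OF u])
  note Uc = primitive_continuous_on[OF Up] and wc = primitive_continuous_on[OF w]
  define Q where "Q r = r * strain lam u' w r" for r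
  define S where "S r = U r / r" for r
  have QL: "loc_L2 Q" unfolding Q_def[abs_def] by (rule strain_loc_L2[OF u w])
  have Sc: "continuous_on {0<..} S" unfolding S_def[abs_def] by (intro continuous_intros Uc) auto
  have SL: "loc_L2 S" by (rule loc_L2_continuous[OF Sc])
  obtain c1 where c1: "AE r in lborel. r \<ge> a \<longrightarrow> Q r = signed_integral a S r + c1"
  proof (rule weak_equation_AE_half_line[OF a(1) QL SL])
    fix b \<eta> \<eta>' assume "primitive \<eta> \<eta>'" "\<And>r. r > 0 \<Longrightarrow> r \<notin> {a..b} \<Longrightarrow> \<eta> r = 0 \<and> \<eta>' r = 0"
    from weak_equation_u[OF min lam a(2) this] show "(LINT r:{a..b}|lborel. Q r * \<eta>' r + S r * \<eta> r) = 0"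
      by (simp add: Q_def S_def U_def)
  qed blast
  define q where "q r = signed_integral a S r + c1" for r
  have sp: "primitive (signed_integral a S) S" by (rule primitive_signed_integral'[OF a(1) SL])
  have qc: "continuous_on {0<..} q" unfolding q_def[abs_def] by (intro continuous_intros primitive_continuous_on[OF sp])
  have q': "(q has_real_derivative S r) (at r)" if "r > a" for r
  proof -
    have "(signed_integral a S has_real_derivative S r) (at r)"
      by (rule has_real_derivative_of_primitive[OF sp a(1) _ continuous_on_subset[OF Sc aset] that]) simp
    thus ?thesis unfolding q_def[abs_def] by (auto intro!: derivative_eq_intros)
  qed
  have U': "(U has_real_derivative q r / r - ((w r)\<^sup>2 - 1)) (at r)" if "r > a" for r
  proof (rule has_real_derivative_of_primitive[OF Up a(1) _ _ that])
    show "AE r in lborel. a \<le> r \<longrightarrow> U' r = q r / r - ((w r)\<^sup>2 - 1)"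
      using c1
    proof eventually_elim
      case (elim r)
      show ?case
      proof
        assume r: "a \<le> r"
        hence "q r = r * strain lam u' w r" using elim by (simp add: q_def Q_def)
        moreover have "r \<noteq> 0" "\<not> r < lam" using r a by auto
        ultimately show "U' r = q r / r - ((w r)\<^sup>2 - 1)" by (simp add: strain_def shift'_def U'_def)
      qed
    qed
    show "continuous_on {a..} (\<lambda>r. q r / r - ((w r)\<^sup>2 - 1))"
      by (intro continuous_intros continuous_on_subset[OF qc aset] continuous_on_subset[OF wc aset]) (use a in auto)
  qed
  define P where "P r = lam\<^sup>2 * r * w' r" for r
  define S2 where "S2 r = (2 * w r) * Q r" for r
  have PL: "loc_L2 P" unfolding P_def[abs_def]
    by (rule loc_L2_cont_mult[OF _ loc_L2_primitive[OF w]]) (intro continuous_intros)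
  have S2L: "loc_L2 S2" unfolding S2_def[abs_def] by (rule loc_L2_cont_mult[OF _ QL]) (intro continuous_intros wc)
  obtain c2 where c2: "AE r in lborel. r \<ge> a \<longrightarrow> P r = signed_integral a S2 r + c2"
  proof (rule weak_equation_AE_half_line[OF a(1) PL S2L])
    fix b \<eta> \<eta>' assume "primitive \<eta> \<eta>'" "\<And>r. r > 0 \<Longrightarrow> r \<notin> {a..b} \<Longrightarrow> \<eta> r = 0 \<and> \<eta>' r = 0"
    from weak_equation_w[OF min lam a(2) this] show "(LINT r:{a..b}|lborel. P r * \<eta>' r + S2 r * \<eta> r) = 0"
      by (simp add: P_def S2_def Q_def)
  qed blast
  define p where "p r = signed_integral a S2 r + c2" for r
  have s2p: "primitive (signed_integral a S2) S2" by (rule primitive_signed_integral'[OF a(1) S2L])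
  have pc: "continuous_on {0<..} p" unfolding p_def[abs_def] by (intro continuous_intros primitive_continuous_on[OF s2p])
  have p': "(p has_real_derivative 2 * q r * w r) (at r)" if "r > a" for r
  proof -
    have "(signed_integral a S2 has_real_derivative 2 * q r * w r) (at r)"
    proof (rule has_real_derivative_of_primitive[OF s2p a(1) _ _ that])
      show "AE r in lborel. a \<le> r \<longrightarrow> S2 r = 2 * q r * w r"
        using c1 by eventually_elim (auto simp: S2_def q_def)
      show "continuous_on {a..} (\<lambda>r. 2 * q r * w r)"
        by (intro continuous_intros continuous_on_subset[OF qc aset] continuous_on_subset[OF wc aset])
    qed
    thus ?thesis unfolding p_def[abs_def] by (auto intro!: derivative_eq_intros)
  qed
  have w': "(w has_real_derivative p r / (lam\<^sup>2 * r)) (at r)" if "r > a" for r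
  proof (rule has_real_derivative_of_primitive[OF w a(1) _ _ that])
    show "AE r in lborel. a \<le> r \<longrightarrow> w' r = p r / (lam\<^sup>2 * r)"
      using c2 by eventually_elim (use a lam in \<open>auto simp: P_def p_def field_simps\<close>)
    show "continuous_on {a..} (\<lambda>r. p r / (lam\<^sup>2 * r))"
      by (intro continuous_intros continuous_on_subset[OF pc aset]) (use a lam in auto)
  qed
  show thesis
    by (rule that[of q p]) (use q' U' w' p' in \<open>auto simp: a_def S_def U_def[abs_def]\<close>)
qed

subsection \<open>Asymptotics\<close>

text \<open>On the interval from x to 2x the oscillation of \<open>w\<close> is bounded by the tail
  of the energy, and the mean of w^2 - 1, being that of the strain minus U', tends to 0 because U is
  sublinear. Hence w^2 tends to 1, and the sign condition selects 1.\<close>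

lemma minimizer_w_tendsto_1:
  assumes lam: "lam > 0" and adm: "(u, w) \<in> admissible lam"
    and fin: "sq_energy lam u (weak_deriv u) w (weak_deriv w) < \<infinity>" and nn: "\<And>r. r > 0 \<Longrightarrow> w r \<ge> 0"
  shows "(w \<longlongrightarrow> 1) at_top"
proof (rule tendstoI)
  fix \<epsilon>0 :: real assume \<epsilon>0: "\<epsilon>0 > 0"
  define \<epsilon> where "\<epsilon> = min \<epsilon>0 1"
  have \<epsilon>: "\<epsilon> > 0" "\<epsilon> \<le> 1" "\<epsilon> \<le> \<epsilon>0" using \<epsilon>0 by (auto simp: \<epsilon>_def)
  have u: "primitive u (weak_deriv u)" and w: "primitive w (weak_deriv w)"
    using admissible_W12[OF adm] W12_loc_primitive by auto
  define h where "h = sq_density lam u (weak_deriv u) w (weak_deriv w)"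
  define N where "N = (LINT r:{0<..}|lborel. h r)"
  have h0: "r > 0 \<Longrightarrow> h r \<ge> 0" for r unfolding h_def by (rule sq_density_nonneg)
  have hi: "set_integrable lborel {0<..} h" unfolding h_def by (rule sq_energy_finite_integrable(1)[OF u w fin])
  have N0: "N \<ge> 0" unfolding N_def set_lebesgue_integral_def using h0 by (auto intro!: integral_nonneg_AE simp: indicator_def)
  define J where "J R = (LINT r:{0<..<R}|lborel. h r)" for R
  have "((\<lambda>R. ereal (J R)) \<longlongrightarrow> ereal N) at_top"
    using partial_sq_energy_tendsto[OF lam adm] sq_energy_finite_integrable(2)[OF u w fin] N0
    unfolding J_def h_def N_def by simp
  hence JN: "(J \<longlongrightarrow> N) at_top" by (simp add: lim_ereal)
  have tail: "(LINT r:{x..y}|lborel. h r) \<le> N - J x" if x: "0 < x" for x y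
  proof -
    have "(LINT r:{x..y}|lborel. h r) \<le> (LINT r:{x..}|lborel. h r)"
      by (rule set_integral_subset_le[OF set_integrable_subset[OF hi]]) (use x h0 in auto)
    also have "\<dots> = N - J x"
    proof -
      have e: "{0<..} = {0<..<x} \<union> {x..}" using x by auto
      have "N = J x + (LINT r:{x..}|lborel. h r)"
        unfolding N_def J_def e by (rule set_integral_Un) (use x in \<open>auto intro!: set_integrable_subset[OF hi]\<close>)
      thus ?thesis by simp
    qed
    finally show ?thesis .
  qed
  define U where "U r = u r - lam\<^sup>2 / (2 * r)" for r
  define U' where "U' r = weak_deriv u r + lam\<^sup>2 / (2 * r\<^sup>2)" for r
  have Up: "primitive U U'" unfolding U_def[abs_def] U'_def[abs_def] by (rule primitive_excess[OF u])
  have Ul: "((\<lambda>r. U r / r) \<longlongrightarrow> 0) at_top" unfolding U_def by (rule excess_sublinear[OF lam u w fin])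
  \<comment> \<open>The restriction \<open>y \<le> 2 * x\<close> makes the factor (y - x)/x at most
    1, so the estimate is uniform over all such intervals.\<close>
  have osc: "(w y - w x)\<^sup>2 \<le> (N - J x) / lam\<^sup>2" if xy: "lam \<le> x" "x \<le> y" "y \<le> 2 * x" for x y
  proof -
    have x0: "x > 0" using xy lam by simp
    note d = primitiveD[OF w x0, of y]
    have "(w y - w x)\<^sup>2 \<le> (LINT t:{x..y}|lborel. \<bar>weak_deriv w t\<bar>)\<^sup>2"
    proof -
      have "\<bar>w y - w x\<bar> \<le> (LINT t:{x..y}|lborel. \<bar>weak_deriv w t\<bar>)"
        using d(5)[OF xy(2)] by (simp, intro set_integral_abs_le set_integrable_abs d) auto
      thus ?thesis by (metis abs_ge_zero power2_abs power_mono)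
    qed
    also have "\<dots> \<le> (LINT t:{x..y}|lborel. t * (weak_deriv w t)\<^sup>2) * ((y - x) / x)"
      by (rule integral_abs_square_le) (use d x0 xy in auto)
    also have "\<dots> \<le> (LINT t:{x..y}|lborel. t * (weak_deriv w t)\<^sup>2) * 1"
    proof (rule mult_left_mono)
      show "(y - x) / x \<le> 1" using xy x0 by (simp add: field_simps)
      show "0 \<le> (LINT t:{x..y}|lborel. t * (weak_deriv w t)\<^sup>2)"
        unfolding set_lebesgue_integral_def using x0 by (auto intro!: integral_nonneg_AE simp: indicator_def)
    qed
    also have "\<dots> = (LINT t:{x..y}|lborel. lam\<^sup>2 * (t * (weak_deriv w t)\<^sup>2)) / lam\<^sup>2" using lam by simp
    also have "\<dots> \<le> (N - J x) / lam\<^sup>2"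
      by (rule divide_right_mono[OF sq_density_parts(3)[OF u w lam xy(1)]]) (use tail[OF x0, of y] in \<open>auto simp: h_def\<close>)
    finally show ?thesis .
  qed
  have avg: "\<bar>LINT t:{x..2*x}|lborel. (w t)\<^sup>2 - 1\<bar> \<le> sqrt N + \<bar>U (2 * x)\<bar> + \<bar>U x\<bar>" if x: "lam \<le> x" for x
  proof -
    have x0: "x > 0" using x lam by simp
    note si = strain_set_integrable[OF u w x0, of "2 * x" lam]
    note d = primitiveD[OF Up x0, of "2 * x"]
    have "(LINT t:{x..2*x}|lborel. (w t)\<^sup>2 - 1) = (LINT t:{x..2*x}|lborel. strain lam (weak_deriv u) w t - U' t)"
      by (rule set_lebesgue_integral_cong) (use x in \<open>auto simp: strain_def U'_def shift'_def\<close>)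
    also have "\<dots> = (LINT t:{x..2*x}|lborel. strain lam (weak_deriv u) w t) - (U (2*x) - U x)"
      using set_integral_diff(2)[OF si(1) d(2)] d(5) x0 by simp
    finally have e: "(LINT t:{x..2*x}|lborel. (w t)\<^sup>2 - 1) = (LINT t:{x..2*x}|lborel. strain lam (weak_deriv u) w t) - (U (2*x) - U x)" .
    have "\<bar>LINT t:{x..2*x}|lborel. strain lam (weak_deriv u) w t\<bar> \<le> (LINT t:{x..2*x}|lborel. \<bar>strain lam (weak_deriv u) w t\<bar>)"
      by (intro set_integral_abs_le set_integrable_abs si) auto
    also have "\<dots> \<le> sqrt N"
    proof (rule real_le_rsqrt)
      have "(LINT t:{x..2*x}|lborel. \<bar>strain lam (weak_deriv u) w t\<bar>)\<^sup>2 \<le> (LINT t:{x..2*x}|lborel. t * (strain lam (weak_deriv u) w t)\<^sup>2) * ((2 * x - x) / x)"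
        by (rule integral_abs_square_le) (use si x0 in auto)
      also have "\<dots> = (LINT t:{x..2*x}|lborel. t * (strain lam (weak_deriv u) w t)\<^sup>2)" using x0 by simp
      also have "\<dots> \<le> N"
      proof (rule sq_density_parts(2)[OF u w lam x])
        show "(LINT r:{x..2 * x}|lborel. sq_density lam u (weak_deriv u) w (weak_deriv w) r) \<le> N"
          unfolding N_def h_def[symmetric] by (rule set_integral_subset_le[OF hi]) (use x0 h0 in auto)
      qed
      finally show "(LINT t:{x..2*x}|lborel. \<bar>strain lam (weak_deriv u) w t\<bar>)\<^sup>2 \<le> N" .
    qed
    finally show ?thesis using e by linarith
  qed
  have "((\<lambda>x. (N - J x) / lam\<^sup>2) \<longlongrightarrow> (N - N) / lam\<^sup>2) at_top"
    by (intro tendsto_intros JN) (use lam in simp)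
  hence ev1: "eventually (\<lambda>x. (N - J x) / lam\<^sup>2 < (\<epsilon> / 2)\<^sup>2) at_top"
    using \<epsilon> by (intro order_tendstoD(2)) auto
  have "filterlim (\<lambda>x::real. 2 * x) at_top at_top" by real_asymp
  from filterlim_compose[OF Ul this] have Ul2: "((\<lambda>x. U (2 * x) / (2 * x)) \<longlongrightarrow> 0) at_top" .
  \<comment> \<open>This is the bound \<open>avg\<close> divided by the interval length x; the
    factor 2 comes from normalising U(2x) by 2x.\<close>
  have "((\<lambda>x. sqrt N / x + 2 * \<bar>U (2 * x) / (2 * x)\<bar> + \<bar>U x / x\<bar>) \<longlongrightarrow> 0 + 2 * \<bar>0\<bar> + \<bar>0\<bar>) at_top"
    by (intro tendsto_intros Ul Ul2) real_asymp
  hence ev2: "eventually (\<lambda>x. sqrt N / x + 2 * \<bar>U (2 * x) / (2 * x)\<bar> + \<bar>U x / x\<bar> < \<epsilon> / 2) at_top"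
    using \<epsilon> by (intro order_tendstoD(2)) auto
  show "eventually (\<lambda>x. dist (w x) 1 < \<epsilon>0) at_top"
    using ev1 ev2 eventually_ge_at_top[of lam]
  proof eventually_elim
    case (elim x)
    have x0: "x > 0" using elim lam by simp
    have close: "\<bar>w t - w x\<bar> \<le> \<epsilon> / 2" if "t \<in> {x..2*x}" for t
    proof -
      have "(w t - w x)\<^sup>2 \<le> (\<epsilon> / 2)\<^sup>2" using osc[of x t] elim that by fastforce
      thus ?thesis using \<epsilon> by (intro power2_le_imp_le[of "\<bar>w t - w x\<bar>" "\<epsilon> / 2"]) auto
    qed
    have wc: "continuous_on {x..2*x} w" by (rule primitiveD(4)[OF w x0])
    have wi: "set_integrable lborel {x..2*x} (\<lambda>t. (w t)\<^sup>2 - 1)" by (intro set_integrable_continuous continuous_intros wc)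
    have const: "(LINT t:{x..2*x}|lborel. c) = c * x" for c :: real using x0 by (simp add: set_lebesgue_integral_def)
    have ci: "set_integrable lborel {x..2*x} (\<lambda>t. c)" for c :: real by (intro set_integrable_continuous) simp
    have "\<bar>LINT t:{x..2*x}|lborel. (w t)\<^sup>2 - 1\<bar> \<le> x * (sqrt N / x + 2 * \<bar>U (2 * x) / (2 * x)\<bar> + \<bar>U x / x\<bar>)"
      using avg[OF elim(3)] x0 by (simp add: abs_mult abs_divide distrib_left)
    also have "\<dots> < x * (\<epsilon> / 2)" by (rule mult_strict_left_mono[OF elim(2) x0])
    finally have small: "\<bar>LINT t:{x..2*x}|lborel. (w t)\<^sup>2 - 1\<bar> < x * (\<epsilon> / 2)" .
    have "\<bar>w x - 1\<bar> < \<epsilon>"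
    proof (rule ccontr)
      assume "\<not> \<bar>w x - 1\<bar> < \<epsilon>"
      then consider "w x \<ge> 1 + \<epsilon>" | "w x \<le> 1 - \<epsilon>" by linarith
      thus False
      proof cases
        case 1
        have "(LINT t:{x..2*x}|lborel. \<epsilon>) \<le> (LINT t:{x..2*x}|lborel. (w t)\<^sup>2 - 1)"
        proof (rule set_integral_mono[OF ci wi])
          fix t assume "t \<in> {x..2*x}"
          hence "w t \<ge> 1 + \<epsilon> / 2" using close[of t] 1 by linarith
          hence "(1 + \<epsilon> / 2)\<^sup>2 \<le> (w t)\<^sup>2" using \<epsilon> by (intro power_mono) auto
          moreover have "(1 + \<epsilon> / 2)\<^sup>2 = 1 + \<epsilon> + (\<epsilon> / 2)\<^sup>2" by (simp add: power2_sum)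
          ultimately show "\<epsilon> \<le> (w t)\<^sup>2 - 1" using zero_le_power2[of "\<epsilon> / 2"] by linarith
        qed
        hence "\<epsilon> * x < x * (\<epsilon> / 2)" using small const[of \<epsilon>] by linarith
        thus False using x0 \<epsilon> by simp
      next
        case 2
        have "(LINT t:{x..2*x}|lborel. (w t)\<^sup>2 - 1) \<le> (LINT t:{x..2*x}|lborel. - (\<epsilon> / 2))"
        proof (rule set_integral_mono[OF wi ci])
          fix t assume t: "t \<in> {x..2*x}"
          hence "w t \<le> 1 - \<epsilon> / 2" using close[of t] 2 by linarith
          \<comment> \<open>Nonnegativity of \<open>w\<close> enters here; without it
            \<open>w\<close> could be close to -1.\<close>
          hence "(w t)\<^sup>2 \<le> (1 - \<epsilon> / 2)\<^sup>2" using nn[of t] t x0 by (intro power_mono) auto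
          moreover have "(1 - \<epsilon> / 2)\<^sup>2 = 1 - \<epsilon> + \<epsilon> * \<epsilon> / 4" unfolding power2_diff by (simp add: power2_eq_square)
          moreover have "\<epsilon> * \<epsilon> \<le> \<epsilon> * 1" using \<epsilon> by (intro mult_left_mono) auto
          ultimately show "(w t)\<^sup>2 - 1 \<le> - (\<epsilon> / 2)" using \<epsilon> by linarith
        qed
        hence "(LINT t:{x..2*x}|lborel. (w t)\<^sup>2 - 1) \<le> - (\<epsilon> / 2) * x" using const[of "- (\<epsilon> / 2)"] by linarith
        moreover have "- (\<epsilon> / 2) * x = - (x * (\<epsilon> / 2))" by simp
        ultimately show False using small by linarith
      qed
    qed
    thus ?case using \<epsilon> by (simp add: dist_real_def)
  qed
qed

section \<open>Exponential decay for the Euler-Lagrange system\<close>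

lemma abs_le_of_deriv_bound:
  fixes f :: "real \<Rightarrow> real"
  assumes "\<And>t. x \<le> t \<Longrightarrow> t \<le> y \<Longrightarrow> (f has_real_derivative f' t) (at t)" "\<And>t. x \<le> t \<Longrightarrow> t \<le> y \<Longrightarrow> \<bar>f' t\<bar> \<le> M" "x \<le> y"
  shows "\<bar>f y\<bar> \<le> \<bar>f x\<bar> + M * (y - x)"
proof (cases "x = y")
  case False
  hence xy: "x < y" using assms by simp
  obtain z where z: "x < z" "z < y" "f y - f x = (y - x) * f' z"
    using MVT2[OF xy, of f f'] assms(1) by auto
  have "\<bar>f y - f x\<bar> \<le> (y - x) * M" unfolding z(3) abs_mult using assms(2)[of z] z xy by (intro mult_mono) auto
  thus ?thesis by (simp add: mult.commute)
qed simp

text \<open>With \<open>d/ds = \<tau> d/dr\<close>, the complex combination \<open>Z = \<alpha> + iq\<close> satisfies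
  \<open>Z'' = -2iZ\<close> up to small errors. Since \<open>(1 - i)\<^sup>2 = -2i\<close>, the growing and decaying modes are
  \<open>Z' \<plusminus> (1 - i)Z\<close>, with squared moduli \<open>T \<plusminus> 2\<Psi>\<close>.\<close>

lemma mode_inequalities:
  fixes A B \<alpha> q v \<kappa> \<mu> \<delta> :: real
  assumes "\<bar>v\<bar> \<le> \<delta>" "\<bar>\<kappa>\<bar> \<le> \<delta>" "\<bar>\<mu>\<bar> \<le> \<delta>"
  defines "A1 \<equiv> 2 * q * (1 + v) - A * \<kappa>" and "B1 \<equiv> \<mu> * q - \<alpha> * (2 + v) - B * \<kappa>"
    and "T \<equiv> A\<^sup>2 + B\<^sup>2 + 2 * (\<alpha>\<^sup>2 + q\<^sup>2)" and "\<Psi> \<equiv> A * (\<alpha> + q) + B * (q - \<alpha>)"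
  shows "\<bar>(A1 * (\<alpha> + q) + A * (A + B) + B1 * (q - \<alpha>) + B * (B - A)) - T\<bar> \<le> 5 * \<delta> * T"
    "\<bar>(2 * A * A1 + 2 * B * B1 + 4 * (\<alpha> * A + q * B)) - 4 * \<Psi>\<bar> \<le> 4 * \<delta> * T"
    "2 * \<bar>\<Psi>\<bar> \<le> T"
proof -
  have \<delta>: "\<delta> \<ge> 0" using assms(1) by simp
  \<comment> \<open>Every error term is one of the three small coefficients times a product of two
    of A, B, \<alpha>, q, so it is at most \<delta> times part of \<open>T\<close>.\<close>
  have prod: "\<bar>c * (x * y)\<bar> \<le> \<delta> * ((x\<^sup>2 + y\<^sup>2) / 2)" if "\<bar>c\<bar> \<le> \<delta>" for c x y
  proof -
    have "\<bar>x * y\<bar> \<le> (x\<^sup>2 + y\<^sup>2) / 2"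
      using sum_squares_bound[of "\<bar>x\<bar>" "\<bar>y\<bar>"] by (simp add: abs_mult)
    hence "\<bar>c\<bar> * \<bar>x * y\<bar> \<le> \<delta> * ((x\<^sup>2 + y\<^sup>2) / 2)" using that \<delta> by (intro mult_mono) auto
    thus ?thesis by (simp add: abs_mult)
  qed
  have half: "\<delta> * ((x\<^sup>2 + y\<^sup>2) / 2) = \<delta> * x\<^sup>2 / 2 + \<delta> * y\<^sup>2 / 2" for x y by (simp add: algebra_simps add_divide_distrib)
  note v = prod[OF assms(1), unfolded half] and k = prod[OF assms(2), unfolded half] and m = prod[OF assms(3), unfolded half]
  have sum5: "\<bar>y1 + y2 + y3 + y4 + y5\<bar> \<le> b1 + b2 + b3 + b4 + b5"
    if "\<bar>y1\<bar> \<le> b1" "\<bar>y2\<bar> \<le> b2" "\<bar>y3\<bar> \<le> b3" "\<bar>y4\<bar> \<le> b4" "\<bar>y5\<bar> \<le> b5" for y1 y2 y3 y4 y5 b1 b2 b3 b4 b5 :: real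
    using that by linarith
  have sq: "0 \<le> \<delta> * x\<^sup>2" for x using \<delta> by simp
  have e1: "(A1 * (\<alpha> + q) + A * (A + B) + B1 * (q - \<alpha>) + B * (B - A)) - T
     = (2 * (v * (q * \<alpha>)) + 2 * (v * (q * q))) + (- (\<kappa> * (A * \<alpha>)) - \<kappa> * (A * q)) + (\<mu> * (q * q) - \<mu> * (q * \<alpha>))
       + (- (v * (\<alpha> * q)) + v * (\<alpha> * \<alpha>)) + (- (\<kappa> * (B * q)) + \<kappa> * (B * \<alpha>))"
    unfolding A1_def B1_def T_def by (simp add: algebra_simps power2_eq_square)
  have T: "\<delta> * T = \<delta> * A\<^sup>2 + \<delta> * B\<^sup>2 + 2 * (\<delta> * \<alpha>\<^sup>2) + 2 * (\<delta> * q\<^sup>2)" unfolding T_def by (simp add: algebra_simps)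
  show "\<bar>(A1 * (\<alpha> + q) + A * (A + B) + B1 * (q - \<alpha>) + B * (B - A)) - T\<bar> \<le> 5 * \<delta> * T"
  proof -
    have "\<bar>2 * (v * (q * \<alpha>)) + 2 * (v * (q * q))\<bar> \<le> 3 * (\<delta> * q\<^sup>2) + \<delta> * \<alpha>\<^sup>2"
      using v[of q \<alpha>] v[of q q] by linarith
    moreover have "\<bar>- (\<kappa> * (A * \<alpha>)) - \<kappa> * (A * q)\<bar> \<le> \<delta> * A\<^sup>2 + \<delta> * \<alpha>\<^sup>2 / 2 + \<delta> * q\<^sup>2 / 2"
      using k[of A \<alpha>] k[of A q] by linarith
    moreover have "\<bar>\<mu> * (q * q) - \<mu> * (q * \<alpha>)\<bar> \<le> 3 * (\<delta> * q\<^sup>2) / 2 + \<delta> * \<alpha>\<^sup>2 / 2"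
      using m[of q q] m[of q \<alpha>] by linarith
    moreover have "\<bar>- (v * (\<alpha> * q)) + v * (\<alpha> * \<alpha>)\<bar> \<le> 3 * (\<delta> * \<alpha>\<^sup>2) / 2 + \<delta> * q\<^sup>2 / 2"
      using v[of \<alpha> q] v[of \<alpha> \<alpha>] by linarith
    moreover have "\<bar>- (\<kappa> * (B * q)) + \<kappa> * (B * \<alpha>)\<bar> \<le> \<delta> * B\<^sup>2 + \<delta> * \<alpha>\<^sup>2 / 2 + \<delta> * q\<^sup>2 / 2"
      using k[of B q] k[of B \<alpha>] by linarith
    ultimately have "\<bar>(A1 * (\<alpha> + q) + A * (A + B) + B1 * (q - \<alpha>) + B * (B - A)) - T\<bar>
      \<le> (3 * (\<delta> * q\<^sup>2) + \<delta> * \<alpha>\<^sup>2) + (\<delta> * A\<^sup>2 + \<delta> * \<alpha>\<^sup>2 / 2 + \<delta> * q\<^sup>2 / 2) + (3 * (\<delta> * q\<^sup>2) / 2 + \<delta> * \<alpha>\<^sup>2 / 2)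
        + (3 * (\<delta> * \<alpha>\<^sup>2) / 2 + \<delta> * q\<^sup>2 / 2) + (\<delta> * B\<^sup>2 + \<delta> * \<alpha>\<^sup>2 / 2 + \<delta> * q\<^sup>2 / 2)"
      unfolding e1 by (rule sum5)
    also have "\<dots> \<le> 5 * (\<delta> * A\<^sup>2) + 5 * (\<delta> * B\<^sup>2) + 10 * (\<delta> * \<alpha>\<^sup>2) + 10 * (\<delta> * q\<^sup>2)"
      using sq[of A] sq[of B] sq[of \<alpha>] sq[of q] by linarith
    also have "\<dots> = 5 * (\<delta> * T)" unfolding T by (simp add: distrib_left)
    finally show ?thesis by (simp add: mult.assoc)
  qed
  have e2: "(2 * A * A1 + 2 * B * B1 + 4 * (\<alpha> * A + q * B)) - 4 * \<Psi>
     = 4 * (v * (A * q)) + (- 2 * (\<kappa> * (A * A))) + 2 * (\<mu> * (B * q)) + (- 2 * (v * (B * \<alpha>))) + (- 2 * (\<kappa> * (B * B)))"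
    unfolding A1_def B1_def \<Psi>_def by (simp add: algebra_simps power2_eq_square)
  show "\<bar>(2 * A * A1 + 2 * B * B1 + 4 * (\<alpha> * A + q * B)) - 4 * \<Psi>\<bar> \<le> 4 * \<delta> * T"
  proof -
    have "\<bar>4 * (v * (A * q))\<bar> \<le> 2 * (\<delta> * A\<^sup>2) + 2 * (\<delta> * q\<^sup>2)" using v[of A q] by linarith
    moreover have "\<bar>- 2 * (\<kappa> * (A * A))\<bar> \<le> 2 * (\<delta> * A\<^sup>2)" using k[of A A] by linarith
    moreover have "\<bar>2 * (\<mu> * (B * q))\<bar> \<le> \<delta> * B\<^sup>2 + \<delta> * q\<^sup>2" using m[of B q] by linarith
    moreover have "\<bar>- 2 * (v * (B * \<alpha>))\<bar> \<le> \<delta> * B\<^sup>2 + \<delta> * \<alpha>\<^sup>2" using v[of B \<alpha>] by linarith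
    moreover have "\<bar>- 2 * (\<kappa> * (B * B))\<bar> \<le> 2 * (\<delta> * B\<^sup>2)" using k[of B B] by linarith
    ultimately have "\<bar>(2 * A * A1 + 2 * B * B1 + 4 * (\<alpha> * A + q * B)) - 4 * \<Psi>\<bar> \<le>
      (2 * (\<delta> * A\<^sup>2) + 2 * (\<delta> * q\<^sup>2)) + 2 * (\<delta> * A\<^sup>2) + (\<delta> * B\<^sup>2 + \<delta> * q\<^sup>2) + (\<delta> * B\<^sup>2 + \<delta> * \<alpha>\<^sup>2) + 2 * (\<delta> * B\<^sup>2)"
      unfolding e2 by (rule sum5)
    also have "\<dots> \<le> 4 * (\<delta> * A\<^sup>2) + 4 * (\<delta> * B\<^sup>2) + 8 * (\<delta> * \<alpha>\<^sup>2) + 8 * (\<delta> * q\<^sup>2)"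
      using sq[of A] sq[of B] sq[of \<alpha>] sq[of q] by linarith
    also have "\<dots> = 4 * (\<delta> * T)" unfolding T by (simp add: distrib_left)
    finally show ?thesis by (simp add: mult.assoc)
  qed
  \<comment> \<open>The two sums of squares are T - 2\<Psi> and T + 2\<Psi>.\<close>
  have "0 \<le> (A - (\<alpha> + q))\<^sup>2 + (B - (q - \<alpha>))\<^sup>2" "0 \<le> (A + (\<alpha> + q))\<^sup>2 + (B + (q - \<alpha>))\<^sup>2" by auto
  hence "2 * \<Psi> \<le> T" "- 2 * \<Psi> \<le> T" unfolding T_def \<Psi>_def by (simp_all add: power2_eq_square algebra_simps)
  thus "2 * \<bar>\<Psi>\<bar> \<le> T" by linarith
qed

text \<open>Up to small errors d\<Psi>/ds = T and dT/ds = 4\<Psi>, while 2|\<Psi>| \<le> T. A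
  positive value of \<Psi> would make it grow exponentially in s, against the polynomial bound on
  \<open>T\<close>; so \<Psi> \<le> 0 eventually. Then T - 2\<Psi> dominates \<open>T\<close> and
  decays almost like exp(-2s), and \<open>T\<close> is quadratic in the unknowns.\<close>

lemma ode_decay:
  fixes p q U w :: "real \<Rightarrow> real"
  assumes lam: "lam > 0" and R0: "R0 > 0"
    and dq: "\<And>r. r > R0 \<Longrightarrow> (q has_real_derivative U r / r) (at r)"
    and dU: "\<And>r. r > R0 \<Longrightarrow> (U has_real_derivative q r / r - ((w r)\<^sup>2 - 1)) (at r)"
    and dw: "\<And>r. r > R0 \<Longrightarrow> (w has_real_derivative p r / (lam\<^sup>2 * r)) (at r)"
    and dp: "\<And>r. r > R0 \<Longrightarrow> (p has_real_derivative 2 * q r * w r) (at r)"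
    and wl: "(w \<longlongrightarrow> 1) at_top" and Ul: "((\<lambda>r. U r / r) \<longlongrightarrow> 0) at_top" and \<sigma>: "\<sigma> < 2"
  shows "U \<in> o[at_top](\<lambda>r. exp (- \<sigma> * sqrt (r / lam)))"
    "(\<lambda>r. w r - 1) \<in> o[at_top](\<lambda>r. exp (- \<sigma> * sqrt (r / lam)))"
proof -
  define \<tau> where "\<tau> r = sqrt (lam * r)" for r
  define s where "s r = 2 * sqrt (r / lam)" for r
  define \<alpha> where "\<alpha> r = lam * (w r - 1)" for r
  \<comment> \<open>\<open>A\<close> and \<open>B\<close> are the s-derivatives of \<alpha> and
    \<open>q\<close>, since ds/dr = 1/\<tau>.\<close>
  define A where "A r = p r / \<tau> r" for r
  define B where "B r = lam * U r / \<tau> r" for r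
  define v where "v r = w r - 1" for r
  \<comment> \<open>The damping coefficient from differentiating 1/\<tau>: it equals d\<tau>/dr. The
    coefficient \<mu> below stems from q/r in the equation for U, and \<open>v\<close> from the
    nonlinearity.\<close>
  define \<kappa> where "\<kappa> r = lam / (2 * \<tau> r)" for r
  define \<mu> where "\<mu> r = lam / r" for r
  define A1 where "A1 r = 2 * q r * (1 + v r) - A r * \<kappa> r" for r
  define B1 where "B1 r = \<mu> r * q r - \<alpha> r * (2 + v r) - B r * \<kappa> r" for r
  define T where "T r = (A r)\<^sup>2 + (B r)\<^sup>2 + 2 * ((\<alpha> r)\<^sup>2 + (q r)\<^sup>2)" for r
  define \<Psi> where "\<Psi> r = A r * (\<alpha> r + q r) + B r * (q r - \<alpha> r)" for r
  define \<Psi>1 where "\<Psi>1 r = A1 r * (\<alpha> r + q r) + A r * (A r + B r) + B1 r * (q r - \<alpha> r) + B r * (B r - A r)" for r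
  define T1 where "T1 r = 2 * A r * A1 r + 2 * B r * B1 r + 4 * (\<alpha> r * A r + q r * B r)" for r
  have \<tau>: "\<tau> r > 0" "\<tau> r * \<tau> r = lam * r" if "r > 0" for r using that lam by (auto simp: \<tau>_def)
  have d\<tau>: "(\<tau> has_real_derivative lam / (2 * \<tau> r)) (at r)" if "r > 0" for r
  proof -
    have "lam * r > 0" using that lam by simp
    moreover have "((\<lambda>r. lam * r) has_real_derivative lam) (at r)"
      using DERIV_cmult[OF DERIV_ident, of lam] by simp
    ultimately have "((\<lambda>r. sqrt (lam * r)) has_real_derivative inverse (sqrt (lam * r)) / 2 * lam) (at r)"
      by (intro DERIV_chain2[OF DERIV_real_sqrt])
    thus ?thesis unfolding \<tau>_def[abs_def] by (simp add: inverse_eq_divide mult.commute)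
  qed
  have ds: "(s has_real_derivative 1 / \<tau> r) (at r)" if "r > 0" for r
  proof -
    have "(s has_real_derivative 2 * (inverse (sqrt (r / lam)) / 2 * (1 / lam))) (at r)"
    proof -
      have "r / lam > 0" using that lam by simp
      moreover have "((\<lambda>r. r / lam) has_real_derivative 1 / lam) (at r)"
        by (rule DERIV_cdivide[OF DERIV_ident])
      ultimately show ?thesis
        unfolding s_def[abs_def] by (intro DERIV_cmult DERIV_chain2[OF DERIV_real_sqrt])
    qed
    moreover have "lam * sqrt (r / lam) = \<tau> r"
    proof -
      have l: "sqrt lam * sqrt lam = lam" "sqrt lam > 0" using lam by auto
      have k: "(k * k) * (t / k) = k * t" if "k > 0" for k t :: real using that by simp
      have "lam * sqrt (r / lam) = (sqrt lam * sqrt lam) * (sqrt r / sqrt lam)" by (simp only: l(1) real_sqrt_divide)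
      also have "\<dots> = sqrt lam * sqrt r" by (rule k[OF l(2)])
      finally show ?thesis by (simp add: \<tau>_def real_sqrt_mult)
    qed
    moreover have "2 * (inverse (sqrt (r / lam)) / 2 * (1 / lam)) = 1 / (lam * sqrt (r / lam))"
      by (simp add: field_simps)
    ultimately show ?thesis by simp
  qed
  have d\<alpha>: "(\<alpha> has_real_derivative A r / \<tau> r) (at r)" if r: "r > R0" for r
  proof -
    have r0: "r > 0" using r R0 by simp
    have "(\<alpha> has_real_derivative lam * (p r / (lam\<^sup>2 * r))) (at r)"
      unfolding \<alpha>_def[abs_def] by (rule derivative_eq_intros dw[OF r] refl | simp)+
    moreover have "A r / \<tau> r = lam * (p r / (lam\<^sup>2 * r))"
      using \<tau>[OF r0] lam r0 by (simp add: A_def power2_eq_square)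
    ultimately show ?thesis by simp
  qed
  have dq': "(q has_real_derivative B r / \<tau> r) (at r)" if r: "r > R0" for r
  proof -
    have r0: "r > 0" using r R0 by simp
    have "B r / \<tau> r = U r / r" using \<tau>[OF r0] lam r0 by (simp add: B_def)
    thus ?thesis using dq[OF r] by simp
  qed
  have dA: "(A has_real_derivative A1 r / \<tau> r) (at r)" if r: "r > R0" for r
  proof -
    have r0: "r > 0" using r R0 by simp
    have "(A has_real_derivative (2 * q r * w r * \<tau> r - p r * (lam / (2 * \<tau> r))) / (\<tau> r * \<tau> r)) (at r)"
      unfolding A_def[abs_def] by (rule DERIV_divide[OF dp[OF r] d\<tau>[OF r0]]) (use \<tau>[OF r0] in simp)
    moreover have "A1 r / \<tau> r = (2 * q r * w r * \<tau> r - p r * (lam / (2 * \<tau> r))) / (\<tau> r * \<tau> r)"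
      using \<tau>(1)[OF r0] by (simp add: A1_def A_def \<kappa>_def v_def field_simps)
    ultimately show ?thesis by simp
  qed
  have dB: "(B has_real_derivative B1 r / \<tau> r) (at r)" if r: "r > R0" for r
  proof -
    have r0: "r > 0" using r R0 by simp
    have "((\<lambda>r. lam * U r) has_real_derivative lam * (q r / r - ((w r)\<^sup>2 - 1))) (at r)"
      by (rule DERIV_cmult[OF dU[OF r]])
    hence "(B has_real_derivative (lam * (q r / r - ((w r)\<^sup>2 - 1)) * \<tau> r - lam * U r * (lam / (2 * \<tau> r))) / (\<tau> r * \<tau> r)) (at r)"
      unfolding B_def[abs_def] by (rule DERIV_divide[OF _ d\<tau>[OF r0]]) (use \<tau>[OF r0] in simp)
    moreover have "lam * (q r / r - ((w r)\<^sup>2 - 1)) = \<mu> r * q r - \<alpha> r * (2 + v r)"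
      by (simp add: \<mu>_def \<alpha>_def v_def power2_eq_square algebra_simps)
    moreover have "B1 r / \<tau> r = ((\<mu> r * q r - \<alpha> r * (2 + v r)) * \<tau> r - lam * U r * (lam / (2 * \<tau> r))) / (\<tau> r * \<tau> r)"
    proof -
      have "((\<mu> r * q r - \<alpha> r * (2 + v r)) * \<tau> r - lam * U r * (lam / (2 * \<tau> r))) / (\<tau> r * \<tau> r)
          = (\<mu> r * q r - \<alpha> r * (2 + v r)) / \<tau> r - (lam * U r / \<tau> r) * (lam / (2 * \<tau> r)) / \<tau> r"
        using \<tau>(1)[OF r0] by (simp add: diff_divide_distrib)
      thus ?thesis by (simp add: B1_def B_def \<kappa>_def diff_divide_distrib)
    qed
    ultimately show ?thesis by simp
  qed
  have d\<Psi>: "(\<Psi> has_real_derivative \<Psi>1 r / \<tau> r) (at r)" if r: "r > R0" for r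
    unfolding \<Psi>_def[abs_def] \<Psi>1_def
    by (rule derivative_eq_intros dA[OF r] dB[OF r] d\<alpha>[OF r] dq'[OF r] refl)+
       (simp add: algebra_simps add_divide_distrib diff_divide_distrib)
  have dT: "(T has_real_derivative T1 r / \<tau> r) (at r)" if r: "r > R0" for r
    unfolding T_def[abs_def] T1_def
    by (rule derivative_eq_intros dA[OF r] dB[OF r] d\<alpha>[OF r] dq'[OF r] refl)+
       (simp add: algebra_simps add_divide_distrib)
  have small: "\<exists>R>R0. \<forall>r\<ge>R. \<bar>v r\<bar> \<le> \<delta> \<and> \<bar>\<kappa> r\<bar> \<le> \<delta> \<and> \<bar>\<mu> r\<bar> \<le> \<delta>" if \<delta>: "\<delta> > 0" for \<delta>
  proof -
    have "((\<lambda>r. \<bar>v r\<bar>) \<longlongrightarrow> \<bar>1 - 1\<bar>) at_top" unfolding v_def by (intro tendsto_intros wl)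
    hence 1: "eventually (\<lambda>r. \<bar>v r\<bar> < \<delta>) at_top" using \<delta> by (intro order_tendstoD(2)) auto
    have "(\<kappa> \<longlongrightarrow> 0) at_top" unfolding \<kappa>_def[abs_def] \<tau>_def using lam by real_asymp
    hence "((\<lambda>r. \<bar>\<kappa> r\<bar>) \<longlongrightarrow> 0) at_top" by (rule tendsto_rabs_zero)
    hence 2: "eventually (\<lambda>r. \<bar>\<kappa> r\<bar> < \<delta>) at_top" using \<delta> by (intro order_tendstoD(2)) auto
    have "(\<mu> \<longlongrightarrow> 0) at_top" unfolding \<mu>_def[abs_def] using lam by real_asymp
    hence "((\<lambda>r. \<bar>\<mu> r\<bar>) \<longlongrightarrow> 0) at_top" by (rule tendsto_rabs_zero)
    hence 3: "eventually (\<lambda>r. \<bar>\<mu> r\<bar> < \<delta>) at_top" using \<delta> by (intro order_tendstoD(2)) auto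
    have "eventually (\<lambda>r. r > R0 \<and> \<bar>v r\<bar> \<le> \<delta> \<and> \<bar>\<kappa> r\<bar> \<le> \<delta> \<and> \<bar>\<mu> r\<bar> \<le> \<delta>) at_top"
      using 1 2 3 eventually_gt_at_top[of R0] by eventually_elim auto
    then obtain R where "\<And>r. r \<ge> R \<Longrightarrow> r > R0 \<and> \<bar>v r\<bar> \<le> \<delta> \<and> \<bar>\<kappa> r\<bar> \<le> \<delta> \<and> \<bar>\<mu> r\<bar> \<le> \<delta>"
      unfolding eventually_at_top_linorder by blast
    thus ?thesis by (intro exI[of _ R]) auto
  qed
  have modes: "\<bar>\<Psi>1 r - T r\<bar> \<le> 5 * \<delta> * T r" "\<bar>T1 r - 4 * \<Psi> r\<bar> \<le> 4 * \<delta> * T r" "2 * \<bar>\<Psi> r\<bar> \<le> T r"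
    if "\<bar>v r\<bar> \<le> \<delta>" "\<bar>\<kappa> r\<bar> \<le> \<delta>" "\<bar>\<mu> r\<bar> \<le> \<delta>" for r \<delta>
    using mode_inequalities[OF that, where q = "q r" and A = "A r" and \<alpha> = "\<alpha> r" and B = "B r"]
    unfolding \<Psi>1_def T_def T1_def \<Psi>_def A1_def B1_def by blast+
  have T0: "T r \<ge> 0" for r by (simp add: T_def)
  \<comment> \<open>U = o(r) bounds q' and gives q = O(r); as w stays bounded, p' = O(r) and p =
    O(r^2). The largest term of \<open>T\<close> is p^2/(lam r) = O(r^3), so r^4 suffices.\<close>
  obtain D R2 where poly: "\<And>r. r \<ge> R2 \<Longrightarrow> T r \<le> D * r ^ 4"
  proof -
    have "((\<lambda>r. \<bar>U r / r\<bar>) \<longlongrightarrow> 0) at_top" by (rule tendsto_rabs_zero[OF Ul])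
    hence 1: "eventually (\<lambda>r. \<bar>U r / r\<bar> < 1) at_top" by (rule order_tendstoD(2)) simp
    have "((\<lambda>r. \<bar>w r - 1\<bar>) \<longlongrightarrow> \<bar>1 - 1\<bar>) at_top" by (intro tendsto_intros wl)
    hence 2: "eventually (\<lambda>r. \<bar>w r - 1\<bar> < 1) at_top" by (rule order_tendstoD(2)) simp
    have "eventually (\<lambda>r. r > R0 \<and> r \<ge> 1 \<and> \<bar>U r / r\<bar> < 1 \<and> \<bar>w r - 1\<bar> < 1) at_top"
      using 1 2 eventually_gt_at_top[of R0] eventually_ge_at_top[of 1] by eventually_elim auto
    then obtain R where R: "\<And>r. r \<ge> R \<Longrightarrow> r > R0 \<and> r \<ge> 1 \<and> \<bar>U r / r\<bar> < 1 \<and> \<bar>w r - 1\<bar> < 1"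
      unfolding eventually_at_top_linorder by blast
    define cq where "cq = \<bar>q R\<bar> + 1"
    define cp where "cp = \<bar>p R\<bar> + 4 * cq"
    have cq0: "cq \<ge> 0" "cp \<ge> 0" by (auto simp: cq_def cp_def)
    have R1: "R \<ge> 1" using R[of R] by simp
    have qb: "\<bar>q r\<bar> \<le> cq * r" if r: "r \<ge> R" for r
    proof -
      have "\<bar>q r\<bar> \<le> \<bar>q R\<bar> + 1 * (r - R)"
        by (rule abs_le_of_deriv_bound[where f' = "\<lambda>r. U r / r"]) (use r R dq in \<open>auto simp: less_imp_le\<close>)
      also have "\<dots> \<le> \<bar>q R\<bar> * r + 1 * r" using r R1 mult_left_mono[of 1 r "\<bar>q R\<bar>"] by simp
      finally show ?thesis by (simp add: cq_def distrib_right)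
    qed
    have pb: "\<bar>p r\<bar> \<le> cp * r\<^sup>2" if r: "r \<ge> R" for r
    proof -
      have "\<bar>p r\<bar> \<le> \<bar>p R\<bar> + (4 * cq * r) * (r - R)"
      proof (rule abs_le_of_deriv_bound[where f' = "\<lambda>r. 2 * q r * w r"])
        fix t assume t: "R \<le> t" "t \<le> r"
        show "(p has_real_derivative 2 * q t * w t) (at t)" by (rule dp) (use R t in auto)
        have "\<bar>q t\<bar> \<le> cq * r" using qb[OF t(1)] mult_left_mono[OF t(2) cq0(1)] by linarith
        moreover have "\<bar>w t\<bar> \<le> 2" using R[OF t(1)] by linarith
        ultimately have "\<bar>q t\<bar> * \<bar>w t\<bar> \<le> (cq * r) * 2" using cq0 r R1 by (intro mult_mono) auto
        thus "\<bar>2 * q t * w t\<bar> \<le> 4 * cq * r" by (simp add: abs_mult)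
      qed (use r in auto)
      also have "\<dots> \<le> \<bar>p R\<bar> * r\<^sup>2 + (4 * cq * r) * r"
      proof (intro add_mono mult_left_mono)
        have "1 \<le> r\<^sup>2" using r R1 by simp
        thus "\<bar>p R\<bar> \<le> \<bar>p R\<bar> * r\<^sup>2" using mult_left_mono[of 1 "r\<^sup>2" "\<bar>p R\<bar>"] by simp
      qed (use r R1 cq0 in auto)
      finally show ?thesis by (simp add: cp_def algebra_simps power2_eq_square)
    qed
    define D where "D = cp\<^sup>2 / lam + lam + 2 * (lam\<^sup>2 + cq\<^sup>2)"
    have "T r \<le> D * r ^ 4" if r: "r \<ge> R" for r
    proof -
      have r1: "r \<ge> 1" "r > 0" using r R1 by auto
      have pw: "r ^ 3 \<le> r ^ 4" "r ^ 2 \<le> r ^ 4" "r ^ 1 \<le> r ^ 4" "r ^ 0 \<le> r ^ 4"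
        by (rule power_increasing; use r1 in simp)+
      have "(p r)\<^sup>2 \<le> (cp * r\<^sup>2)\<^sup>2" using power_mono[OF pb[OF r], of 2] by simp
      hence "(p r)\<^sup>2 / (lam * r) \<le> (cp * r\<^sup>2)\<^sup>2 / (lam * r)" using lam r1 by (intro divide_right_mono) auto
      also have "\<dots> = cp\<^sup>2 / lam * r ^ 3" using lam r1 by (simp add: field_simps power2_eq_square power3_eq_cube)
      also have "\<dots> \<le> cp\<^sup>2 / lam * r ^ 4" using lam pw by (intro mult_left_mono) auto
      finally have a: "(A r)\<^sup>2 \<le> cp\<^sup>2 / lam * r ^ 4"
        using \<tau>[OF r1(2)] by (simp add: A_def power_divide power2_eq_square)
      have "\<bar>U r\<bar> \<le> r" using R[OF r] r1 by (simp add: abs_divide)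
      hence "(U r)\<^sup>2 \<le> r\<^sup>2" using power_mono[of "\<bar>U r\<bar>" r 2] by simp
      hence "lam\<^sup>2 * (U r)\<^sup>2 / (lam * r) \<le> lam\<^sup>2 * r\<^sup>2 / (lam * r)"
        using lam r1 by (intro divide_right_mono mult_left_mono) auto
      also have "\<dots> = lam * r ^ 1" using lam r1 by (simp add: power2_eq_square)
      also have "\<dots> \<le> lam * r ^ 4" using lam pw by (intro mult_left_mono) auto
      also have "lam\<^sup>2 * (U r)\<^sup>2 / (lam * r) = (B r)\<^sup>2"
        unfolding B_def power_divide power_mult_distrib \<tau>(2)[OF r1(2), folded power2_eq_square] ..
      finally have b: "(B r)\<^sup>2 \<le> lam * r ^ 4" .
      have "(w r - 1)\<^sup>2 \<le> 1\<^sup>2" using R[OF r] power_mono[of "\<bar>w r - 1\<bar>" 1 2] by simp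
      hence "(\<alpha> r)\<^sup>2 \<le> lam\<^sup>2 * r ^ 0" by (simp add: \<alpha>_def power_mult_distrib mult_left_le)
      also have "\<dots> \<le> lam\<^sup>2 * r ^ 4" using pw by (intro mult_left_mono) auto
      finally have c: "(\<alpha> r)\<^sup>2 \<le> lam\<^sup>2 * r ^ 4" .
      have "(q r)\<^sup>2 \<le> (cq * r)\<^sup>2" using power_mono[OF qb[OF r], of 2] by simp
      also have "\<dots> = cq\<^sup>2 * r ^ 2" by (simp add: power_mult_distrib)
      also have "\<dots> \<le> cq\<^sup>2 * r ^ 4" using pw by (intro mult_left_mono) auto
      finally have d: "(q r)\<^sup>2 \<le> cq\<^sup>2 * r ^ 4" .
      have "T r \<le> cp\<^sup>2 / lam * r ^ 4 + lam * r ^ 4 + 2 * (lam\<^sup>2 * r ^ 4 + cq\<^sup>2 * r ^ 4)"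
        unfolding T_def using a b c d by (intro add_mono mult_left_mono) auto
      also have "\<dots> = D * r ^ 4" by (simp add: D_def algebra_simps)
      finally show ?thesis .
    qed
    thus thesis by (rule that)
  qed
  obtain R1 where R1: "R1 > R0" "\<And>r. r \<ge> R1 \<Longrightarrow> \<Psi> r \<le> 0"
  proof -
    \<comment> \<open>With 1/10 the error 5\<delta>T is T/2, so the s-derivative of \<Psi> is at
      least T/2 \<ge> \<Psi>.\<close>
    obtain R where R: "R > R0" "\<And>r. r \<ge> R \<Longrightarrow> \<bar>v r\<bar> \<le> 1/10 \<and> \<bar>\<kappa> r\<bar> \<le> 1/10 \<and> \<bar>\<mu> r\<bar> \<le> 1/10"
      using small[of "1/10"] by auto
    have "\<Psi> r0 \<le> 0" if r0: "r0 \<ge> R" for r0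
    proof (rule ccontr)
      assume "\<not> \<Psi> r0 \<le> 0"
      hence pos: "\<Psi> r0 * exp (- s r0) > 0" by simp
      \<comment> \<open>Thus \<Psi> grows at least like exp(s), faster than any power of r.\<close>
      have grow: "\<Psi> r0 * exp (- s r0) \<le> \<Psi> r * exp (- s r)" if r: "r \<ge> r0" for r
      proof (rule DERIV_nonneg_imp_nondecreasing[OF r])
        fix x assume x: "r0 \<le> x" "x \<le> r"
        have xR: "x \<ge> R" "x > R0" "x > 0" using x r0 R(1) R0 by auto
        have sm: "\<bar>v x\<bar> \<le> 1/10" "\<bar>\<kappa> x\<bar> \<le> 1/10" "\<bar>\<mu> x\<bar> \<le> 1/10" using R(2)[OF xR(1)] by auto
        have "((\<lambda>r. \<Psi> r * exp (- s r)) has_real_derivative (\<Psi>1 x - \<Psi> x) / \<tau> x * exp (- s x)) (at x)"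
          by (rule derivative_eq_intros d\<Psi>[OF xR(2)] ds[OF xR(3)] refl)+ (simp add: algebra_simps diff_divide_distrib)
        moreover have "\<Psi>1 x - \<Psi> x \<ge> 0" using modes[OF sm] by linarith
        hence "(\<Psi>1 x - \<Psi> x) / \<tau> x * exp (- s x) \<ge> 0" using \<tau>(1)[OF xR(3)] by simp
        ultimately show "\<exists>y. ((\<lambda>r. \<Psi> r * exp (- s r)) has_real_derivative y) (at x) \<and> 0 \<le> y" by blast
      qed
      have "((\<lambda>r. D * r ^ 4 * exp (- s r)) \<longlongrightarrow> 0) at_top"
      proof -
        have "((\<lambda>r. r ^ 4 * exp (- (2 * sqrt (r / lam)))) \<longlongrightarrow> 0) at_top" using lam by real_asymp
        from tendsto_mult[OF tendsto_const this, of D] show ?thesis by (simp add: s_def mult.assoc)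
      qed
      hence "eventually (\<lambda>r. D * r ^ 4 * exp (- s r) < \<Psi> r0 * exp (- s r0)) at_top"
        using pos by (intro order_tendstoD(2)) auto
      hence "eventually (\<lambda>r. D * r ^ 4 * exp (- s r) < \<Psi> r0 * exp (- s r0) \<and> r \<ge> r0 \<and> r \<ge> R2) at_top"
        using eventually_ge_at_top[of r0] eventually_ge_at_top[of R2] by eventually_elim auto
      then obtain r where r: "D * r ^ 4 * exp (- s r) < \<Psi> r0 * exp (- s r0)" "r \<ge> r0" "r \<ge> R2"
        using eventually_happens[of _ at_top] trivial_limit_at_top_linorder by (metis (mono_tags, lifting))
      have "2 * \<bar>\<Psi> r\<bar> \<le> T r" by (rule modes(3)[of r "1/10"]) (use R(2)[of r] r(2) r0 in auto)
      hence "\<Psi> r \<le> T r" using T0[of r] by linarith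
      also have "\<dots> \<le> D * r ^ 4" by (rule poly[OF r(3)])
      finally have "\<Psi> r * exp (- s r) \<le> D * r ^ 4 * exp (- s r)" by (intro mult_right_mono) auto
      thus False using grow[OF r(2)] r(1) by linarith
    qed
    thus thesis using that R(1) by blast
  qed
  \<comment> \<open>So \<sigma> = 2 - 2\<epsilon>: one \<epsilon> is spent on the errors, the other
    leaves the vanishing factor exp(-\<epsilon> sqrt(r/lam)).\<close>
  define \<epsilon> where "\<epsilon> = (2 - \<sigma>) / 2"
  have \<epsilon>: "\<epsilon> > 0" using \<sigma> by (simp add: \<epsilon>_def)
  \<comment> \<open>In T - 2\<Psi> the error is 4\<delta>T + 2 * 5\<delta>T = 14\<delta>T, which is
    \<epsilon>T for \<delta> = \<epsilon>/14.\<close>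
  obtain R3 where R3: "R3 > R0" "\<And>r. r \<ge> R3 \<Longrightarrow> \<bar>v r\<bar> \<le> \<epsilon>/14 \<and> \<bar>\<kappa> r\<bar> \<le> \<epsilon>/14 \<and> \<bar>\<mu> r\<bar> \<le> \<epsilon>/14"
    using small[of "\<epsilon>/14"] \<epsilon> by auto
  define R where "R = max R1 R3"
  define C where "C = (T R - 2 * \<Psi> R) * exp ((2 - \<epsilon>) * s R)"
  have decay: "T r \<le> C * exp (- ((2 - \<epsilon>) * s r))" if r: "r \<ge> R" for r
  proof -
    have "(T r - 2 * \<Psi> r) * exp ((2 - \<epsilon>) * s r) \<le> C"
      unfolding C_def
    proof (rule DERIV_nonpos_imp_nonincreasing[OF r])
      fix x assume x: "R \<le> x" "x \<le> r"
      have xR: "x \<ge> R1" "x \<ge> R3" "x > R0" "x > 0" using x R1(1) R3(1) R0 by (auto simp: R_def)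
      have sm: "\<bar>v x\<bar> \<le> \<epsilon>/14" "\<bar>\<kappa> x\<bar> \<le> \<epsilon>/14" "\<bar>\<mu> x\<bar> \<le> \<epsilon>/14" using R3(2)[OF xR(2)] by auto
      have "((\<lambda>r. (T r - 2 * \<Psi> r) * exp ((2 - \<epsilon>) * s r)) has_real_derivative
          ((T1 x - 2 * \<Psi>1 x) + (2 - \<epsilon>) * (T x - 2 * \<Psi> x)) / \<tau> x * exp ((2 - \<epsilon>) * s x)) (at x)"
        by (rule derivative_eq_intros dT[OF xR(3)] d\<Psi>[OF xR(3)] ds[OF xR(4)] refl)+
           (simp add: algebra_simps diff_divide_distrib add_divide_distrib)
      \<comment> \<open>Everything cancels up to 2\<epsilon>\<Psi>, which is where \<Psi> \<le> 0 is
        used.\<close>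
      moreover have "(T1 x - 2 * \<Psi>1 x) + (2 - \<epsilon>) * (T x - 2 * \<Psi> x) \<le> 0"
      proof -
        have e: "4 * (\<epsilon> / 14) * T x = 4 * (\<epsilon> * T x / 14)" "5 * (\<epsilon> / 14) * T x = 5 * (\<epsilon> * T x / 14)" by simp_all
        have "T1 x - 2 * \<Psi>1 x \<le> 4 * \<Psi> x - 2 * T x + \<epsilon> * T x"
          using modes(1,2)[OF sm] unfolding e by linarith
        moreover have "(2 - \<epsilon>) * (T x - 2 * \<Psi> x) = 2 * T x - 4 * \<Psi> x - \<epsilon> * T x + 2 * (\<epsilon> * \<Psi> x)" by (simp add: algebra_simps)
        moreover have "\<epsilon> * \<Psi> x \<le> 0" using \<epsilon> R1(2)[OF xR(1)] by (simp add: mult_le_0_iff)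
        ultimately show ?thesis by linarith
      qed
      hence "((T1 x - 2 * \<Psi>1 x) + (2 - \<epsilon>) * (T x - 2 * \<Psi> x)) / \<tau> x * exp ((2 - \<epsilon>) * s x) \<le> 0"
        using \<tau>(1)[OF xR(4)] by (intro mult_nonpos_nonneg divide_nonpos_pos) auto
      ultimately show "\<exists>y. ((\<lambda>r. (T r - 2 * \<Psi> r) * exp ((2 - \<epsilon>) * s r)) has_real_derivative y) (at x) \<and> y \<le> 0" by blast
    qed
    moreover have "T r * exp ((2 - \<epsilon>) * s r) \<le> (T r - 2 * \<Psi> r) * exp ((2 - \<epsilon>) * s r)"
      using R1(2)[of r] r by (intro mult_right_mono) (auto simp: R_def)
    ultimately have "T r * exp ((2 - \<epsilon>) * s r) \<le> C" by linarith
    hence "T r \<le> C / exp ((2 - \<epsilon>) * s r)" by (simp add: field_simps)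
    thus ?thesis by (simp add: exp_minus divide_inverse)
  qed
  have C0: "C \<ge> 0"
  proof -
    have "0 \<le> T R * exp ((2 - \<epsilon>) * s R)" using T0 by simp
    also have "\<dots> \<le> C * exp (- ((2 - \<epsilon>) * s R)) * exp ((2 - \<epsilon>) * s R)" by (rule mult_right_mono[OF decay]) auto
    finally show ?thesis by (simp add: mult.assoc exp_minus)
  qed
  have comp: "\<bar>y\<bar> \<le> sqrt C * exp (- ((2 - \<epsilon>) * sqrt (r / lam)))" if "r \<ge> R" "y\<^sup>2 \<le> T r" for r y
  proof -
    \<comment> \<open>Since s is twice sqrt(r/lam), taking the square root of the bound on
      \<open>T\<close> turns s back into sqrt(r/lam) with the same factor 2 - \<epsilon>.\<close>
    have "(exp (- ((2 - \<epsilon>) * sqrt (r / lam))))\<^sup>2 = exp (- ((2 - \<epsilon>) * s r))"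
      by (simp add: s_def power2_eq_square exp_add[symmetric] algebra_simps)
    hence "\<bar>y\<bar>\<^sup>2 \<le> (sqrt C * exp (- ((2 - \<epsilon>) * sqrt (r / lam))))\<^sup>2"
      using decay[OF that(1)] that(2) C0 by (simp add: power_mult_distrib)
    thus ?thesis by (rule power2_le_imp_le) (use C0 in auto)
  qed
  have quot: "exp (- ((2 - \<epsilon>) * x)) / exp (- \<sigma> * x) = exp (- (\<epsilon> * x))" for x
    by (simp add: exp_diff[symmetric] \<epsilon>_def field_simps)
  show "(\<lambda>r. w r - 1) \<in> o[at_top](\<lambda>r. exp (- \<sigma> * sqrt (r / lam)))"
  proof (rule smalloI_tendsto)
    have lim: "((\<lambda>r. sqrt C / lam * exp (- (\<epsilon> * sqrt (r / lam)))) \<longlongrightarrow> 0) at_top"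
      using lam \<epsilon> by real_asymp
    show "((\<lambda>r. (w r - 1) / exp (- \<sigma> * sqrt (r / lam))) \<longlongrightarrow> 0) at_top"
    proof (rule Lim_null_comparison[OF _ lim])
      show "\<forall>\<^sub>F r in at_top. norm ((w r - 1) / exp (- \<sigma> * sqrt (r / lam))) \<le> sqrt C / lam * exp (- (\<epsilon> * sqrt (r / lam)))"
        using eventually_ge_at_top[of R]
      proof eventually_elim
        case (elim r)
        have "\<bar>\<alpha> r\<bar> \<le> sqrt C * exp (- ((2 - \<epsilon>) * sqrt (r / lam)))" by (rule comp[OF elim]) (simp add: T_def)
        moreover have "\<bar>\<alpha> r\<bar> = lam * \<bar>w r - 1\<bar>" using lam unfolding \<alpha>_def abs_mult by simp
        ultimately have "\<bar>w r - 1\<bar> \<le> sqrt C * exp (- ((2 - \<epsilon>) * sqrt (r / lam))) / lam"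
          using lam by (simp only: pos_le_divide_eq mult.commute)
        hence "\<bar>w r - 1\<bar> \<le> sqrt C / lam * exp (- ((2 - \<epsilon>) * sqrt (r / lam)))"
          by (simp only: times_divide_eq_left)
        hence "\<bar>w r - 1\<bar> / exp (- \<sigma> * sqrt (r / lam)) \<le> sqrt C / lam * exp (- ((2 - \<epsilon>) * sqrt (r / lam))) / exp (- \<sigma> * sqrt (r / lam))"
          by (rule divide_right_mono) simp
        also have "\<dots> = sqrt C / lam * exp (- (\<epsilon> * sqrt (r / lam)))" unfolding times_divide_eq_right[symmetric] quot ..
        finally show ?case by simp
      qed
    qed
  qed simp
  show "U \<in> o[at_top](\<lambda>r. exp (- \<sigma> * sqrt (r / lam)))"
  proof (rule smalloI_tendsto)
    \<comment> \<open>U is recovered from \<open>B\<close> at the cost of a factor \<tau> = sqrt(lam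
      r), which the spare exponential absorbs.\<close>
    have lim: "((\<lambda>r. sqrt C / lam * sqrt (lam * r) * exp (- (\<epsilon> * sqrt (r / lam)))) \<longlongrightarrow> 0) at_top"
    proof -
      have "((\<lambda>r. sqrt (lam * r) * exp (- (\<epsilon> * sqrt (r / lam)))) \<longlongrightarrow> 0) at_top" using lam \<epsilon> by real_asymp
      from tendsto_mult[OF tendsto_const this, of "sqrt C / lam"] show ?thesis by (simp add: mult.assoc)
    qed
    show "((\<lambda>r. U r / exp (- \<sigma> * sqrt (r / lam))) \<longlongrightarrow> 0) at_top"
    proof (rule Lim_null_comparison[OF _ lim])
      show "\<forall>\<^sub>F r in at_top. norm (U r / exp (- \<sigma> * sqrt (r / lam))) \<le> sqrt C / lam * sqrt (lam * r) * exp (- (\<epsilon> * sqrt (r / lam)))"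
        using eventually_ge_at_top[of R]
      proof eventually_elim
        case (elim r)
        have r0: "r > 0" using elim R1(1) R0 by (simp add: R_def)
        have "\<bar>B r\<bar> \<le> sqrt C * exp (- ((2 - \<epsilon>) * sqrt (r / lam)))" by (rule comp[OF elim]) (simp add: T_def)
        moreover have "\<bar>B r\<bar> = lam * \<bar>U r\<bar> / \<tau> r" using lam \<tau>(1)[OF r0] by (simp add: B_def abs_mult abs_divide)
        ultimately have "lam * \<bar>U r\<bar> / \<tau> r \<le> sqrt C * exp (- ((2 - \<epsilon>) * sqrt (r / lam)))" by simp
        hence "lam * \<bar>U r\<bar> \<le> sqrt C * exp (- ((2 - \<epsilon>) * sqrt (r / lam))) * \<tau> r"
          using \<tau>(1)[OF r0] by (simp only: pos_divide_le_eq)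
        hence "\<bar>U r\<bar> \<le> sqrt C * exp (- ((2 - \<epsilon>) * sqrt (r / lam))) * \<tau> r / lam"
          using lam by (simp only: pos_le_divide_eq mult.commute)
        hence "\<bar>U r\<bar> \<le> sqrt C / lam * sqrt (lam * r) * exp (- ((2 - \<epsilon>) * sqrt (r / lam)))"
          by (simp add: \<tau>_def mult_ac)
        hence "\<bar>U r\<bar> / exp (- \<sigma> * sqrt (r / lam)) \<le> sqrt C / lam * sqrt (lam * r) * exp (- ((2 - \<epsilon>) * sqrt (r / lam))) / exp (- \<sigma> * sqrt (r / lam))"
          by (rule divide_right_mono) simp
        also have "\<dots> = sqrt C / lam * sqrt (lam * r) * exp (- (\<epsilon> * sqrt (r / lam)))" unfolding times_divide_eq_right[symmetric] quot ..
        finally show ?case by simp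
      qed
    qed
  qed simp
qed

theorem theorem1:
  fixes lam :: real and \<psi> :: "real \<Rightarrow> real"
  assumes "lam > 0" and "cutoff \<psi>"
  shows
    "(\<forall>(u, w) \<in> admissible lam.
        (\<forall>R>0. set_integrable lborel {0<..<R} (renormalized_density lam \<psi> u w)) \<and>
        (\<exists>L::ereal. L \<noteq> -\<infinity> \<and>
           ((\<lambda>R. ereal (truncated_energy lam \<psi> u w R)) \<longlongrightarrow> L) at_top)) \<and>
     (\<exists>C::real. \<forall>(u, w) \<in> admissible lam. ereal C \<le> energy lam \<psi> u w) \<and>
     (\<exists>u w. is_minimizer lam \<psi> u w \<and> (\<forall>r>0. w r \<ge> 0) \<and> energy lam \<psi> u w < \<infinity>) \<and>
     (\<forall>u w. is_minimizer lam \<psi> u w \<and> (\<forall>r>0. w r \<ge> 0) \<longrightarrow>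
        (\<forall>\<sigma>::real. \<sigma> < 2 \<longrightarrow>
           (\<lambda>r. u r - lam\<^sup>2 / (2 * r)) \<in> o[at_top](\<lambda>r. exp (- \<sigma> * sqrt (r / lam))) \<and>
           (\<lambda>r. w r - 1) \<in> o[at_top](\<lambda>r. exp (- \<sigma> * sqrt (r / lam)))))"
proof (intro conjI)
  note lam = assms(1) and \<psi> = assms(2)
  have well_defined: "(\<forall>R>0. set_integrable lborel {0<..<R} (renormalized_density lam \<psi> u w)) \<and>
        (\<exists>L::ereal. L \<noteq> -\<infinity> \<and> ((\<lambda>R. ereal (truncated_energy lam \<psi> u w R)) \<longlongrightarrow> L) at_top)"
    if adm: "(u, w) \<in> admissible lam" for u w
  proof (intro conjI allI impI)
    fix R :: real
    \<comment> \<open>The energy formula needs a radius beyond \<open>lam\<close>; smaller radii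
      follow by restriction.\<close>
    have "set_integrable lborel {0<..<max R (2 * lam)} (renormalized_density lam \<psi> u w)"
      by (rule truncated_energy_formula(1)[OF lam \<psi> adm]) (use lam in auto)
    thus "set_integrable lborel {0<..<R} (renormalized_density lam \<psi> u w)"
      by (rule set_integrable_subset) auto
    have "enn2ereal (sq_energy lam u (weak_deriv u) w (weak_deriv w)) + ereal (lam * u lam - counterterm lam \<psi>) \<noteq> -\<infinity>"
      using enn2ereal_nonneg[of "sq_energy lam u (weak_deriv u) w (weak_deriv w)"] by auto
    thus "\<exists>L::ereal. L \<noteq> -\<infinity> \<and> ((\<lambda>R. ereal (truncated_energy lam \<psi> u w R)) \<longlongrightarrow> L) at_top"
      using truncated_energy_tendsto[OF lam \<psi> adm] by blast
  qed
  show "\<forall>(u, w) \<in> admissible lam.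
        (\<forall>R>0. set_integrable lborel {0<..<R} (renormalized_density lam \<psi> u w)) \<and>
        (\<exists>L::ereal. L \<noteq> -\<infinity> \<and> ((\<lambda>R. ereal (truncated_energy lam \<psi> u w R)) \<longlongrightarrow> L) at_top)"
  proof (rule ballI)
    fix x assume x: "x \<in> admissible lam"
    obtain u w where uw: "x = (u, w)" by (cases x)
    show "case x of (u, w) \<Rightarrow> (\<forall>R>0. set_integrable lborel {0<..<R} (renormalized_density lam \<psi> u w)) \<and>
        (\<exists>L::ereal. L \<noteq> -\<infinity> \<and> ((\<lambda>R. ereal (truncated_energy lam \<psi> u w R)) \<longlongrightarrow> L) at_top)"
      unfolding uw prod.case by (rule well_defined[OF x[unfolded uw]])
  qed
  have bounded: "ereal (- 4 * lam\<^sup>2 - counterterm lam \<psi>) \<le> energy lam \<psi> u w" if adm: "(u, w) \<in> admissible lam" for u w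
  proof (cases "sq_energy lam u (weak_deriv u) w (weak_deriv w) = \<infinity>")
    case True
    thus ?thesis using energy_eq[OF lam \<psi> adm] by simp
  next
    case False
    then obtain N where N: "sq_energy lam u (weak_deriv u) w (weak_deriv w) = ennreal N" "N \<ge> 0"
      by (cases "sq_energy lam u (weak_deriv u) w (weak_deriv w)") auto
    have p: "primitive u (weak_deriv u)" "primitive w (weak_deriv w)"
      using admissible_W12[OF adm] W12_loc_primitive by auto
    have "- N / 2 - 4 * lam\<^sup>2 \<le> lam * u lam" by (rule boundary_value_bound[OF lam p N])
    thus ?thesis using energy_eq[OF lam \<psi> adm] N by simp
  qed
  show "\<exists>C::real. \<forall>(u, w) \<in> admissible lam. ereal C \<le> energy lam \<psi> u w"
  proof (rule exI[of _ "- 4 * lam\<^sup>2 - counterterm lam \<psi>"], rule ballI)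
    fix x assume x: "x \<in> admissible lam"
    obtain u w where uw: "x = (u, w)" by (cases x)
    show "case x of (u, w) \<Rightarrow> ereal (- 4 * lam\<^sup>2 - counterterm lam \<psi>) \<le> energy lam \<psi> u w"
      unfolding uw prod.case by (rule bounded[OF x[unfolded uw]])
  qed
  show ex: "\<exists>u w. is_minimizer lam \<psi> u w \<and> (\<forall>r>0. w r \<ge> 0) \<and> energy lam \<psi> u w < \<infinity>"
    by (rule minimizer_exists[OF lam \<psi>])
  show "\<forall>u w. is_minimizer lam \<psi> u w \<and> (\<forall>r>0. w r \<ge> 0) \<longrightarrow>
        (\<forall>\<sigma>::real. \<sigma> < 2 \<longrightarrow>
           (\<lambda>r. u r - lam\<^sup>2 / (2 * r)) \<in> o[at_top](\<lambda>r. exp (- \<sigma> * sqrt (r / lam))) \<and>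
           (\<lambda>r. w r - 1) \<in> o[at_top](\<lambda>r. exp (- \<sigma> * sqrt (r / lam))))"
  proof (intro allI impI)
    fix u w and \<sigma> :: real
    assume *: "is_minimizer lam \<psi> u w \<and> (\<forall>r>0. w r \<ge> 0)" and \<sigma>: "\<sigma> < 2"
    have adm: "(u, w) \<in> admissible lam" and nn: "\<And>r. r > 0 \<Longrightarrow> w r \<ge> 0"
      and least: "\<And>v y. (v, y) \<in> admissible lam \<Longrightarrow> energy lam \<psi> u w \<le> energy lam \<psi> v y"
      using * by (auto simp: is_minimizer_def)
    have p: "primitive u (weak_deriv u)" "primitive w (weak_deriv w)"
      using admissible_W12[OF adm] W12_loc_primitive by auto
    \<comment> \<open>An arbitrary minimizer has finite energy by comparison with the one already
      constructed, which is what gives access to the square energy.\<close>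
    obtain u0 w0 where "(u0, w0) \<in> admissible lam" "energy lam \<psi> u0 w0 < \<infinity>"
      using ex by (auto simp: is_minimizer_def)
    hence "energy lam \<psi> u w < \<infinity>" using least by (meson le_less_trans)
    hence fin: "sq_energy lam u (weak_deriv u) w (weak_deriv w) < \<infinity>"
      unfolding energy_eq[OF lam \<psi> adm] by (cases "sq_energy lam u (weak_deriv u) w (weak_deriv w)") auto
    then obtain N where N: "sq_energy lam u (weak_deriv u) w (weak_deriv w) = ennreal N" "N \<ge> 0"
      by (cases "sq_energy lam u (weak_deriv u) w (weak_deriv w)") auto
    have sqm: "sq_minimal lam u (weak_deriv u) w (weak_deriv w) N"
      unfolding sq_minimal_def
    proof (intro conjI p N allI impI)
      fix v v' y y' M
      assume v: "primitive v v'" and y: "primitive y y'" and M: "sq_energy lam v v' y y' = ennreal M" "0 \<le> M"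
      have adm': "(v, y) \<in> admissible lam"
        by (rule finite_sq_energy_admissible[OF lam v y]) (simp add: M)
      have "energy lam \<psi> u w \<le> energy lam \<psi> v y" by (rule least[OF adm'])
      thus "N + lam * u lam \<le> M + lam * v lam"
        unfolding energy_eq[OF lam \<psi> adm] energy_eq[OF lam \<psi> adm'] sq_energy_weak_deriv[OF v y] using N M by simp
    qed
    show "(\<lambda>r. u r - lam\<^sup>2 / (2 * r)) \<in> o[at_top](\<lambda>r. exp (- \<sigma> * sqrt (r / lam))) \<and>
           (\<lambda>r. w r - 1) \<in> o[at_top](\<lambda>r. exp (- \<sigma> * sqrt (r / lam)))"
    proof (rule euler_lagrange_system[OF sqm lam])
      fix P Q
      assume sys: "\<And>r. r > 2 * lam \<Longrightarrow> (Q has_real_derivative (u r - lam\<^sup>2 / (2 * r)) / r) (at r)"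
        "\<And>r. r > 2 * lam \<Longrightarrow> ((\<lambda>r. u r - lam\<^sup>2 / (2 * r)) has_real_derivative Q r / r - ((w r)\<^sup>2 - 1)) (at r)"
        "\<And>r. r > 2 * lam \<Longrightarrow> (w has_real_derivative P r / (lam\<^sup>2 * r)) (at r)"
        "\<And>r. r > 2 * lam \<Longrightarrow> (P has_real_derivative 2 * Q r * w r) (at r)"
      have "2 * lam > 0" using lam by simp
      note d = ode_decay[OF lam this sys minimizer_w_tendsto_1[OF lam adm fin nn] excess_sublinear[OF lam p fin] \<sigma>]
      show ?thesis by (rule conjI[OF d])
    qed
  qed
qed

end
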